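(* There is no algorithm that, for every first-order sentence $\varphi$ of vocabulary $\{E\}$ which is equivalent on finite graphs to some universal sentence, computes a universal sentence $\mu$ with $\mathrm{Graph}_{\mathrm{fin}}(\varphi)=\mathrm{Graph}_{\mathrm{fin}}(\mu)$. Equivalently, there is no algorithm that, for every first-order sentence $\varphi$ such that $\mathrm{Graph}_{\mathrm{fin}}(\varphi)=\mathrm{Forb}_{\mathrm{fin}}(\mathcal F)$ for some finite set $\mathcal F$ of finite graphs, computes such a set $\mathcal F$.
   Context: Graphs are $\{E\}$-structures with $E$ binary, irreflexive and symmetric. $\mathrm{Graph}_{\mathrm{fin}}(\varphi)$ is the class of finite graphs that are models of $\varphi$. For a finite set $\mathcal F$ of finite graphs, $\mathrm{Forb}_{\mathrm{fin}}(\mathcal F)$ is the class of finite graphs with no induced subgraph isomorphic to a graph in $\mathcal F$. A first-order formula is universal if it is built from atomic and negated atomic formulas using $\wedge$, $\vee$ and $\forall$. *)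

theory Defs
  imports "HOL-Library.Nat_Bijection"
begin

section \<open>Graphs\<close>

datatype 'a graph = Graph (verts: "'a set") (edges: "('a \<times> 'a) set")

text \<open>As usual for first-order structures, the universe is nonempty.\<close>

definition is_graph :: "'a graph \<Rightarrow> bool" where
  "is_graph G \<longleftrightarrow> verts G \<noteq> {} \<and> edges G \<subseteq> verts G \<times> verts G \<and> irrefl (edges G) \<and> sym (edges G)"

text \<open>Classes of finite graphs are represented by sets of graphs whose vertices are natural
  numbers. Every finite graph is isomorphic to one of these, and all the classes considered are
  closed under isomorphism.\<close>

definition fin_graphs :: "nat graph set" where
  "fin_graphs = {G. is_graph G \<and> finite (verts G)}"

definition induced :: "'a graph \<Rightarrow> 'a set \<Rightarrow> 'a graph" where
  "induced G W = Graph W (edges G \<inter> W \<times> W)"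

definition isomorphic :: "'a graph \<Rightarrow> 'b graph \<Rightarrow> bool" where
  "isomorphic G H \<longleftrightarrow> (\<exists>h. bij_betw h (verts G) (verts H) \<and>
     (\<forall>u\<in>verts G. \<forall>v\<in>verts G. (u, v) \<in> edges G \<longleftrightarrow> (h u, h v) \<in> edges H))"

definition Forb_fin :: "nat graph set \<Rightarrow> nat graph set" where
  "Forb_fin \<F> = {G \<in> fin_graphs. \<not> (\<exists>W. W \<noteq> {} \<and> W \<subseteq> verts G \<and> (\<exists>H\<in>\<F>. isomorphic (induced G W) H))}"


section \<open>First-order logic over the vocabulary of graphs\<close>

datatype fm =
    Eq nat nat
  | Edge nat nat
  | Neg fm
  | Conj fm fm
  | Disj fm fm
  | Forall nat fm
  | Exists nat fm

primrec fv :: "fm \<Rightarrow> nat set" where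
  "fv (Eq x y) = {x, y}"
| "fv (Edge x y) = {x, y}"
| "fv (Neg \<phi>) = fv \<phi>"
| "fv (Conj \<phi> \<psi>) = fv \<phi> \<union> fv \<psi>"
| "fv (Disj \<phi> \<psi>) = fv \<phi> \<union> fv \<psi>"
| "fv (Forall x \<phi>) = fv \<phi> - {x}"
| "fv (Exists x \<phi>) = fv \<phi> - {x}"

definition sentence :: "fm \<Rightarrow> bool" where
  "sentence \<phi> \<longleftrightarrow> fv \<phi> = {}"

primrec sat :: "'a graph \<Rightarrow> (nat \<Rightarrow> 'a) \<Rightarrow> fm \<Rightarrow> bool" where
  "sat G s (Eq x y) \<longleftrightarrow> s x = s y"
| "sat G s (Edge x y) \<longleftrightarrow> (s x, s y) \<in> edges G"
| "sat G s (Neg \<phi>) \<longleftrightarrow> \<not> sat G s \<phi>"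
| "sat G s (Conj \<phi> \<psi>) \<longleftrightarrow> sat G s \<phi> \<and> sat G s \<psi>"
| "sat G s (Disj \<phi> \<psi>) \<longleftrightarrow> sat G s \<phi> \<or> sat G s \<psi>"
| "sat G s (Forall x \<phi>) \<longleftrightarrow> (\<forall>a\<in>verts G. sat G (s(x := a)) \<phi>)"
| "sat G s (Exists x \<phi>) \<longleftrightarrow> (\<exists>a\<in>verts G. sat G (s(x := a)) \<phi>)"

definition models :: "'a graph \<Rightarrow> fm \<Rightarrow> bool" where
  "models G \<phi> \<longleftrightarrow> (\<forall>s. range s \<subseteq> verts G \<longrightarrow> sat G s \<phi>)"

definition Graph_fin :: "fm \<Rightarrow> nat graph set" where
  "Graph_fin \<phi> = {G \<in> fin_graphs. models G \<phi>}"

inductive universal :: "fm \<Rightarrow> bool" where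
  "universal (Eq x y)"
| "universal (Edge x y)"
| "universal (Neg (Eq x y))"
| "universal (Neg (Edge x y))"
| "universal \<phi> \<Longrightarrow> universal \<psi> \<Longrightarrow> universal (Conj \<phi> \<psi>)"
| "universal \<phi> \<Longrightarrow> universal \<psi> \<Longrightarrow> universal (Disj \<phi> \<psi>)"
| "universal \<phi> \<Longrightarrow> universal (Forall x \<phi>)"

definition universal_sentence :: "fm \<Rightarrow> bool" where
  "universal_sentence \<mu> \<longleftrightarrow> universal \<mu> \<and> sentence \<mu>"

lemma sat_cong:
  assumes "\<And>x. x \<in> fv \<phi> \<Longrightarrow> s x = t x"
  shows "sat G s \<phi> \<longleftrightarrow> sat G t \<phi>"
  using assms
proof (induction \<phi> arbitrary: s t)
  case (Neg \<phi>)
  then show ?case by (metis fv.simps(3) sat.simps(3))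
next
  case (Conj \<phi> \<psi>)
  then show ?case by (metis UnCI fv.simps(4) sat.simps(4))
next
  case (Disj \<phi> \<psi>)
  then show ?case by (metis UnCI fv.simps(5) sat.simps(5))
next
  case (Forall x \<phi>)
  have "sat G (s(x := a)) \<phi> = sat G (t(x := a)) \<phi>" for a
    by (rule Forall.IH) (use Forall.prems in auto)
  then show ?case by simp
next
  case (Exists x \<phi>)
  have "sat G (s(x := a)) \<phi> = sat G (t(x := a)) \<phi>" for a
    by (rule Exists.IH) (use Exists.prems in auto)
  then show ?case by simp
qed auto

lemma models_sentence:
  assumes "sentence \<phi>" and "range s \<subseteq> verts G"
  shows "models G \<phi> \<longleftrightarrow> sat G s \<phi>"
proof -
  have "sat G s \<phi> = sat G t \<phi>" for t
    by (rule sat_cong) (use assms(1) in \<open>simp add: sentence_def\<close>)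
  then show ?thesis using assms(2) unfolding models_def by metis
qed


section \<open>Algorithms\<close>

text \<open>Algorithms are codes of Kleene's partial recursive functions on tuples of natural numbers.
  \<open>computes r xs y\<close> means that \<open>r\<close> halts on input \<open>xs\<close> with output \<open>y\<close>; if there is no such \<open>y\<close>,
  then \<open>r\<close> diverges on \<open>xs\<close>. Arities are not part of the syntax: a code applied to a tuple of an
  unsuitable length is simply undefined there, so on each fixed arity the codes compute exactly the
  partial recursive functions of that arity. In primitive recursion and minimisation the
  distinguished argument is the first one.\<close>

datatype recf =
    Zero
  | Succ
  | Proj nat
  | Comp recf "recf list"
  | PrimRec recf recf
  | Min recf

inductive computes :: "recf \<Rightarrow> nat list \<Rightarrow> nat \<Rightarrow> bool" where
  computes_Zero: "computes Zero xs 0"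
| computes_Succ: "computes Succ [x] (Suc x)"
| computes_Proj: "i < length xs \<Longrightarrow> computes (Proj i) xs (xs ! i)"
| computes_Comp: "list_all2 (\<lambda>g y. computes g xs y) gs ys \<Longrightarrow> computes f ys z \<Longrightarrow>
    computes (Comp f gs) xs z"
| computes_PrimRec_0: "computes f xs y \<Longrightarrow> computes (PrimRec f g) (0 # xs) y"
| computes_PrimRec_Suc: "computes (PrimRec f g) (n # xs) y \<Longrightarrow> computes g (n # y # xs) z \<Longrightarrow>
    computes (PrimRec f g) (Suc n # xs) z"
| computes_Min: "computes f (n # xs) 0 \<Longrightarrow> (\<forall>m<n. \<exists>y>0. computes f (m # xs) y) \<Longrightarrow>
    computes (Min f) xs n"
monos list_all2_mono

inductive_cases computes_ZeroE: "computes Zero xs y"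
inductive_cases computes_SuccE: "computes Succ xs y"
inductive_cases computes_ProjE: "computes (Proj i) xs y"
inductive_cases computes_CompE: "computes (Comp f gs) xs y"
inductive_cases computes_PrimRec_0E: "computes (PrimRec f g) (0 # xs) y"
inductive_cases computes_PrimRec_SucE: "computes (PrimRec f g) (Suc n # xs) y"
inductive_cases computes_MinE: "computes (Min f) xs y"

lemma computes_deterministic:
  "computes r xs y \<Longrightarrow> computes r xs z \<Longrightarrow> y = z"
proof (induction r xs y arbitrary: z rule: computes.induct)
  case (computes_Zero xs)
  then show ?case by (auto elim: computes_ZeroE)
next
  case (computes_Succ x)
  then show ?case by (auto elim: computes_SuccE)
next
  case (computes_Proj i xs)
  from computes_Proj.prems show ?case by (auto elim: computes_ProjE)
next
  case (computes_Comp xs gs ys f w)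
  from computes_Comp.prems obtain ys' where
    ys': "list_all2 (\<lambda>g y. computes g xs y) gs ys'" "computes f ys' z"
    by (auto elim: computes_CompE)
  have "ys = ys'"
    using computes_Comp.IH(1) ys'(1) by (auto simp: list_all2_conv_all_nth intro!: nth_equalityI)
  with computes_Comp.IH(2) ys'(2) show ?case by blast
next
  case (computes_PrimRec_0 f xs y g)
  from computes_PrimRec_0.prems have "computes f xs z" by (rule computes_PrimRec_0E)
  then show ?case by (rule computes_PrimRec_0.IH)
next
  case (computes_PrimRec_Suc f g n xs y w)
  from computes_PrimRec_Suc.prems obtain y' where
    y': "computes (PrimRec f g) (n # xs) y'" "computes g (n # y' # xs) z"
    by (rule computes_PrimRec_SucE)
  have "y = y'" using y'(1) by (rule computes_PrimRec_Suc.IH(1))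
  with y'(2) have "computes g (n # y # xs) z" by simp
  then show ?case by (rule computes_PrimRec_Suc.IH(2))
next
  case (computes_Min f n xs)
  from computes_Min.prems have z: "computes f (z # xs) 0" "\<forall>m<z. \<exists>y>0. computes f (m # xs) y"
    by (auto elim: computes_MinE)
  show ?case
  proof (cases n z rule: linorder_cases)
    case less
    with z(2) obtain y where "y > 0" "computes f (n # xs) y" by blast
    with computes_Min.IH(1) show ?thesis by fastforce
  next
    case greater
    with computes_Min.IH(2) z(1) show ?thesis by fastforce
  qed
qed


section \<open>Codes of the finite objects\<close>

primrec fm_code :: "fm \<Rightarrow> nat" where
  "fm_code (Eq x y) = prod_encode (0, prod_encode (x, y))"
| "fm_code (Edge x y) = prod_encode (1, prod_encode (x, y))"
| "fm_code (Neg \<phi>) = prod_encode (2, fm_code \<phi>)"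
| "fm_code (Conj \<phi> \<psi>) = prod_encode (3, prod_encode (fm_code \<phi>, fm_code \<psi>))"
| "fm_code (Disj \<phi> \<psi>) = prod_encode (4, prod_encode (fm_code \<phi>, fm_code \<psi>))"
| "fm_code (Forall x \<phi>) = prod_encode (5, prod_encode (x, fm_code \<phi>))"
| "fm_code (Exists x \<phi>) = prod_encode (6, prod_encode (x, fm_code \<phi>))"

text \<open>The next two codes are meaningful for finite (sets of) finite graphs only, since
  \<^const>\<open>set_encode\<close> is injective only on finite sets.\<close>

definition graph_code :: "nat graph \<Rightarrow> nat" where
  "graph_code G = prod_encode (set_encode (verts G), set_encode (prod_encode ` edges G))"

definition graph_set_code :: "nat graph set \<Rightarrow> nat" where
  "graph_set_code \<F> = set_encode (graph_code ` \<F>)"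

lemma fm_code_inject: "fm_code \<phi> = fm_code \<psi> \<longleftrightarrow> \<phi> = \<psi>"
proof (induction \<phi> arbitrary: \<psi>)
  case (Eq x y) then show ?case by (cases \<psi>) auto
next
  case (Edge x y) then show ?case by (cases \<psi>) auto
next
  case (Neg \<phi>) then show ?case by (cases \<psi>) auto
next
  case (Conj \<phi>1 \<phi>2) then show ?case by (cases \<psi>) auto
next
  case (Disj \<phi>1 \<phi>2) then show ?case by (cases \<psi>) auto
next
  case (Forall x \<phi>) then show ?case by (cases \<psi>) auto
next
  case (Exists x \<phi>) then show ?case by (cases \<psi>) auto
qed

lemma inj_on_graph_code: "inj_on graph_code fin_graphs"
proof (rule inj_onI)
  fix G H assume G: "G \<in> fin_graphs" and H: "H \<in> fin_graphs" and eq: "graph_code G = graph_code H"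
  have fin: "finite (verts K) \<and> finite (edges K)" if "K \<in> fin_graphs" for K
    using that unfolding fin_graphs_def is_graph_def by (simp, metis finite_SigmaI finite_subset)
  have "verts G = verts H" "prod_encode ` edges G = prod_encode ` edges H"
    using eq fin[OF G] fin[OF H] by (auto simp: graph_code_def set_encode_eq)
  then show "G = H"
    by (metis graph.expand inj_image_eq_iff inj_prod_encode)
qed

lemma graph_set_code_inject:
  assumes "finite \<F>" "\<F> \<subseteq> fin_graphs" "finite \<G>" "\<G> \<subseteq> fin_graphs"
  shows "graph_set_code \<F> = graph_set_code \<G> \<longleftrightarrow> \<F> = \<G>"
  using assms inj_on_graph_code
  by (simp add: graph_set_code_def set_encode_eq inj_on_image_eq_iff)

end

theory Submission
  imports Defs
begin

text \<open>A diagonal argument. Suppose that \<open>r\<close> computes the universal sentences or the sets \<open>\<F>\<close>. Some sentence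
  \<open>\<phi>\<close> says of a graph that it does not encode the initial segment \<open>{..N}\<close> of the natural numbers,
  with order and binary digits, where \<open>N\<close> is the least bound of a computation of \<open>r\<close> on
  the code of \<open>\<phi>\<close> itself. Moreover \<open>\<phi>\<close> excludes finitely many small graphs, and these are chosen so
  that a graph encoding an initial segment and containing none of them cannot be
  extended by relevant vertices. Hence \<open>\<phi>\<close> is preserved under induced subgraphs; since \<open>N\<close> is
  unique if it exists, the minimal graphs violating \<open>\<phi>\<close> have bounded size, so \<open>\<phi>\<close> satisfies the
  hypotheses on the input of \<open>r\<close>. If \<open>r\<close> outputs \<open>c\<close> on this input, then \<open>c < N\<close>, and the graph that
  encodes \<open>{..N}\<close> violates \<open>\<phi>\<close> although all its induced subgraphs with at most \<open>c + 1\<close> vertices satisfy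
  \<open>\<phi>\<close>. But a universal sentence with code \<open>c\<close> that fails in a graph fails in an induced subgraph with
  at most \<open>c + 1\<close> vertices, and the members of a set of graphs with code \<open>c\<close> have at most \<open>c\<close>
  vertices.\<close>

section \<open>Computable functions\<close>

text \<open>Self-reference needs no substitution of numerals: \<open>\<chi>\<close> speaks of
  whichever chain element variable \<open>10\<close> holds, and wrapping it in \<open>n\<close>
  copies of \<open>step\<close>, with \<open>n\<close> the code of \<open>\<chi>\<close>, makes it
  speak of element \<open>n\<close>. On codes the wrapping iterates one computable function, so a
  fixed algorithm \<open>D\<close> leads from \<open>n\<close> to the code of the finished sentence,
  and the formula about \<open>r\<close> after \<open>D\<close> can be written before
  \<open>n\<close> is known. The excluded configurations must be existential, so that they pass to
  larger graphs, although they have to express exact positions in an order. The path through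
  \<open>A\<close> makes this possible: \<open>between\<close> locates a vertex by means of the two
  path neighbours of a chain element. Digits are encoded, rather than addition and multiplication,
  because membership of \<open>i\<close> in the finite set with code \<open>j\<close> gives pairs
  and finite sequences directly, and because a first-order increment rule determines all digits once
  the order is right.\<close>

definition computable1 :: "(nat \<Rightarrow> nat) \<Rightarrow> bool" where
  "computable1 f \<longleftrightarrow> (\<exists>r. \<forall>x. computes r [x] (f x))"

definition computable2 :: "(nat \<Rightarrow> nat \<Rightarrow> nat) \<Rightarrow> bool" where
  "computable2 h \<longleftrightarrow> (\<exists>r. \<forall>x y. computes r [x, y] (h x y))"

lemma computes_Comp1: "computes g xs y \<Longrightarrow> computes f [y] z \<Longrightarrow> computes (Comp f [g]) xs z"
  by (rule computes_Comp[of _ _ "[y]"]) auto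

lemma computes_Comp2:
  "computes g xs y \<Longrightarrow> computes g' xs y' \<Longrightarrow> computes f [y, y'] z \<Longrightarrow> computes (Comp f [g, g']) xs z"
  by (rule computes_Comp[of _ _ "[y, y']"]) auto

lemma computes_Proj0: "computes (Proj 0) (x # xs) x"
  using computes_Proj[of 0 "x # xs"] by simp

lemma computes_Proj1: "computes (Proj 1) (x # y # xs) y"
  using computes_Proj[of 1 "x # y # xs"] by simp

lemma computable1_id: "computable1 (\<lambda>x. x)"
  unfolding computable1_def using computes_Proj0 by blast

lemma computable1_comp: "computable1 f \<Longrightarrow> computable1 g \<Longrightarrow> computable1 (\<lambda>x. f (g x))"
  unfolding computable1_def using computes_Comp1 by blast

lemma computable1_comp2:
  "computable2 h \<Longrightarrow> computable1 f \<Longrightarrow> computable1 g \<Longrightarrow> computable1 (\<lambda>x. h (f x) (g x))"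
  unfolding computable1_def computable2_def using computes_Comp2 by blast

lemma computable1_Suc: "computable1 Suc"
  unfolding computable1_def using computes_Succ by blast

lemma computable1_const: "computable1 (\<lambda>_. c)"
proof (induction c)
  case 0
  show ?case unfolding computable1_def using computes_Zero by blast
next
  case (Suc c)
  then show ?case using computable1_comp[OF computable1_Suc] by blast
qed

lemma computable2_funpow:
  assumes "computable1 g"
  shows "computable2 (\<lambda>n x. (g ^^ n) x)"
proof -
  from assms obtain r where r: "computes r [x] (g x)" for x
    unfolding computable1_def by blast
  have "computes (PrimRec (Proj 0) (Comp r [Proj 1])) [n, x] ((g ^^ n) x)" for n x
  proof (induction n)
    case 0
    show ?case using computes_PrimRec_0[OF computes_Proj0] by simp
  next
    case (Suc n)
    show ?case
      by (rule computes_PrimRec_Suc[OF Suc], unfold funpow.simps comp_apply,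
          rule computes_Comp1[OF computes_Proj1 r])
  qed
  then show ?thesis unfolding computable2_def by blast
qed

lemma computable2_add: "computable2 (+)"
proof -
  have "(Suc ^^ n) x = n + x" for n x by (induction n) auto
  then show ?thesis using computable2_funpow[OF computable1_Suc] by simp
qed

lemma computable1_triangle: "computable1 triangle"
proof -
  from computable2_add obtain r where r: "computes r [x, y] (x + y)" for x y
    unfolding computable2_def by blast
  have "computes (PrimRec Zero (Comp r [Proj 1, Comp Succ [Proj 0]])) [n] (triangle n)" for n
  proof (induction n)
    case 0
    show ?case using computes_PrimRec_0[OF computes_Zero] by simp
  next
    case (Suc n)
    show ?case
      by (rule computes_PrimRec_Suc[OF Suc], unfold triangle_Suc,
          rule computes_Comp2[OF computes_Proj1 computes_Comp1[OF computes_Proj0 computes_Succ] r])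
  qed
  then show ?thesis unfolding computable1_def by blast
qed

lemma computable1_prod_encode:
  assumes "computable1 f" "computable1 g"
  shows "computable1 (\<lambda>x. prod_encode (f x, g x))"
proof -
  have "computable1 (\<lambda>x. triangle (f x + g x) + f x)"
    by (intro computable1_comp2[OF computable2_add] computable1_comp[OF computable1_triangle] assms)
  then show ?thesis by (simp add: prod_encode_def)
qed

text \<open>With \<open>g\<close> the effect of one \<open>step\<close> on codes and
  \<open>f\<close> that of the final closure to a sentence, this map leads from the code of a
  formula to the code of the sentence that applies the formula to its own code.\<close>

lemma computable1_diagonal:
  assumes "computable1 f" "computable1 g"
  shows "computable1 (\<lambda>n. f ((g ^^ n) n))"
  by (intro computable1_comp[OF assms(1)] computable1_comp2[OF computable2_funpow[OF assms(2)]] computable1_id)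


section \<open>Bounded obstructions\<close>

lemma sat_isomorphism:
  assumes "bij_betw h (verts G) (verts H)"
    and "\<forall>u\<in>verts G. \<forall>v\<in>verts G. (u, v) \<in> edges G \<longleftrightarrow> (h u, h v) \<in> edges H"
    and "range s \<subseteq> verts G"
  shows "sat H (h \<circ> s) \<phi> \<longleftrightarrow> sat G s \<phi>"
  using assms(3)
proof (induction \<phi> arbitrary: s)
  case (Eq x y)
  then show ?case using assms(1) by (auto simp: bij_betw_def inj_on_def range_subsetD)
next
  case (Edge x y)
  then show ?case using assms(2) by (simp add: range_subsetD)
next
  case (Forall x \<phi>)
  have "sat H ((h \<circ> s)(x := h a)) \<phi> = sat G (s(x := a)) \<phi>" if "a \<in> verts G" for a
  proof -
    have "range (s(x := a)) \<subseteq> verts G" using Forall.prems that by auto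
    then have "sat H (h \<circ> s(x := a)) \<phi> = sat G (s(x := a)) \<phi>" by (rule Forall.IH)
    then show ?thesis by (simp add: fun_upd_comp)
  qed
  moreover have "verts H = h ` verts G" using assms(1) by (simp add: bij_betw_def)
  ultimately show ?case by (simp add: comp_def)
next
  case (Exists x \<phi>)
  have "sat H ((h \<circ> s)(x := h a)) \<phi> = sat G (s(x := a)) \<phi>" if "a \<in> verts G" for a
  proof -
    have "range (s(x := a)) \<subseteq> verts G" using Exists.prems that by auto
    then have "sat H (h \<circ> s(x := a)) \<phi> = sat G (s(x := a)) \<phi>" by (rule Exists.IH)
    then show ?thesis by (simp add: fun_upd_comp)
  qed
  moreover have "verts H = h ` verts G" using assms(1) by (simp add: bij_betw_def)
  ultimately show ?case by (simp add: comp_def)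
qed auto

lemma models_isomorphic:
  assumes "isomorphic G H" "sentence \<phi>" "verts G \<noteq> {}"
  shows "models G \<phi> \<longleftrightarrow> models H \<phi>"
proof -
  from assms(1) obtain h where h: "bij_betw h (verts G) (verts H)"
    "\<forall>u\<in>verts G. \<forall>v\<in>verts G. (u, v) \<in> edges G \<longleftrightarrow> (h u, h v) \<in> edges H"
    unfolding isomorphic_def by blast
  from assms(3) obtain a where a: "a \<in> verts G" by blast
  let ?s = "\<lambda>_::nat. a"
  have s: "range ?s \<subseteq> verts G" using a by auto
  have "range (h \<circ> ?s) \<subseteq> verts H" using a h(1) by (auto simp: bij_betw_def)
  then show ?thesis
    using sat_isomorphism[OF h s] models_sentence[OF assms(2)] s by metis
qed

text \<open>The values of \<open>s\<close> may lie outside the graph, since a sentence does not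
  depend on them; this permits \<open>undefined\<close> as assignment.\<close>

lemma not_models_iff:
  assumes "sentence \<phi>" "verts G \<noteq> {}"
  shows "\<not> models G \<phi> \<longleftrightarrow> \<not> sat G s \<phi>"
proof -
  from assms(2) obtain a where a: "a \<in> verts G" by blast
  have "sat G s \<phi> = sat G (\<lambda>_. a) \<phi>"
    by (rule sat_cong) (use assms(1) in \<open>simp add: sentence_def\<close>)
  then show ?thesis using models_sentence[OF assms(1), of "\<lambda>_. a" G] a by auto
qed

lemma verts_induced [simp]: "verts (induced G W) = W"
  by (simp add: induced_def)

lemma edges_induced [simp]: "edges (induced G W) = edges G \<inter> W \<times> W"
  by (simp add: induced_def)

lemma fin_graphs_induced:
  "G \<in> fin_graphs \<Longrightarrow> W \<subseteq> verts G \<Longrightarrow> W \<noteq> {} \<Longrightarrow> induced G W \<in> fin_graphs"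
  by (auto simp: fin_graphs_def is_graph_def irrefl_def sym_def finite_subset)

lemma induced_induced: "W \<subseteq> V \<Longrightarrow> induced (induced G V) W = induced G W"
  by (auto simp: induced_def)

text \<open>Obstructions of bounded size amount to finitely many graphs only after their vertices
  are moved to an initial segment.\<close>

lemma isomorphic_initial_segment:
  assumes "G \<in> fin_graphs"
  shows "\<exists>H\<in>fin_graphs. isomorphic G H \<and> verts H = {..<card (verts G)}"
proof -
  have fin: "finite (verts G)" and G: "is_graph G" using assms by (auto simp: fin_graphs_def)
  from ex_bij_betw_finite_nat[OF fin] obtain h where
    h: "bij_betw h (verts G) {..<card (verts G)}" by (auto simp: atLeast0LessThan)
  let ?H = "Graph {..<card (verts G)} {(h u, h v) | u v. (u, v) \<in> edges G}"
  have E: "edges G \<subseteq> verts G \<times> verts G" using G by (simp add: is_graph_def)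
  have inj: "u = v" if "h u = h v" "u \<in> verts G" "v \<in> verts G" for u v
    using h that by (auto simp: bij_betw_def inj_on_def)
  have im: "h u < card (verts G)" if "u \<in> verts G" for u
    using h that by (auto simp: bij_betw_def)
  have "is_graph ?H"
    unfolding is_graph_def
  proof (intro conjI)
    show "verts ?H \<noteq> {}" using G fin by (simp add: is_graph_def card_gt_0_iff lessThan_empty_iff)
    show "edges ?H \<subseteq> verts ?H \<times> verts ?H" using E im by auto
    show "irrefl (edges ?H)"
    proof (rule irreflI)
      fix a show "(a, a) \<notin> edges ?H"
      proof
        assume "(a, a) \<in> edges ?H"
        then obtain u v where "(u, v) \<in> edges G" "h u = h v" by auto
        then show False using E G inj by (auto simp: is_graph_def irrefl_def)
      qed
    qed
    show "sym (edges ?H)"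
    proof (rule symI)
      fix a b assume "(a, b) \<in> edges ?H"
      then obtain u v where "(u, v) \<in> edges G" "a = h u" "b = h v" by auto
      moreover from this have "(v, u) \<in> edges G" using G by (auto simp: is_graph_def sym_def)
      ultimately show "(b, a) \<in> edges ?H" by auto
    qed
  qed
  moreover have "isomorphic G ?H"
    unfolding isomorphic_def
  proof (intro exI conjI ballI)
    show "bij_betw h (verts G) (verts ?H)" using h by simp
    fix u v assume uv: "u \<in> verts G" "v \<in> verts G"
    show "(u, v) \<in> edges G \<longleftrightarrow> (h u, h v) \<in> edges ?H"
    proof
      assume "(h u, h v) \<in> edges ?H"
      then obtain u' v' where "(u', v') \<in> edges G" "h u = h u'" "h v = h v'" by auto
      then show "(u, v) \<in> edges G" using E inj uv by blast
    qed auto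
  qed
  ultimately show ?thesis by (intro bexI[of _ ?H]) (auto simp: fin_graphs_def)
qed

section \<open>Bounded obstructions and finite sets of forbidden graphs\<close>

definition hereditary :: "fm \<Rightarrow> bool" where
  "hereditary \<phi> \<longleftrightarrow> (\<forall>G\<in>Graph_fin \<phi>. \<forall>W\<subseteq>verts G. W \<noteq> {} \<longrightarrow> induced G W \<in> Graph_fin \<phi>)"

definition obstructions_le :: "nat \<Rightarrow> fm \<Rightarrow> bool" where
  "obstructions_le k \<phi> \<longleftrightarrow> (\<forall>G\<in>fin_graphs - Graph_fin \<phi>.
     \<exists>W\<subseteq>verts G. W \<noteq> {} \<and> card W \<le> k \<and> induced G W \<notin> Graph_fin \<phi>)"

lemma Forb_fin_if_obstructions_le:
  assumes "sentence \<phi>" "hereditary \<phi>" "obstructions_le k \<phi>"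
  shows "\<exists>\<F>. finite \<F> \<and> \<F> \<subseteq> fin_graphs \<and> Graph_fin \<phi> = Forb_fin \<F>"
proof -
  \<comment> \<open>All failing graphs on vertices below \<open>k\<close> are taken, minimal or not;
    heredity makes the larger ones harmless.\<close>
  define \<F> where "\<F> = {H \<in> fin_graphs. verts H \<subseteq> {..<k} \<and> H \<notin> Graph_fin \<phi>}"
  have "\<F> \<subseteq> case_prod Graph ` (Pow {..<k} \<times> Pow ({..<k} \<times> {..<k}))"
  proof
    fix H assume "H \<in> \<F>"
    then have "verts H \<subseteq> {..<k}" "edges H \<subseteq> verts H \<times> verts H"
      by (auto simp: \<F>_def fin_graphs_def is_graph_def)
    moreover have "H = case_prod Graph (verts H, edges H)" by simp
    ultimately show "H \<in> case_prod Graph ` (Pow {..<k} \<times> Pow ({..<k} \<times> {..<k}))" by blast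
  qed
  then have fin: "finite \<F>" by (rule finite_subset) auto
  have iso: "H \<in> Graph_fin \<phi> \<longleftrightarrow> H' \<in> Graph_fin \<phi>"
    if "isomorphic H H'" "H \<in> fin_graphs" "H' \<in> fin_graphs" for H H'
    using models_isomorphic[OF that(1) assms(1)] that(2,3)
    by (auto simp: Graph_fin_def fin_graphs_def is_graph_def)
  have "G \<in> Graph_fin \<phi> \<longleftrightarrow> G \<in> Forb_fin \<F>" if G: "G \<in> fin_graphs" for G
  proof
    assume "G \<in> Graph_fin \<phi>"
    then show "G \<in> Forb_fin \<F>"
      using assms(2) iso G fin_graphs_induced[OF G] unfolding Forb_fin_def \<F>_def hereditary_def by blast
  next
    assume Forb: "G \<in> Forb_fin \<F>"
    show "G \<in> Graph_fin \<phi>"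
    proof (rule ccontr)
      assume "G \<notin> Graph_fin \<phi>"
      then obtain W where W: "W \<subseteq> verts G" "W \<noteq> {}" "card W \<le> k" "induced G W \<notin> Graph_fin \<phi>"
        using assms(3) G unfolding obstructions_le_def by blast
      obtain H where H: "H \<in> fin_graphs" "isomorphic (induced G W) H" "verts H = {..<card W}"
        using isomorphic_initial_segment[OF fin_graphs_induced[OF G W(1,2)]] by auto
      then have "H \<in> \<F>"
        using W iso[OF H(2)] fin_graphs_induced[OF G W(1,2)] by (auto simp: \<F>_def)
      then show False using Forb W(1,2) H(2) unfolding Forb_fin_def by blast
    qed
  qed
  then have "Graph_fin \<phi> = Forb_fin \<F>" by (auto simp: Graph_fin_def Forb_fin_def)
  then show ?thesis using fin by (intro exI[of _ \<F>]) (auto simp: \<F>_def)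
qed

section \<open>Universal sentences that forbid finitely many graphs\<close>

lemma sat_foldr_Forall:
  "sat G s (foldr Forall vs \<phi>) \<longleftrightarrow>
     (\<forall>t. (\<forall>v\<in>set vs. t v \<in> verts G) \<and> (\<forall>v. v \<notin> set vs \<longrightarrow> t v = s v) \<longrightarrow> sat G t \<phi>)"
proof (induction vs arbitrary: s)
  case Nil
  have "t = s" if "\<forall>v. t v = s v" for t using that by auto
  then show ?case by auto
next
  case (Cons x vs)
  show ?case (is "?l \<longleftrightarrow> ?r")
  proof
    assume l: ?l
    show ?r
    proof (intro allI impI)
      fix t assume t: "(\<forall>v\<in>set (x # vs). t v \<in> verts G) \<and> (\<forall>v. v \<notin> set (x # vs) \<longrightarrow> t v = s v)"
      then have "sat G (s(x := t x)) (foldr Forall vs \<phi>)" using l by simp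
      then show "sat G t \<phi>" unfolding Cons.IH using t by auto
    qed
  next
    assume r: ?r
    then show ?l by (auto simp: Cons.IH)
  qed
qed

lemma sat_foldr_Exists:
  "sat G s (foldr Exists vs \<phi>) \<longleftrightarrow>
     (\<exists>t. (\<forall>v\<in>set vs. t v \<in> verts G) \<and> (\<forall>v. v \<notin> set vs \<longrightarrow> t v = s v) \<and> sat G t \<phi>)"
proof -
  have "sat G s (foldr Exists vs \<phi>) \<longleftrightarrow> \<not> sat G s (foldr Forall vs (Neg \<phi>))"
    by (induction vs arbitrary: s) auto
  then show ?thesis by (auto simp: sat_foldr_Forall)
qed

lemma fv_foldr_quantifier [simp]:
  "fv (foldr Forall vs \<phi>) = fv \<phi> - set vs" "fv (foldr Exists vs \<phi>) = fv \<phi> - set vs"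
  by (induction vs) auto

lemma universal_foldr_Forall: "universal \<phi> \<Longrightarrow> universal (foldr Forall vs \<phi>)"
  by (induction vs) (auto intro: universal.intros)

lemma universal_finite_Disj:
  assumes "finite S" "S \<noteq> {}" "\<forall>\<psi>\<in>S. universal \<psi> \<and> fv \<psi> \<subseteq> V"
  shows "\<exists>\<delta>. universal \<delta> \<and> fv \<delta> \<subseteq> V \<and> (\<forall>(G :: 'a graph) s. sat G s \<delta> \<longleftrightarrow> (\<exists>\<psi>\<in>S. sat G s \<psi>))"
  using assms
proof (induction S rule: finite_ne_induct)
  case (singleton \<psi>)
  then show ?case by (intro exI[of _ \<psi>]) auto
next
  case (insert \<psi> S)
  then obtain \<delta> where "universal \<delta>" "fv \<delta> \<subseteq> V" "\<forall>(G :: 'a graph) s. sat G s \<delta> \<longleftrightarrow> (\<exists>\<psi>\<in>S. sat G s \<psi>)"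
    by auto
  then show ?case using insert.prems by (intro exI[of _ "Disj \<psi> \<delta>"]) (auto intro: universal.intros)
qed

lemma universal_finite_Conj:
  assumes "finite S" "\<forall>\<psi>\<in>S. universal \<psi> \<and> fv \<psi> \<subseteq> V"
  shows "\<exists>\<delta>. universal \<delta> \<and> fv \<delta> \<subseteq> V \<and> (\<forall>(G :: 'a graph) s. sat G s \<delta> \<longleftrightarrow> (\<forall>\<psi>\<in>S. sat G s \<psi>))"
  using assms
proof (induction S rule: finite_induct)
  case empty
  \<comment> \<open>A true formula without free variables is required, since \<open>V\<close> may be
    empty.\<close>
  then show ?case by (intro exI[of _ "Forall 0 (Eq 0 0)"]) (auto intro: universal.intros)
next
  case (insert \<psi> S)
  then obtain \<delta> where "universal \<delta>" "fv \<delta> \<subseteq> V" "\<forall>(G :: 'a graph) s. sat G s \<delta> \<longleftrightarrow> (\<forall>\<psi>\<in>S. sat G s \<psi>)"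
    by auto
  then show ?case using insert.prems by (intro exI[of _ "Conj \<psi> \<delta>"]) (auto intro: universal.intros)
qed

text \<open>The vertices of the forbidden graph double as the variables of the sentence.\<close>

lemma universal_sentence_forbidding:
  assumes H: "H \<in> fin_graphs"
  shows "\<exists>\<mu>. universal_sentence \<mu> \<and> (\<forall>G\<in>fin_graphs. \<forall>s. sat G s \<mu> \<longleftrightarrow>
     \<not> (\<exists>W. W \<noteq> {} \<and> W \<subseteq> verts G \<and> isomorphic (induced G W) H))"
proof -
  have fin: "finite (verts H)" and ne: "verts H \<noteq> {}" and irr: "irrefl (edges H)"
    using H by (auto simp: fin_graphs_def is_graph_def)
  obtain vs where vs: "set vs = verts H" using finite_list[OF fin] by blast
  \<comment> \<open>\<open>\<delta>\<close> is going to be the negated diagram of \<open>H\<close>: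
    it fails exactly at the induced embeddings of \<open>H\<close>.\<close>
  define lit where "lit = (\<lambda>(u, v). if (u, v) \<in> edges H then Neg (Edge u v) else Edge u v)"
  \<comment> \<open>Diagonal pairs are kept in the first part, so \<open>S\<close> is nonempty even
    if \<open>H\<close> has a single vertex.\<close>
  define S where "S = lit ` (verts H \<times> verts H) \<union>
    (\<lambda>(u, v). Eq u v) ` {p \<in> verts H \<times> verts H. fst p \<noteq> snd p}"
  have "finite S" "S \<noteq> {}" using fin ne by (auto simp: S_def)
  moreover have "\<forall>\<psi>\<in>S. universal \<psi> \<and> fv \<psi> \<subseteq> verts H"
    by (auto simp: S_def lit_def intro: universal.intros split: if_splits)
  ultimately obtain \<delta> where \<delta>: "universal \<delta>" "fv \<delta> \<subseteq> verts H"
    and "\<forall>(G :: nat graph) s. sat G s \<delta> \<longleftrightarrow> (\<exists>\<psi>\<in>S. sat G s \<psi>)"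
    using universal_finite_Disj[of S "verts H"] by blast
  then have sat\<delta>: "\<not> sat G t \<delta> \<longleftrightarrow> (\<forall>\<psi>\<in>S. \<not> sat G t \<psi>)" for G :: "nat graph" and t
    by simp
  have sat\<delta>: "\<not> sat G t \<delta> \<longleftrightarrow> inj_on t (verts H) \<and>
      (\<forall>u\<in>verts H. \<forall>v\<in>verts H. (u, v) \<in> edges H \<longleftrightarrow> (t u, t v) \<in> edges G)" for G :: "nat graph" and t
    unfolding sat\<delta> S_def lit_def inj_on_def by (simp add: ball_Un split: if_splits) blast
  define \<mu> where "\<mu> = foldr Forall vs \<delta>"
  have "universal_sentence \<mu>"
    using \<delta> vs by (auto simp: \<mu>_def universal_sentence_def sentence_def universal_foldr_Forall)
  moreover have "sat G s \<mu> \<longleftrightarrow> \<not> (\<exists>W. W \<noteq> {} \<and> W \<subseteq> verts G \<and> isomorphic (induced G W) H)"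
    if G: "G \<in> fin_graphs" for G s
  proof -
    have "\<not> sat G s \<mu> \<longleftrightarrow> (\<exists>t. t ` verts H \<subseteq> verts G \<and> \<not> sat G t \<delta>)" (is "_ \<longleftrightarrow> ?emb")
    proof
      assume "?emb"
      then obtain t where t: "t ` verts H \<subseteq> verts G" "\<not> sat G t \<delta>" by blast
      \<comment> \<open>An embedding matters only on \<open>verts H\<close>, whereas the assignment
        has to agree with \<open>s\<close> elsewhere.\<close>
      let ?t = "\<lambda>v. if v \<in> verts H then t v else s v"
      have "sat G ?t \<delta> = sat G t \<delta>" by (rule sat_cong) (use \<delta>(2) in auto)
      with t show "\<not> sat G s \<mu>" unfolding \<mu>_def sat_foldr_Forall vs
        by (intro notI) (drule spec[of _ ?t], auto)
    qed (auto simp: \<mu>_def sat_foldr_Forall vs)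
    also have "\<dots> \<longleftrightarrow> (\<exists>W. W \<noteq> {} \<and> W \<subseteq> verts G \<and> isomorphic (induced G W) H)"
    proof
      assume ?emb
      then obtain t where t: "t ` verts H \<subseteq> verts G" "\<not> sat G t \<delta>" by blast
      then have bij: "bij_betw t (verts H) (t ` verts H)" by (simp add: sat\<delta> bij_betw_def)
      have "isomorphic (induced G (t ` verts H)) H"
        unfolding isomorphic_def
      proof (intro exI conjI)
        show "bij_betw (the_inv_into (verts H) t) (verts (induced G (t ` verts H))) (verts H)"
          using bij_betw_the_inv_into[OF bij] by simp
        show "\<forall>u\<in>verts (induced G (t ` verts H)). \<forall>v\<in>verts (induced G (t ` verts H)).
            (u, v) \<in> edges (induced G (t ` verts H)) \<longleftrightarrow>
            (the_inv_into (verts H) t u, the_inv_into (verts H) t v) \<in> edges H"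
          using t(2) by (auto simp: sat\<delta> the_inv_into_f_f)
      qed
      then show "\<exists>W. W \<noteq> {} \<and> W \<subseteq> verts G \<and> isomorphic (induced G W) H"
        using t(1) ne by (intro exI[of _ "t ` verts H"]) auto
    next
      assume "\<exists>W. W \<noteq> {} \<and> W \<subseteq> verts G \<and> isomorphic (induced G W) H"
      then obtain W h where W: "W \<subseteq> verts G" and h: "bij_betw h W (verts H)"
        "\<forall>u\<in>W. \<forall>v\<in>W. (u, v) \<in> edges G \<longleftrightarrow> (h u, h v) \<in> edges H"
        unfolding isomorphic_def by auto
      let ?t = "the_inv_into W h"
      have t: "bij_betw ?t (verts H) W" using bij_betw_the_inv_into[OF h(1)] .
      have ht: "h (?t u) = u" if "u \<in> verts H" for u
        using h(1) that by (auto simp: bij_betw_def f_the_inv_into_f)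
      have "\<not> sat G ?t \<delta>"
        unfolding sat\<delta> using t h(2) ht by (metis bij_betw_def imageI)
      then show ?emb using t W by (intro exI[of _ ?t]) (auto simp: bij_betw_def)
    qed
    finally show ?thesis by blast
  qed
  ultimately show ?thesis by blast
qed

lemma universal_sentence_Forb_fin:
  assumes "finite \<F>" "\<F> \<subseteq> fin_graphs"
  shows "\<exists>\<mu>. universal_sentence \<mu> \<and> Graph_fin \<mu> = Forb_fin \<F>"
proof -
  from universal_sentence_forbidding have "\<forall>H\<in>\<F>. \<exists>\<mu>. universal_sentence \<mu> \<and> (\<forall>G\<in>fin_graphs. \<forall>s. sat G s \<mu> \<longleftrightarrow>
     \<not> (\<exists>W. W \<noteq> {} \<and> W \<subseteq> verts G \<and> isomorphic (induced G W) H))"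
    using assms(2) by blast
  then obtain m where m: "universal_sentence (m H)" "G \<in> fin_graphs \<Longrightarrow> sat G s (m H) \<longleftrightarrow>
     \<not> (\<exists>W. W \<noteq> {} \<and> W \<subseteq> verts G \<and> isomorphic (induced G W) H)" if "H \<in> \<F>" for H G s
    unfolding bchoice_iff by metis
  obtain \<mu> where \<mu>: "universal \<mu>" "fv \<mu> \<subseteq> {}" "\<forall>(G :: nat graph) s. sat G s \<mu> \<longleftrightarrow> (\<forall>\<psi>\<in>m ` \<F>. sat G s \<psi>)"
    using universal_finite_Conj[of "m ` \<F>" "{}"] assms(1) m(1)
    by (auto simp: universal_sentence_def sentence_def)
  then have us: "universal_sentence \<mu>" by (simp add: universal_sentence_def sentence_def)
  have "models G \<mu> \<longleftrightarrow> G \<in> Forb_fin \<F>" if G: "G \<in> fin_graphs" for G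
  proof -
    have "models G \<mu> \<longleftrightarrow> sat G undefined \<mu>"
      using not_models_iff[of \<mu> G] us G by (auto simp: universal_sentence_def fin_graphs_def is_graph_def)
    also have "\<dots> \<longleftrightarrow> G \<in> Forb_fin \<F>"
      using G by (auto simp: \<mu>(3) m(2)[OF _ G] Forb_fin_def)
    finally show ?thesis .
  qed
  then have "Graph_fin \<mu> = Forb_fin \<F>" by (auto simp: Graph_fin_def Forb_fin_def)
  with us show ?thesis by blast
qed

section \<open>Witness sizes bounded by codes\<close>

lemma add_le_prod_encode: "a + b \<le> prod_encode (a, b)"
proof -
  have "n \<le> triangle n" for n by (induction n) auto
  from this[of "a + b"] show ?thesis by (simp add: prod_encode_def)
qed

text \<open>Only quantifiers require new vertices, and the tag of \<open>Forall\<close> raises the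
  code enough to pay for one. The conclusion covers every \<open>W\<close> above the witnesses
  because in a disjunction both sides must fail in one common subgraph.\<close>

lemma universal_small_countermodel:
  assumes "universal \<mu>" "\<not> sat G s \<mu>"
  shows "\<exists>W0\<subseteq>verts G. finite W0 \<and> card W0 \<le> fm_code \<mu> \<and>
    (\<forall>W\<subseteq>verts G. W0 \<union> s ` fv \<mu> \<subseteq> W \<longrightarrow> \<not> sat (induced G W) s \<mu>)"
  using assms
proof (induction \<mu> arbitrary: s rule: universal.induct)
  case (5 \<phi> \<psi>)
  have le: "fm_code \<phi> \<le> fm_code (Conj \<phi> \<psi>)" "fm_code \<psi> \<le> fm_code (Conj \<phi> \<psi>)"
    using add_le_prod_encode[of "fm_code \<phi>" "fm_code \<psi>"]
      add_le_prod_encode[of 3 "prod_encode (fm_code \<phi>, fm_code \<psi>)"] by simp_all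
  from 5(5) consider "\<not> sat G s \<phi>" | "\<not> sat G s \<psi>" by auto
  then show ?case
  proof cases
    case 1
    from 5(3)[OF this] obtain W0 where W0: "W0 \<subseteq> verts G" "finite W0" "card W0 \<le> fm_code \<phi>"
      "\<forall>W\<subseteq>verts G. W0 \<union> s ` fv \<phi> \<subseteq> W \<longrightarrow> \<not> sat (induced G W) s \<phi>" by blast
    moreover have "card W0 \<le> fm_code (Conj \<phi> \<psi>)" using W0(3) le(1) by (rule order_trans)
    ultimately show ?thesis by (intro exI[of _ W0]) (simp del: fm_code.simps add: image_Un)
  next
    case 2
    from 5(4)[OF this] obtain W0 where W0: "W0 \<subseteq> verts G" "finite W0" "card W0 \<le> fm_code \<psi>"
      "\<forall>W\<subseteq>verts G. W0 \<union> s ` fv \<psi> \<subseteq> W \<longrightarrow> \<not> sat (induced G W) s \<psi>" by blast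
    moreover have "card W0 \<le> fm_code (Conj \<phi> \<psi>)" using W0(3) le(2) by (rule order_trans)
    ultimately show ?thesis by (intro exI[of _ W0]) (simp del: fm_code.simps add: image_Un)
  qed
next
  case (6 \<phi> \<psi>)
  have le: "fm_code \<phi> + fm_code \<psi> \<le> fm_code (Disj \<phi> \<psi>)"
    using add_le_prod_encode[of "fm_code \<phi>" "fm_code \<psi>"]
      add_le_prod_encode[of 4 "prod_encode (fm_code \<phi>, fm_code \<psi>)"] by simp
  from 6 have ns: "\<not> sat G s \<phi>" "\<not> sat G s \<psi>" by auto
  from 6(3)[OF ns(1)] obtain W1 where W1: "W1 \<subseteq> verts G" "finite W1" "card W1 \<le> fm_code \<phi>"
    "\<forall>W\<subseteq>verts G. W1 \<union> s ` fv \<phi> \<subseteq> W \<longrightarrow> \<not> sat (induced G W) s \<phi>" by blast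
  from 6(4)[OF ns(2)] obtain W2 where W2: "W2 \<subseteq> verts G" "finite W2" "card W2 \<le> fm_code \<psi>"
    "\<forall>W\<subseteq>verts G. W2 \<union> s ` fv \<psi> \<subseteq> W \<longrightarrow> \<not> sat (induced G W) s \<psi>" by blast
  have "card (W1 \<union> W2) \<le> fm_code (Disj \<phi> \<psi>)"
    using card_Un_le[of W1 W2] W1(3) W2(3) le by linarith
  then show ?case using W1 W2 by (intro exI[of _ "W1 \<union> W2"]) (simp del: fm_code.simps add: image_Un)
next
  case (7 \<phi> x)
  have le: "Suc (fm_code \<phi>) \<le> fm_code (Forall x \<phi>)"
    using add_le_prod_encode[of x "fm_code \<phi>"] add_le_prod_encode[of 5 "prod_encode (x, fm_code \<phi>)"] by simp
  from 7(3) obtain a where a: "a \<in> verts G" "\<not> sat G (s(x := a)) \<phi>" by auto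
  from 7(2)[OF a(2)] obtain W0 where W0: "W0 \<subseteq> verts G" "finite W0" "card W0 \<le> fm_code \<phi>"
    "\<forall>W\<subseteq>verts G. W0 \<union> (s(x := a)) ` fv \<phi> \<subseteq> W \<longrightarrow> \<not> sat (induced G W) (s(x := a)) \<phi>" by blast
  have "card (insert a W0) \<le> fm_code (Forall x \<phi>)"
    using card_insert_le_m1[of "Suc (card W0)" W0 a] W0(3) le by linarith
  moreover have "\<not> sat (induced G W) s (Forall x \<phi>)"
    if W: "W \<subseteq> verts G" "insert a W0 \<union> s ` fv (Forall x \<phi>) \<subseteq> W" for W
  proof -
    have "W0 \<union> (s(x := a)) ` fv \<phi> \<subseteq> W" using W by auto
    then show ?thesis using W0(4) W by auto
  qed
  ultimately show ?case using W0(1,2) a(1) by (intro exI[of _ "insert a W0"]) (simp del: fm_code.simps fv.simps sat.simps)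
qed (intro exI[of _ "{}"], simp)+

lemma universal_sentence_obstructions_le:
  assumes "universal_sentence \<mu>"
  shows "obstructions_le (Suc (fm_code \<mu>)) \<mu>"
  unfolding obstructions_le_def
proof
  fix G assume G: "G \<in> fin_graphs - Graph_fin \<mu>"
  have \<mu>: "universal \<mu>" "sentence \<mu>" using assms by (auto simp: universal_sentence_def)
  from G obtain a where a: "a \<in> verts G" by (auto simp: fin_graphs_def is_graph_def)
  from G have "\<not> sat G undefined \<mu>"
    using not_models_iff[OF \<mu>(2)] a by (metis DiffD1 DiffD2 Graph_fin_def empty_iff mem_Collect_eq)
  from universal_small_countermodel[OF \<mu>(1) this] obtain W0 where
    W0: "W0 \<subseteq> verts G" "finite W0" "card W0 \<le> fm_code \<mu>"
    "\<forall>W\<subseteq>verts G. W0 \<union> undefined ` fv \<mu> \<subseteq> W \<longrightarrow> \<not> sat (induced G W) undefined \<mu>" by blast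
  \<comment> \<open>\<open>W0\<close> might be empty, but a graph must not be; the extra vertex
    \<open>a\<close> accounts for the \<open>Suc\<close>.\<close>
  have "card (insert a W0) \<le> Suc (fm_code \<mu>)"
    using card_insert_le_m1[of "Suc (card W0)" W0 a] W0(3) by linarith
  moreover have "\<not> sat (induced G (insert a W0)) undefined \<mu>"
    using W0(4)[rule_format, of "insert a W0"] W0(1) a \<mu>(2) by (simp add: sentence_def subset_insertI)
  then have "\<not> models (induced G (insert a W0)) \<mu>" by (subst not_models_iff[OF \<mu>(2)]) simp_all
  ultimately show "\<exists>W\<subseteq>verts G. W \<noteq> {} \<and> card W \<le> Suc (fm_code \<mu>) \<and> induced G W \<notin> Graph_fin \<mu>"
    using W0(1) a by (intro exI[of _ "insert a W0"]) (auto simp: Graph_fin_def)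
qed

lemma mem_le_set_encode: "finite A \<Longrightarrow> x \<in> A \<Longrightarrow> x \<le> set_encode A"
  by (simp add: set_encode_def) (metis (no_types, lifting) less_exp less_imp_le member_le_sum order_trans zero_le)

lemma card_le_set_encode: "finite A \<Longrightarrow> card A \<le> set_encode A"
  using sum_mono[of A "\<lambda>_. 1::nat" "\<lambda>x. 2 ^ x"] by (simp add: set_encode_def)

text \<open>A subset inducing a copy of a member of \<open>\<F>\<close> has as many vertices as that
  member, and the code of a finite set is at least its cardinality and at least each of its
  elements.\<close>

lemma Forb_fin_small_obstruction:
  assumes \<F>: "finite \<F>" "\<F> \<subseteq> fin_graphs" and G: "G \<in> fin_graphs - Forb_fin \<F>"
  shows "\<exists>W\<subseteq>verts G. W \<noteq> {} \<and> card W \<le> graph_set_code \<F> \<and> induced G W \<notin> Forb_fin \<F>"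
proof -
  from G obtain W H where W: "W \<noteq> {}" "W \<subseteq> verts G" "H \<in> \<F>" "isomorphic (induced G W) H"
    by (auto simp: Forb_fin_def)
  have fin: "finite (verts H)" using \<F>(2) W(3) by (auto simp: fin_graphs_def)
  have "card W = card (verts H)"
    using W(4) by (auto simp: isomorphic_def bij_betw_same_card)
  also have "\<dots> \<le> set_encode (verts H)" by (rule card_le_set_encode[OF fin])
  also have "\<dots> \<le> graph_code H" by (simp add: graph_code_def le_prod_encode_1)
  also have "\<dots> \<le> graph_set_code \<F>"
    using W(3) \<F>(1) by (simp add: graph_set_code_def mem_le_set_encode)
  finally have "card W \<le> graph_set_code \<F>" .
  moreover have "induced G W \<notin> Forb_fin \<F>"
  proof -
    have "isomorphic (induced (induced G W) W) H" using W(4) by (simp add: induced_induced)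
    then show ?thesis using W(1,3) by (auto simp: Forb_fin_def)
  qed
  ultimately show ?thesis using W(1,2) by blast
qed


section \<open>Rigid chains\<close>

text \<open>A chain consists of three sequences \<open>a\<close>, \<open>b\<close>, \<open>d\<close> of vertices with index set \<open>{..N}\<close>. The
  half graph between \<open>A\<close> and \<open>B\<close> encodes the order, the edges \<open>(a i, a (Suc i))\<close> make consecutive
  elements recognisable without quantifiers, and the edges between \<open>A\<close> and \<open>D\<close> encode the binary
  digits of the elements. The sets \<open>S\<close> and \<open>T\<close> contain the first and the last element of \<open>A\<close>.\<close>

definition coded :: "'a set \<Rightarrow> 'a set \<Rightarrow> 'a set \<Rightarrow> 'a set \<Rightarrow> 'a set \<Rightarrow> ('a \<times> 'a) set \<Rightarrow> nat \<Rightarrow>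
    (nat \<Rightarrow> 'a) \<Rightarrow> (nat \<Rightarrow> 'a) \<Rightarrow> (nat \<Rightarrow> 'a) \<Rightarrow> bool" where
  "coded A B D S T E N a b d \<longleftrightarrow>
     A = a ` {..N} \<and> B = b ` {..N} \<and> D = d ` {..N} \<and> S = {a 0} \<and> T = {a N} \<and>
     (\<forall>i<N. (a i, a (Suc i)) \<in> E) \<and>
     (\<forall>i\<le>N. \<forall>j\<le>N. (a i, b j) \<in> E \<longleftrightarrow> i \<le> j) \<and>
     (\<forall>i\<le>N. \<forall>j\<le>N. (d i, b j) \<in> E \<longleftrightarrow> i \<le> j) \<and>
     (\<forall>i\<le>N. \<forall>j\<le>N. (a i, d j) \<in> E \<longleftrightarrow> i \<in> set_decode j)"

text \<open>In a chain, \<open>between A B S T E (a i) x\<close> says that the position of \<open>x\<close> relative to \<open>B\<close> is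
  the position of \<open>a i\<close>.\<close>

definition between :: "'a set \<Rightarrow> 'a set \<Rightarrow> 'a set \<Rightarrow> 'a set \<Rightarrow> ('a \<times> 'a) set \<Rightarrow> 'a \<Rightarrow> 'a \<Rightarrow> bool" where
  "between A B S T E a x \<longleftrightarrow>
     (a \<in> S \<or> (\<exists>a1\<in>A. \<exists>b\<in>B. (a1, a) \<in> E \<and> (a1, b) \<in> E \<and> (a, b) \<notin> E \<and> (x, b) \<notin> E)) \<and>
     (\<exists>b\<in>B. (a, b) \<in> E \<and> (x, b) \<in> E \<and> (a \<in> T \<or> (\<exists>a2\<in>A. (a, a2) \<in> E \<and> (a2, b) \<notin> E)))"

text \<open>The following configurations do not occur in a chain, and in their absence a chain cannot be
  extended by further vertices.\<close>

definition violation :: "'a set \<Rightarrow> 'a set \<Rightarrow> 'a set \<Rightarrow> 'a set \<Rightarrow> 'a set \<Rightarrow> ('a \<times> 'a) set \<Rightarrow> bool" where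
  "violation A B D S T E \<longleftrightarrow>
     (\<exists>s\<in>S. \<exists>b\<in>B. (s, b) \<notin> E) \<or>
     (\<exists>e\<in>T. \<exists>x\<in>A \<union> D. \<exists>b\<in>B. (e, b) \<in> E \<and> (x, b) \<notin> E) \<or>
     (\<exists>e\<in>T. \<exists>b\<in>B. \<exists>b'\<in>B. b \<noteq> b' \<and> (e, b) \<in> E \<and> (e, b') \<in> E) \<or>
     (\<exists>a\<in>A. \<exists>a'\<in>A. \<exists>b\<in>B. \<exists>b'\<in>B. (a, a') \<in> E \<and> b \<noteq> b' \<and>
        (a, b) \<in> E \<and> (a', b) \<notin> E \<and> (a, b') \<in> E \<and> (a', b') \<notin> E) \<or>
     (\<exists>a\<in>A. \<exists>x\<in>A. \<exists>x'\<in>A. x \<noteq> x' \<and> between A B S T E a x \<and> between A B S T E a x') \<or>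
     (\<exists>a\<in>A. \<exists>x\<in>D. \<exists>x'\<in>D. x \<noteq> x' \<and> between A B S T E a x \<and> between A B S T E a x')"

text \<open>In a coded chain \<open>a i\<close> is adjacent to the \<open>b j\<close> with
  \<open>i \<le> j\<close>, so neighbourhoods in \<open>B\<close> shrink as the index grows; hence
  the reversed implication.\<close>

definition chain_le :: "'a set \<Rightarrow> ('a \<times> 'a) set \<Rightarrow> 'a \<Rightarrow> 'a \<Rightarrow> bool" where
  "chain_le B E x y \<longleftrightarrow> (\<forall>b\<in>B. (y, b) \<in> E \<longrightarrow> (x, b) \<in> E)"

text \<open>The number of \<open>y\<close> occurs a second time, as the element of \<open>D\<close>
  with the same neighbours in \<open>B\<close>. Digits use this copy because edges inside
  \<open>A\<close> are symmetric and already mark consecutive elements.\<close>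

definition chain_bit :: "'a set \<Rightarrow> 'a set \<Rightarrow> ('a \<times> 'a) set \<Rightarrow> 'a \<Rightarrow> 'a \<Rightarrow> bool" where
  "chain_bit B D E x y \<longleftrightarrow> (\<exists>d\<in>D. (\<forall>b\<in>B. (y, b) \<in> E \<longleftrightarrow> (d, b) \<in> E) \<and> (x, d) \<in> E)"

text \<open>A first-order substitute for \<open>coded\<close>, which mentions a length and
  enumerations. The last clause is binary increment, stated for immediate neighbours in the
  order.\<close>

definition complete_chain :: "'a set \<Rightarrow> 'a set \<Rightarrow> 'a set \<Rightarrow> 'a set \<Rightarrow> 'a set \<Rightarrow> ('a \<times> 'a) set \<Rightarrow> bool" where
  "complete_chain A B D S T E \<longleftrightarrow>
     S \<noteq> {} \<and>
     (\<forall>x\<in>A. x \<in> T \<or> (\<exists>y\<in>A. (x, y) \<in> E \<and> chain_le B E x y \<and> \<not> chain_le B E y x)) \<and>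
     (\<forall>e\<in>T. \<exists>b\<in>B. (e, b) \<in> E) \<and>
     (\<forall>x\<in>A. \<exists>d\<in>D. \<forall>b\<in>B. (x, b) \<in> E \<longleftrightarrow> (d, b) \<in> E) \<and>
     (\<forall>s\<in>S. \<forall>x\<in>A. \<not> chain_bit B D E x s) \<and>
     (\<forall>y\<in>A. \<forall>y'\<in>A. \<not> chain_le B E y' y \<and> (\<forall>z\<in>A. chain_le B E z y \<or> chain_le B E y' z) \<longrightarrow>
       (\<forall>x\<in>A. chain_bit B D E x y' \<longleftrightarrow>
         (chain_bit B D E x y \<longleftrightarrow> (\<exists>z\<in>A. \<not> chain_le B E x z \<and> \<not> chain_bit B D E z y))))"

text \<open>The carry stops at the lowest zero of \<open>j\<close>: digits above it survive, those
  up to it flip. The induction drops the last digit of \<open>j\<close>.\<close>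

lemma mem_set_decode_Suc:
  "i \<in> set_decode (Suc j) \<longleftrightarrow> (i \<in> set_decode j \<longleftrightarrow> (\<exists>l<i. l \<notin> set_decode j))"
proof (induction i arbitrary: j)
  case 0
  then show ?case by simp
next
  case (Suc i)
  have split: "(\<exists>l<Suc i. l \<notin> set_decode j) \<longleftrightarrow> even j \<or> (\<exists>l<i. l \<notin> set_decode (j div 2))"
  proof -
    have "(\<exists>l<Suc i. l \<notin> set_decode j) \<longleftrightarrow> 0 \<notin> set_decode j \<or> (\<exists>l<i. Suc l \<notin> set_decode j)"
      using less_Suc_eq_0_disj by auto
    then show ?thesis by simp
  qed
  show ?case
  proof (cases "even j")
    case True
    then have "Suc j div 2 = j div 2" by simp
    then show ?thesis using split True by simp
  next
    case False
    then have "Suc j div 2 = Suc (j div 2)" by simp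
    then show ?thesis using split False Suc.IH[of "j div 2"] by simp
  qed
qed

text \<open>Every vertex of \<open>A\<close> or \<open>D\<close> is adjacent to \<open>b N\<close>,
  so it has a first neighbour \<open>b i\<close>; then \<open>between\<close> places it at
  \<open>a i\<close>, where the uniqueness clauses leave only \<open>a i\<close> or
  \<open>d i\<close>, respectively. A vertex of \<open>B\<close> is determined by the step of the
  path at which adjacency to it is lost, or by adjacency to \<open>a N\<close>.\<close>

lemma chain_exhausts:
  assumes in_A: "\<And>i. i \<le> N \<Longrightarrow> a i \<in> A" and in_B: "\<And>i. i \<le> N \<Longrightarrow> b i \<in> B"
    and in_D: "\<And>i. i \<le> N \<Longrightarrow> d i \<in> D" and ST: "a 0 \<in> S" "a N \<in> T" "S \<subseteq> A" "T \<subseteq> A"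
    and path: "\<And>i. i < N \<Longrightarrow> (a i, a (Suc i)) \<in> E"
    and ab: "\<And>i j. i \<le> N \<Longrightarrow> j \<le> N \<Longrightarrow> (a i, b j) \<in> E \<longleftrightarrow> i \<le> j"
    and db: "\<And>i j. i \<le> N \<Longrightarrow> j \<le> N \<Longrightarrow> (d i, b j) \<in> E \<longleftrightarrow> i \<le> j"
    and nv: "\<not> violation A B D S T E"
  shows "A = a ` {..N} \<and> B = b ` {..N} \<and> D = d ` {..N} \<and> S = {a 0} \<and> T = {a N}"
proof -
  have v1: "\<And>s b. s \<in> S \<Longrightarrow> b \<in> B \<Longrightarrow> (s, b) \<in> E"
    and v2: "\<And>e x b. e \<in> T \<Longrightarrow> x \<in> A \<union> D \<Longrightarrow> b \<in> B \<Longrightarrow> (e, b) \<in> E \<Longrightarrow> (x, b) \<in> E"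
    and v3: "\<And>e b b'. e \<in> T \<Longrightarrow> b \<in> B \<Longrightarrow> b' \<in> B \<Longrightarrow> (e, b) \<in> E \<Longrightarrow> (e, b') \<in> E \<Longrightarrow> b = b'"
    and v4: "\<And>a a' b b'. a \<in> A \<Longrightarrow> a' \<in> A \<Longrightarrow> b \<in> B \<Longrightarrow> b' \<in> B \<Longrightarrow> (a, a') \<in> E \<Longrightarrow>
      (a, b) \<in> E \<Longrightarrow> (a', b) \<notin> E \<Longrightarrow> (a, b') \<in> E \<Longrightarrow> (a', b') \<notin> E \<Longrightarrow> b = b'"
    and v5: "\<And>a x x'. a \<in> A \<Longrightarrow> x \<in> A \<Longrightarrow> x' \<in> A \<Longrightarrow>
      between A B S T E a x \<Longrightarrow> between A B S T E a x' \<Longrightarrow> x = x'"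
    and v6: "\<And>a x x'. a \<in> A \<Longrightarrow> x \<in> D \<Longrightarrow> x' \<in> D \<Longrightarrow>
      between A B S T E a x \<Longrightarrow> between A B S T E a x' \<Longrightarrow> x = x'"
    using nv unfolding violation_def by metis+
  have between: "between A B S T E (a i) x"
    if i: "i \<le> N" and x: "(x, b i) \<in> E" "\<And>j. j < i \<Longrightarrow> (x, b j) \<notin> E" for i x
    unfolding between_def
  proof
    show "a i \<in> S \<or> (\<exists>a1\<in>A. \<exists>b\<in>B. (a1, a i) \<in> E \<and> (a1, b) \<in> E \<and> (a i, b) \<notin> E \<and> (x, b) \<notin> E)"
    proof (cases i)
      case (Suc j)
      then show ?thesis using i x(2)[of j] in_A[of j] in_B[of j] path[of j] ab by fastforce
    qed (simp add: ST)
    have "a i \<in> T \<or> (\<exists>a2\<in>A. (a i, a2) \<in> E \<and> (a2, b i) \<notin> E)"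
    proof (cases "i = N")
      case False
      then show ?thesis using i in_A[of "Suc i"] path[of i] ab[of "Suc i" i] by auto
    qed (simp add: ST)
    then show "\<exists>b\<in>B. (a i, b) \<in> E \<and> (x, b) \<in> E \<and> (a i \<in> T \<or> (\<exists>a2\<in>A. (a i, a2) \<in> E \<and> (a2, b) \<notin> E))"
      using in_B[OF i] x(1) ab[OF i i] by blast
  qed
  have position: "\<exists>i\<le>N. between A B S T E (a i) x" if x: "x \<in> A \<union> D" for x
  proof -
    have "(x, b N) \<in> E"
      using v2[OF ST(2) x in_B[of N]] ab[of N N] by simp
    then obtain i where i: "(x, b i) \<in> E" "\<And>j. j < i \<Longrightarrow> (x, b j) \<notin> E" "i \<le> N"
      using exists_least_iff[of "\<lambda>i. (x, b i) \<in> E"] by (metis linorder_not_less)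
    then show ?thesis using between by blast
  qed
  have bA: "between A B S T E (a i) (a i)" and bD: "between A B S T E (a i) (d i)" if "i \<le> N" for i
    using that ab db by (auto intro!: between)
  have A: "A = a ` {..N}"
  proof
    show "A \<subseteq> a ` {..N}"
    proof
      fix x assume x: "x \<in> A"
      with position obtain i where i: "i \<le> N" "between A B S T E (a i) x" by blast
      then have "x = a i" using v5[OF in_A[OF i(1)] x in_A[OF i(1)] i(2) bA[OF i(1)]] by blast
      then show "x \<in> a ` {..N}" using i(1) by simp
    qed
  qed (use in_A in auto)
  moreover have "D = d ` {..N}"
  proof
    show "D \<subseteq> d ` {..N}"
    proof
      fix x assume x: "x \<in> D"
      with position obtain i where i: "i \<le> N" "between A B S T E (a i) x" by blast
      then have "x = d i" using v6[OF in_A[OF i(1)] x in_D[OF i(1)] i(2) bD[OF i(1)]] by blast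
      then show "x \<in> d ` {..N}" using i(1) by simp
    qed
  qed (use in_D in auto)
  moreover have "B = b ` {..N}"
  proof
    show "B \<subseteq> b ` {..N}"
    proof
      fix x assume x: "x \<in> B"
      show "x \<in> b ` {..N}"
      proof (cases "(a N, x) \<in> E")
        case True
        then have "x = b N" using v3[OF ST(2) x in_B[of N]] ab[of N N] by simp
        then show ?thesis by simp
      next
        case False
        have 0: "(a 0, x) \<in> E" using v1[OF ST(1) x] .
        obtain i where i: "(a i, x) \<notin> E" "\<And>j. j < i \<Longrightarrow> (a j, x) \<in> E" "i \<le> N"
          using False exists_least_iff[of "\<lambda>i. (a i, x) \<notin> E"] by (metis linorder_not_less)
        then obtain j where j: "i = Suc j" using 0 by (cases i) auto
        have "(a j, a i) \<in> E" "(a j, x) \<in> E" "(a j, b j) \<in> E" "(a i, b j) \<notin> E" "b j \<in> B" "a i \<in> A" "a j \<in> A"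
          using i j path[of j] ab[of j j] ab[of i j] in_A in_B by auto
        then have "x = b j" using v4[of "a j" "a i" x "b j"] x i(1) by blast
        then show ?thesis using i(3) j by simp
      qed
    qed
  qed (use in_B in auto)
  moreover have "S = {a 0}"
  proof -
    have "i = 0" if "i \<le> N" "a i \<in> S" for i
      using v1[OF that(2) in_B[of 0]] ab[of i 0] that(1) by simp
    then show ?thesis using ST A by auto
  qed
  moreover have "T = {a N}"
  proof -
    have "i = N" if i: "i \<le> N" "a i \<in> T" for i
    proof (rule ccontr)
      assume ne: "i \<noteq> N"
      then have "b i \<noteq> b N" using i ab[of N i] ab[of N N] by auto
      then show False using v3[OF i(2) in_B[of i] in_B[of N]] i ab[of i i] ab[of i N] by simp
    qed
    then show ?thesis using ST A by auto
  qed
  ultimately show ?thesis by blast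
qed

text \<open>Each step strictly shrinks the set of neighbours in the finite set \<open>B\<close>, so
  the walk cannot go on forever and has to end in \<open>T\<close>.\<close>

lemma complete_chain_path:
  assumes "finite B" "complete_chain A B D S T E" "x \<in> A"
  shows "\<exists>N a. a 0 = x \<and> a N \<in> T \<and> (\<forall>i\<le>N. a i \<in> A) \<and>
    (\<forall>i<N. (a i, a (Suc i)) \<in> E \<and> chain_le B E (a i) (a (Suc i)) \<and> \<not> chain_le B E (a (Suc i)) (a i))"
  using assms(3)
proof (induction "card {b \<in> B. (x, b) \<in> E}" arbitrary: x rule: less_induct)
  case less
  show ?case
  proof (cases "x \<in> T")
    case True
    then show ?thesis using less.prems by (intro exI[of _ "0::nat"] exI[of _ "\<lambda>_. x"]) auto
  next
    case False
    then obtain y where y: "y \<in> A" "(x, y) \<in> E" "chain_le B E x y" "\<not> chain_le B E y x"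
      using assms(2) less.prems unfolding complete_chain_def by blast
    then have "{b \<in> B. (y, b) \<in> E} \<subset> {b \<in> B. (x, b) \<in> E}" by (auto simp: chain_le_def)
    then have "card {b \<in> B. (y, b) \<in> E} < card {b \<in> B. (x, b) \<in> E}"
      using assms(1) by (intro psubset_card_mono) auto
    from less.hyps[OF this y(1)] obtain N a where a: "a 0 = y" "a N \<in> T" "\<forall>i\<le>N. a i \<in> A"
      "\<forall>i<N. (a i, a (Suc i)) \<in> E \<and> chain_le B E (a i) (a (Suc i)) \<and> \<not> chain_le B E (a (Suc i)) (a i)"
      by blast
    show ?thesis
    proof (intro exI conjI allI impI)
      show "case_nat x a 0 = x" by simp
      show "case_nat x a (Suc N) \<in> T" using a by simp
      show "case_nat x a i \<in> A" if "i \<le> Suc N" for i using that a less.prems by (cases i) auto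
      fix i assume i: "i < Suc N"
      show "(case_nat x a i, case_nat x a (Suc i)) \<in> E" using i a y by (cases i) auto
      show "chain_le B E (case_nat x a i) (case_nat x a (Suc i))" using i a y by (cases i) auto
      show "\<not> chain_le B E (case_nat x a (Suc i)) (case_nat x a i)" using i a y by (cases i) auto
    qed
  qed
qed

section \<open>Coded chains and their first-order description\<close>

lemma coded_chain_le:
  assumes "coded A B D S T E N a b d" "i \<le> N" "j \<le> N"
  shows "chain_le B E (a i) (a j) \<longleftrightarrow> i \<le> j"
proof -
  have "chain_le B E (a i) (a j) \<longleftrightarrow> (\<forall>k\<le>N. j \<le> k \<longrightarrow> i \<le> k)"
    using assms by (auto simp: chain_le_def coded_def)
  then show ?thesis using assms(3) by auto
qed

text \<open>Nothing is assumed about digits, so the lemma is available while the digits of a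
  complete chain are still to be determined.\<close>

lemma order_bit_iff:
  fixes N :: nat
  assumes "B = b ` {..N}" "D = d ` {..N}"
    and ab: "\<And>i j. i \<le> N \<Longrightarrow> j \<le> N \<Longrightarrow> (a i, b j) \<in> E \<longleftrightarrow> i \<le> j"
    and db: "\<And>i j. i \<le> N \<Longrightarrow> j \<le> N \<Longrightarrow> (d i, b j) \<in> E \<longleftrightarrow> i \<le> j"
    and "j \<le> N"
  shows "chain_bit B D E x (a j) \<longleftrightarrow> (x, d j) \<in> E"
proof -
  have "(\<forall>k\<le>N. (a j, b k) \<in> E \<longleftrightarrow> (d i, b k) \<in> E) \<longleftrightarrow> i = j" if i: "i \<le> N" for i
  proof
    assume h: "\<forall>k\<le>N. (a j, b k) \<in> E \<longleftrightarrow> (d i, b k) \<in> E"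
    show "i = j"
      using h[rule_format, of i] h[rule_format, of j] ab[of j] db[of i] i \<open>j \<le> N\<close> by auto
  qed (use ab db i in auto)
  then show ?thesis using assms(1,2) \<open>j \<le> N\<close> by (auto simp: chain_bit_def)
qed

lemma coded_chain_bit:
  assumes "coded A B D S T E N a b d" "i \<le> N" "j \<le> N"
  shows "chain_bit B D E (a i) (a j) \<longleftrightarrow> i \<in> set_decode j"
  using assms order_bit_iff[of B b N D d a E j "a i"] by (simp add: coded_def)

lemma successor_iff:
  assumes "i \<le> N" "j \<le> N"
  shows "\<not> j \<le> i \<and> (\<forall>k\<le>N. k \<le> i \<or> j \<le> k) \<longleftrightarrow> j = Suc (i :: nat)"
proof
  assume h: "\<not> j \<le> i \<and> (\<forall>k\<le>N. k \<le> i \<or> j \<le> k)"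
  then have "Suc i \<le> i \<or> j \<le> Suc i" using assms by (intro h[THEN conjunct2, rule_format]) auto
  then show "j = Suc i" using h by auto
qed auto

lemma complete_chain_if_coded:
  assumes c: "coded A B D S T E N a b d"
  shows "complete_chain A B D S T E"
proof -
  note le = coded_chain_le[OF c] and bit = coded_chain_bit[OF c]
  have sets: "A = a ` {..N}" "B = b ` {..N}" "D = d ` {..N}" "S = {a 0}" "T = {a N}"
    and path: "\<And>i. i < N \<Longrightarrow> (a i, a (Suc i)) \<in> E"
    and ab: "\<And>i j. i \<le> N \<Longrightarrow> j \<le> N \<Longrightarrow> (a i, b j) \<in> E \<longleftrightarrow> i \<le> j"
    and db: "\<And>i j. i \<le> N \<Longrightarrow> j \<le> N \<Longrightarrow> (d i, b j) \<in> E \<longleftrightarrow> i \<le> j"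
    using c by (simp_all add: coded_def)
  have ballA: "(\<forall>x\<in>A. P x) \<longleftrightarrow> (\<forall>i\<le>N. P (a i))" and bexA: "(\<exists>x\<in>A. P x) \<longleftrightarrow> (\<exists>i\<le>N. P (a i))" for P
    by (auto simp: sets)
  show ?thesis
    unfolding complete_chain_def
  proof (intro conjI)
    show "\<forall>x\<in>A. x \<in> T \<or> (\<exists>y\<in>A. (x, y) \<in> E \<and> chain_le B E x y \<and> \<not> chain_le B E y x)"
    proof (unfold ballA, intro allI impI)
      fix i assume i: "i \<le> N"
      show "a i \<in> T \<or> (\<exists>y\<in>A. (a i, y) \<in> E \<and> chain_le B E (a i) y \<and> \<not> chain_le B E y (a i))"
      proof (cases "i = N")
        case False
        then show ?thesis using i path[of i] le[of i "Suc i"] le[of "Suc i" i]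
          by (intro disjI2 bexI[of _ "a (Suc i)"]) (auto simp: sets)
      qed (simp add: sets)
    qed
    show "\<forall>e\<in>T. \<exists>b\<in>B. (e, b) \<in> E" using ab[of N N] by (auto simp: sets)
    show "\<forall>x\<in>A. \<exists>d\<in>D. \<forall>b\<in>B. (x, b) \<in> E \<longleftrightarrow> (d, b) \<in> E" using ab db by (auto simp: sets)
    show "\<forall>s\<in>S. \<forall>x\<in>A. \<not> chain_bit B D E x s" using bit[of _ 0] by (auto simp: sets)
    have lt: "(\<exists>l\<le>N. \<not> chain_le B E (a i) (a l) \<and> \<not> chain_bit B D E (a l) (a j)) \<longleftrightarrow> (\<exists>l<i. l \<notin> set_decode j)"
      if "i \<le> N" "j \<le> N" for i j
    proof -
      have "(\<exists>l\<le>N. \<not> chain_le B E (a i) (a l) \<and> \<not> chain_bit B D E (a l) (a j)) \<longleftrightarrow>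
          (\<exists>l\<le>N. \<not> i \<le> l \<and> l \<notin> set_decode j)"
        using le[OF that(1)] bit[OF _ that(2)] by blast
      also have "\<dots> \<longleftrightarrow> (\<exists>l<i. l \<notin> set_decode j)"
        using that(1) by (meson leD leI less_imp_le order_trans)
      finally show ?thesis .
    qed
    show "\<forall>y\<in>A. \<forall>y'\<in>A. \<not> chain_le B E y' y \<and> (\<forall>z\<in>A. chain_le B E z y \<or> chain_le B E y' z) \<longrightarrow>
       (\<forall>x\<in>A. chain_bit B D E x y' \<longleftrightarrow>
         (chain_bit B D E x y \<longleftrightarrow> (\<exists>z\<in>A. \<not> chain_le B E x z \<and> \<not> chain_bit B D E z y)))"
    proof (unfold ballA bexA, intro allI impI)
      fix i j k
      assume ij: "i \<le> N" "j \<le> N" and k: "k \<le> N"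
        and "\<not> chain_le B E (a j) (a i) \<and> (\<forall>k\<le>N. chain_le B E (a k) (a i) \<or> chain_le B E (a j) (a k))"
      then have "\<not> j \<le> i \<and> (\<forall>k\<le>N. k \<le> i \<or> j \<le> k)" using le by metis
      then have j: "j = Suc i" using successor_iff ij by blast
      show "chain_bit B D E (a k) (a j) \<longleftrightarrow> (chain_bit B D E (a k) (a i) \<longleftrightarrow>
          (\<exists>l\<le>N. \<not> chain_le B E (a k) (a l) \<and> \<not> chain_bit B D E (a l) (a i)))"
        using lt[OF k ij(1)] bit[OF k ij(1)] bit[OF k ij(2)] mem_set_decode_Suc[of k i] j by simp
    qed
  qed (simp add: sets)
qed

text \<open>Follow a path from \<open>S\<close> to \<open>T\<close>, choose \<open>b i\<close> and
  \<open>d i\<close> along it, and let the absence of violations show that no vertex is left over.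
  The digits then follow from the increment clause by induction, starting with the element of
  \<open>S\<close>, which has none.\<close>

lemma coded_if_complete_chain:
  assumes fin: "finite B" and cc: "complete_chain A B D S T E" and nv: "\<not> violation A B D S T E"
    and ST: "S \<subseteq> A" "T \<subseteq> A"
  shows "\<exists>N a b d. coded A B D S T E N a b d"
proof -
  from cc obtain s where s: "s \<in> S" by (auto simp: complete_chain_def)
  obtain N a where a0: "a 0 = s" and aT: "a N \<in> T" and aA: "\<forall>i\<le>N. a i \<in> A"
    and step: "\<forall>i<N. (a i, a (Suc i)) \<in> E \<and> chain_le B E (a i) (a (Suc i)) \<and> \<not> chain_le B E (a (Suc i)) (a i)"
    using complete_chain_path[OF fin cc, of s] s ST by auto
  \<comment> \<open>\<open>b i\<close> is to be a neighbour that is lost at the next step, which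
    makes adjacency of \<open>a i\<close> to \<open>b j\<close> a threshold in \<open>i\<close>; at
    \<open>N\<close> any neighbour will do.\<close>
  have "\<exists>b\<in>B. (a i, b) \<in> E \<and> (i < N \<longrightarrow> (a (Suc i), b) \<notin> E)" if "i \<le> N" for i
  proof (cases "i = N")
    case True
    then show ?thesis using aT cc by (auto simp: complete_chain_def)
  next
    case False
    then show ?thesis using step that by (auto simp: chain_le_def)
  qed
  then obtain b where b: "b i \<in> B" "(a i, b i) \<in> E" "i < N \<Longrightarrow> (a (Suc i), b i) \<notin> E" if "i \<le> N" for i
    by metis
  have "\<exists>d\<in>D. \<forall>b\<in>B. (a i, b) \<in> E \<longleftrightarrow> (d, b) \<in> E" if "i \<le> N" for i
    using cc aA that by (simp add: complete_chain_def)
  then obtain d where d: "d i \<in> D" "\<forall>b\<in>B. (a i, b) \<in> E \<longleftrightarrow> (d i, b) \<in> E" if "i \<le> N" for i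
    by metis
  have anti: "chain_le B E (a i) (a j)" if "i \<le> j" "j \<le> N" for i j
    using that
  proof (induction j rule: dec_induct)
    case base
    then show ?case by (simp add: chain_le_def)
  next
    case (step j)
    then show ?case using \<open>\<forall>i<N. (a i, a (Suc i)) \<in> E \<and> _ i\<close> by (simp add: chain_le_def)
  qed
  have ab: "(a i, b j) \<in> E \<longleftrightarrow> i \<le> j" if ij: "i \<le> N" "j \<le> N" for i j
  proof
    assume "(a i, b j) \<in> E"
    show "i \<le> j"
    proof (rule ccontr)
      assume "\<not> i \<le> j"
      then have "chain_le B E (a (Suc j)) (a i)" "j < N" using ij anti by auto
      then show False using \<open>(a i, b j) \<in> E\<close> b[OF ij(2)] by (auto simp: chain_le_def)
    qed
  next
    assume "i \<le> j"
    then show "(a i, b j) \<in> E" using anti[of i j] b[OF ij(2)] ij by (auto simp: chain_le_def)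
  qed
  have db: "(d i, b j) \<in> E \<longleftrightarrow> i \<le> j" if "i \<le> N" "j \<le> N" for i j
    using ab[OF that] d[OF that(1)] b(1)[OF that(2)] by blast
  have sets: "A = a ` {..N} \<and> B = b ` {..N} \<and> D = d ` {..N} \<and> S = {a 0} \<and> T = {a N}"
    using aA b(1) d(1) a0 s aT ST step ab db nv by (intro chain_exhausts) auto
  then have bit: "chain_bit B D E x (a j) \<longleftrightarrow> (x, d j) \<in> E" if "j \<le> N" for j x
    using order_bit_iff[of B b N D d a E j x] ab db that by blast
  have le: "chain_le B E (a i) (a j) \<longleftrightarrow> i \<le> j" if "i \<le> N" "j \<le> N" for i j
  proof
    assume "chain_le B E (a i) (a j)"
    then have "(a i, b j) \<in> E" using ab[of j j] b(1)[of j] that by (auto simp: chain_le_def)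
    then show "i \<le> j" using ab that by simp
  qed (use anti that in auto)
  have ballA: "(\<forall>x\<in>A. P x) \<longleftrightarrow> (\<forall>i\<le>N. P (a i))" and bexA: "(\<exists>x\<in>A. P x) \<longleftrightarrow> (\<exists>i\<le>N. P (a i))" for P
    using sets by auto
  have flips: "\<forall>y\<in>A. \<forall>y'\<in>A. \<not> chain_le B E y' y \<and> (\<forall>z\<in>A. chain_le B E z y \<or> chain_le B E y' z) \<longrightarrow>
       (\<forall>x\<in>A. chain_bit B D E x y' \<longleftrightarrow>
         (chain_bit B D E x y \<longleftrightarrow> (\<exists>z\<in>A. \<not> chain_le B E x z \<and> \<not> chain_bit B D E z y)))"
    using cc unfolding complete_chain_def by (elim conjE)
  have "\<forall>i\<le>N. (a i, d j) \<in> E \<longleftrightarrow> i \<in> set_decode j" if "j \<le> N" for j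
    using that
  proof (induction j)
    case 0
    have "\<not> chain_bit B D E (a i) (a 0)" if "i \<le> N" for i
      using cc a0 s aA that unfolding complete_chain_def by blast
    then show ?case using bit by simp
  next
    case (Suc j)
    have "\<not> chain_le B E (a (Suc j)) (a j)" "\<forall>z\<in>A. chain_le B E z (a j) \<or> chain_le B E (a (Suc j)) z"
      using le Suc.prems unfolding ballA by auto
    then have flip: "chain_bit B D E (a i) (a (Suc j)) \<longleftrightarrow> (chain_bit B D E (a i) (a j) \<longleftrightarrow>
        (\<exists>z\<in>A. \<not> chain_le B E (a i) z \<and> \<not> chain_bit B D E z (a j)))" if "i \<le> N" for i
      using aA that Suc.prems
      by (intro flips[THEN bspec, THEN bspec, THEN mp, THEN bspec]) auto
    have IH: "\<forall>i\<le>N. (a i, d j) \<in> E \<longleftrightarrow> i \<in> set_decode j" using Suc by simp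
    show ?case
    proof (intro allI impI)
      fix i assume i: "i \<le> N"
      have "(\<exists>z\<in>A. \<not> chain_le B E (a i) z \<and> \<not> chain_bit B D E z (a j)) \<longleftrightarrow> (\<exists>l<i. l \<notin> set_decode j)"
      proof -
        have "(\<exists>z\<in>A. \<not> chain_le B E (a i) z \<and> \<not> chain_bit B D E z (a j)) \<longleftrightarrow>
            (\<exists>l\<le>N. \<not> i \<le> l \<and> l \<notin> set_decode j)"
          unfolding bexA using IH bit[of j] le[OF i] Suc.prems by auto
        also have "\<dots> \<longleftrightarrow> (\<exists>l<i. l \<notin> set_decode j)"
          using i by (meson leD leI less_imp_le order_trans)
        finally show ?thesis .
      qed
      then show "(a i, d (Suc j)) \<in> E \<longleftrightarrow> i \<in> set_decode (Suc j)"
        using flip[OF i] bit[of "Suc j"] bit[of j] IH i Suc.prems mem_set_decode_Suc[of i j] by simp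
    qed
  qed
  then have "coded A B D S T E N a b d"
    using sets step ab db by (simp add: coded_def)
  then show ?thesis by blast
qed


section \<open>Chains in graphs\<close>

text \<open>A clique \<open>qs\<close> with ten vertices serves as a list of parameters; a vertex is classified by the
  number of its neighbours in \<open>qs\<close>, which does not depend on the order of \<open>qs\<close>.\<close>

definition clique10 :: "'a graph \<Rightarrow> 'a list \<Rightarrow> bool" where
  "clique10 G qs \<longleftrightarrow> length qs = 10 \<and> distinct qs \<and> set qs \<subseteq> verts G \<and>
     (\<forall>p\<in>set qs. \<forall>q\<in>set qs. p \<noteq> q \<longrightarrow> (p, q) \<in> edges G)"

definition labelled :: "'a graph \<Rightarrow> 'a list \<Rightarrow> nat set \<Rightarrow> 'a set" where
  "labelled G qs L = {x \<in> verts G. length (filter (\<lambda>q. (x, q) \<in> edges G) qs) \<in> L}"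

text \<open>Labels \<open>4\<close> and \<open>5\<close> mark the ends of the chain and count for
  \<open>A\<close> as well, which gives \<open>S \<subseteq> A\<close> and
  \<open>T \<subseteq> A\<close> in every graph.\<close>

definition at_labels ::
  "('a set \<Rightarrow> 'a set \<Rightarrow> 'a set \<Rightarrow> 'a set \<Rightarrow> 'a set \<Rightarrow> ('a \<times> 'a) set \<Rightarrow> 'b) \<Rightarrow> 'a graph \<Rightarrow> 'a list \<Rightarrow> 'b" where
  "at_labels P G qs = P (labelled G qs {1, 4, 5}) (labelled G qs {2}) (labelled G qs {3})
     (labelled G qs {4}) (labelled G qs {5}) (edges G)"

text \<open>A mere violation counts as an obstruction too. So if further vertices of a larger graph
  spoil a chain, the larger graph is obstructed nevertheless.\<close>

definition obstructed :: "(nat \<Rightarrow> bool) \<Rightarrow> 'a graph \<Rightarrow> bool" where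
  "obstructed P G \<longleftrightarrow> (\<exists>qs. clique10 G qs \<and>
     (at_labels violation G qs \<or> (\<exists>N a b d. at_labels coded G qs N a b d \<and> P N)))"

lemma labelled_subset: "labelled G qs L \<subseteq> verts G"
  by (auto simp: labelled_def)

lemma labelled_mono: "L \<subseteq> L' \<Longrightarrow> labelled G qs L \<subseteq> labelled G qs L'"
  by (auto simp: labelled_def)

lemma labelled_induced:
  assumes "set qs \<subseteq> W" "W \<subseteq> verts G"
  shows "labelled (induced G W) qs L = labelled G qs L \<inter> W"
proof -
  have "filter (\<lambda>q. (x, q) \<in> edges (induced G W)) qs = filter (\<lambda>q. (x, q) \<in> edges G) qs" if "x \<in> W" for x
    using assms that by (auto intro!: filter_cong)
  then show ?thesis using assms by (auto simp: labelled_def)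
qed

lemma clique10_induced:
  "W \<subseteq> verts G \<Longrightarrow> clique10 (induced G W) qs \<longleftrightarrow> set qs \<subseteq> W \<and> clique10 G qs"
  by (auto simp: clique10_def)

section \<open>Persistence and bounded size of violations\<close>

lemma between_mono:
  assumes "between A B S T E a x" "A \<subseteq> A'" "B \<subseteq> B'" "S \<subseteq> S'" "T \<subseteq> T'"
  shows "between A' B' S' T' E a x"
  using assms unfolding between_def by (meson subsetD)

text \<open>The vertex sets occur only positively, mostly as ranges of existential quantifiers,
  while \<open>E\<close> stays fixed.\<close>

lemma violation_mono:
  assumes "violation A B D S T E" "A \<subseteq> A'" "B \<subseteq> B'" "D \<subseteq> D'" "S \<subseteq> S'" "T \<subseteq> T'"
  shows "violation A' B' D' S' T' E"
proof -
  have b: "between A B S T E a x \<Longrightarrow> between A' B' S' T' E a x" for a x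
    by (rule between_mono[OF _ assms(2,3,5,6)])
  have bex: "\<exists>x\<in>X. p x \<Longrightarrow> X \<subseteq> Y \<Longrightarrow> (\<And>x. x \<in> X \<Longrightarrow> p x \<Longrightarrow> p' x) \<Longrightarrow> \<exists>x\<in>Y. p' x"
    for X Y :: "'a set" and p p' by blast
  show ?thesis
    using assms(1) unfolding violation_def
    by (elim disj_forward bex) (use assms(2-6) b in auto)
qed

lemma between_restrict:
  assumes "A \<subseteq> W" "B \<subseteq> W" "a \<in> W" "x \<in> W"
  shows "between A B S T (E \<inter> W \<times> W) a x \<longleftrightarrow> between A B S T E a x"
proof -
  have "(u, v) \<in> E \<inter> W \<times> W \<longleftrightarrow> (u, v) \<in> E" if "u \<in> W" "v \<in> W" for u v using that by simp
  then show ?thesis using assms unfolding between_def by (smt (verit) subsetD)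
qed

lemma violation_restrict:
  assumes "A \<subseteq> W" "B \<subseteq> W" "D \<subseteq> W" "S \<subseteq> W" "T \<subseteq> W"
  shows "violation A B D S T (E \<inter> W \<times> W) \<longleftrightarrow> violation A B D S T E"
proof -
  have b: "between A B S T (E \<inter> W \<times> W) a x \<longleftrightarrow> between A B S T E a x" if "a \<in> W" "x \<in> W" for a x
    using between_restrict assms that by metis
  show ?thesis
    unfolding violation_def
    by (intro arg_cong2[of _ _ _ _ "(\<or>)"] bex_cong refl)
      (use assms in \<open>auto simp: b subset_iff\<close>)
qed

text \<open>Four quantified witnesses suffice, together with \<open>a\<close> itself, because
  membership of \<open>a\<close> in \<open>S\<close> or \<open>T\<close> is tested in the restricted
  sets.\<close>

lemma between_small:
  assumes "between A B S T E a x"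
  shows "\<exists>W. finite W \<and> card W \<le> 5 \<and> between (A \<inter> W) (B \<inter> W) (S \<inter> W) (T \<inter> W) E a x"
proof -
  from assms obtain b a2 where b: "b \<in> B" "(a, b) \<in> E" "(x, b) \<in> E"
    "a \<in> T \<or> (a2 \<in> A \<and> (a, a2) \<in> E \<and> (a2, b) \<notin> E)" unfolding between_def by blast
  from assms obtain a1 b1 where b1: "a \<in> S \<or>
    (a1 \<in> A \<and> b1 \<in> B \<and> (a1, a) \<in> E \<and> (a1, b1) \<in> E \<and> (a, b1) \<notin> E \<and> (x, b1) \<notin> E)"
    unfolding between_def by blast
  have "between (A \<inter> {a, b, a2, a1, b1}) (B \<inter> {a, b, a2, a1, b1})
      (S \<inter> {a, b, a2, a1, b1}) (T \<inter> {a, b, a2, a1, b1}) E a x"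
    unfolding between_def using b b1 by blast
  then show ?thesis by (intro exI[of _ "{a, b, a2, a1, b1}"]) (auto simp: card_insert_if)
qed

text \<open>The costliest case is a pair of vertices at one position: \<open>a\<close>,
  \<open>x\<close>, \<open>x'\<close> and five witnesses for each \<open>between\<close> give
  13.\<close>

lemma violation_small:
  assumes "violation A B D S T E"
  shows "\<exists>W. finite W \<and> card W \<le> 13 \<and> violation (A \<inter> W) (B \<inter> W) (D \<inter> W) (S \<inter> W) (T \<inter> W) E"
proof -
  let ?v = "\<lambda>W. violation (A \<inter> W) (B \<inter> W) (D \<inter> W) (S \<inter> W) (T \<inter> W) E"
  have pair: ?thesis
    if a: "a \<in> A" "x \<noteq> x'" "x \<in> A \<and> x' \<in> A \<or> x \<in> D \<and> x' \<in> D"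
      "between A B S T E a x" "between A B S T E a x'" for a x x'
  proof -
    obtain W1 where W1: "finite W1" "card W1 \<le> 5"
      "between (A \<inter> W1) (B \<inter> W1) (S \<inter> W1) (T \<inter> W1) E a x" using between_small[OF a(4)] by blast
    obtain W2 where W2: "finite W2" "card W2 \<le> 5"
      "between (A \<inter> W2) (B \<inter> W2) (S \<inter> W2) (T \<inter> W2) E a x'" using between_small[OF a(5)] by blast
    let ?W = "{a, x, x'} \<union> (W1 \<union> W2)"
    have "between (A \<inter> ?W) (B \<inter> ?W) (S \<inter> ?W) (T \<inter> ?W) E a x"
      by (rule between_mono[OF W1(3)]) auto
    moreover have "between (A \<inter> ?W) (B \<inter> ?W) (S \<inter> ?W) (T \<inter> ?W) E a x'"
      by (rule between_mono[OF W2(3)]) auto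
    moreover have "a \<in> A \<inter> ?W" "x \<in> A \<inter> ?W \<and> x' \<in> A \<inter> ?W \<or> x \<in> D \<inter> ?W \<and> x' \<in> D \<inter> ?W" using a by auto
    ultimately have "?v ?W" unfolding violation_def using a(2) by metis
    moreover have "card ?W \<le> 3 + (5 + 5)"
      by (intro order_trans[OF card_Un_le] add_mono W1 W2) (auto simp: card_insert_if)
    ultimately show ?thesis using W1(1) W2(1) by (intro exI[of _ ?W]) auto
  qed
  have few: ?thesis if "?v (set xs)" "length xs \<le> 13" for xs
    using that card_length[of xs] by (intro exI[of _ "set xs"]) auto
  from assms consider
      s b where "s \<in> S" "b \<in> B" "(s, b) \<notin> E"
    | e x b where "e \<in> T" "x \<in> A \<union> D" "b \<in> B" "(e, b) \<in> E" "(x, b) \<notin> E"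
    | e b b' where "e \<in> T" "b \<in> B" "b' \<in> B" "b \<noteq> b'" "(e, b) \<in> E" "(e, b') \<in> E"
    | a a' b b' where "a \<in> A" "a' \<in> A" "b \<in> B" "b' \<in> B" "(a, a') \<in> E" "b \<noteq> b'"
        "(a, b) \<in> E" "(a', b) \<notin> E" "(a, b') \<in> E" "(a', b') \<notin> E"
    | a x x' where "a \<in> A" "x \<noteq> x'" "x \<in> A \<and> x' \<in> A \<or> x \<in> D \<and> x' \<in> D"
      "between A B S T E a x" "between A B S T E a x'"
    unfolding violation_def by (elim disjE bexE conjE) metis+
  then show ?thesis
  proof cases
    case (1 s b)
    then have "?v (set [s, b])" unfolding violation_def by (intro disjI1) auto
    then show ?thesis by (rule few) simp
  next
    case (2 e x b)
    then have "?v (set [e, x, b])" unfolding violation_def by (intro disjI2 disjI1) auto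
    then show ?thesis by (rule few) simp
  next
    case (3 e b b')
    then have "\<exists>u\<in>T \<inter> set [e, b, b']. \<exists>v\<in>B \<inter> set [e, b, b']. \<exists>v'\<in>B \<inter> set [e, b, b'].
        v \<noteq> v' \<and> (u, v) \<in> E \<and> (u, v') \<in> E"
      by (intro bexI[of _ e] bexI[of _ b] bexI[of _ b']) auto
    then have "?v (set [e, b, b'])"
      unfolding violation_def by - (rule disjI2, rule disjI2, rule disjI1)
    then show ?thesis by (rule few) simp
  next
    case (4 a a' b b')
    then have "\<exists>u\<in>A \<inter> set [a, a', b, b']. \<exists>u'\<in>A \<inter> set [a, a', b, b'].
        \<exists>v\<in>B \<inter> set [a, a', b, b']. \<exists>v'\<in>B \<inter> set [a, a', b, b'].
        (u, u') \<in> E \<and> v \<noteq> v' \<and> (u, v) \<in> E \<and> (u', v) \<notin> E \<and> (u, v') \<in> E \<and> (u', v') \<notin> E"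
      by (intro bexI[of _ a] bexI[of _ a'] bexI[of _ b] bexI[of _ b']) auto
    then have "?v (set [a, a', b, b'])"
      unfolding violation_def by - (rule disjI2, rule disjI2, rule disjI2, rule disjI1)
    then show ?thesis by (rule few) simp
  qed (rule pair)
qed

lemma violation_induced:
  assumes "W \<subseteq> verts G" "set qs \<subseteq> W"
  shows "at_labels violation (induced G W) qs \<longleftrightarrow>
    violation (labelled G qs {1, 4, 5} \<inter> W) (labelled G qs {2} \<inter> W) (labelled G qs {3} \<inter> W)
      (labelled G qs {4} \<inter> W) (labelled G qs {5} \<inter> W) (edges G)"
  unfolding at_labels_def labelled_induced[OF assms(2,1)] edges_induced
  by (rule violation_restrict) auto

lemma coded_induced_extend:
  assumes W: "W \<subseteq> verts G" "set qs \<subseteq> W" and c: "at_labels coded (induced G W) qs N a b d"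
    and nv: "\<not> at_labels violation G qs"
  shows "at_labels coded G qs N a b d"
proof -
  let ?L = "labelled G qs"
  have c': "?L {1, 4, 5} \<inter> W = a ` {..N}" "?L {2} \<inter> W = b ` {..N}" "?L {3} \<inter> W = d ` {..N}"
    "?L {4} \<inter> W = {a 0}" "?L {5} \<inter> W = {a N}"
    and E: "\<And>i. i < N \<Longrightarrow> (a i, a (Suc i)) \<in> edges G \<inter> W \<times> W"
    "\<And>i j. i \<le> N \<Longrightarrow> j \<le> N \<Longrightarrow> (a i, b j) \<in> edges G \<inter> W \<times> W \<longleftrightarrow> i \<le> j"
    "\<And>i j. i \<le> N \<Longrightarrow> j \<le> N \<Longrightarrow> (d i, b j) \<in> edges G \<inter> W \<times> W \<longleftrightarrow> i \<le> j"
    "\<And>i j. i \<le> N \<Longrightarrow> j \<le> N \<Longrightarrow> (a i, d j) \<in> edges G \<inter> W \<times> W \<longleftrightarrow> i \<in> set_decode j"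
    using c unfolding at_labels_def labelled_induced[OF W(2,1)] edges_induced coded_def
    by (elim conjE; simp)+
  have in_sets: "a i \<in> ?L {1, 4, 5} \<inter> W" "b i \<in> ?L {2} \<inter> W" "d i \<in> ?L {3} \<inter> W" if "i \<le> N" for i
    unfolding c' using that by auto
  have ends: "a 0 \<in> ?L {4}" "a N \<in> ?L {5}" using c'(4,5) by blast+
  have E': "i < N \<Longrightarrow> (a i, a (Suc i)) \<in> edges G"
    "i \<le> N \<Longrightarrow> j \<le> N \<Longrightarrow> (a i, b j) \<in> edges G \<longleftrightarrow> i \<le> j"
    "i \<le> N \<Longrightarrow> j \<le> N \<Longrightarrow> (d i, b j) \<in> edges G \<longleftrightarrow> i \<le> j"
    "i \<le> N \<Longrightarrow> j \<le> N \<Longrightarrow> (a i, d j) \<in> edges G \<longleftrightarrow> i \<in> set_decode j" for i j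
    using E[of i] in_sets[of i] in_sets[of j] by auto
  have "?L {1, 4, 5} = a ` {..N} \<and> ?L {2} = b ` {..N} \<and> ?L {3} = d ` {..N} \<and>
      ?L {4} = {a 0} \<and> ?L {5} = {a N}"
    by (rule chain_exhausts[where E = "edges G"])
      (use in_sets ends E' nv in \<open>auto simp: at_labels_def labelled_mono\<close>)
  then show ?thesis by (simp add: at_labels_def coded_def E' del: One_nat_def)
qed

lemma coded_induced:
  assumes W: "W \<subseteq> verts G" "set qs \<subseteq> W" and c: "at_labels coded G qs N a b d"
    and sub: "labelled G qs {1, 2, 3, 4, 5} \<subseteq> W"
  shows "at_labels coded (induced G W) qs N a b d"
proof -
  have L: "labelled G qs L \<inter> W = labelled G qs L" if "L \<subseteq> {1, 2, 3, 4, 5}" for L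
    using labelled_mono[OF that, of G qs] sub by blast
  have "labelled G qs {1, 4, 5} = a ` {..N}" "labelled G qs {2} = b ` {..N}" "labelled G qs {3} = d ` {..N}"
    using c by (simp_all add: at_labels_def coded_def)
  then have "a ` {..N} \<subseteq> W" "b ` {..N} \<subseteq> W" "d ` {..N} \<subseteq> W"
    using L[of "{1, 4, 5}"] L[of "{2}"] L[of "{3}"] by blast+
  then have im: "a ` {..N} \<inter> W = a ` {..N}" "b ` {..N} \<inter> W = b ` {..N}" "d ` {..N} \<inter> W = d ` {..N}"
    and m: "i \<le> N \<Longrightarrow> a i \<in> W" "i \<le> N \<Longrightarrow> b i \<in> W" "i \<le> N \<Longrightarrow> d i \<in> W" for i by auto
  show ?thesis
    using c unfolding at_labels_def labelled_induced[OF W(2,1)] edges_induced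
    by (simp add: L coded_def m Suc_le_eq im del: One_nat_def)
qed

text \<open>Violations persist upwards. Without one in \<open>G\<close>, a chain found in the
  subgraph already exhausts the labelled vertices of \<open>G\<close>, so it is a chain of
  \<open>G\<close> with the same \<open>N\<close>.\<close>

lemma obstructed_if_induced:
  assumes "W \<subseteq> verts G" "obstructed P (induced G W)"
  shows "obstructed P G"
proof -
  from assms obtain qs where qs: "set qs \<subseteq> W" "clique10 G qs"
    and d: "at_labels violation (induced G W) qs \<or> (\<exists>N a b d. at_labels coded (induced G W) qs N a b d \<and> P N)"
    unfolding obstructed_def clique10_induced[OF assms(1)] by blast
  show ?thesis
  proof (cases "at_labels violation G qs")
    case False
    have "\<not> at_labels violation (induced G W) qs"
    proof
      assume "at_labels violation (induced G W) qs"
      then have "at_labels violation G qs"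
        unfolding violation_induced[OF assms(1) qs(1)] unfolding at_labels_def by (rule violation_mono) auto
      with False show False by blast
    qed
    then show ?thesis
      using d False coded_induced_extend[OF assms(1) qs(1)] qs(2) unfolding obstructed_def by blast
  qed (use qs(2) in \<open>auto simp: obstructed_def\<close>)
qed

text \<open>The ten parameters and the at most 13 vertices of a violation give 23; a chain costs the
  parameters and three sequences of \<open>Suc N\<close> vertices.\<close>

lemma obstructed_small:
  assumes G: "finite (verts G)" "obstructed P G" and P: "\<And>N. P N \<Longrightarrow> N \<le> M"
  shows "\<exists>W\<subseteq>verts G. W \<noteq> {} \<and> card W \<le> 23 + 3 * Suc M \<and> obstructed P (induced G W)"
proof -
  from G(2) obtain qs where qs: "clique10 G qs"
    and d: "at_labels violation G qs \<or> (\<exists>N a b d. at_labels coded G qs N a b d \<and> P N)"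
    unfolding obstructed_def by blast
  have q: "set qs \<subseteq> verts G" "set qs \<noteq> {}" "card (set qs) = 10"
    using qs by (auto simp: clique10_def distinct_card)
  from d show ?thesis
  proof
    assume "at_labels violation G qs"
    from violation_small[OF this[unfolded at_labels_def]] obtain W where W: "finite W" "card W \<le> 13"
      "violation (labelled G qs {1, 4, 5} \<inter> W) (labelled G qs {2} \<inter> W) (labelled G qs {3} \<inter> W)
        (labelled G qs {4} \<inter> W) (labelled G qs {5} \<inter> W) (edges G)" by blast
    define W' where "W' = set qs \<union> (W \<inter> verts G)"
    have W': "W' \<subseteq> verts G" "set qs \<subseteq> W'" using q by (auto simp: W'_def)
    have "at_labels violation (induced G W') qs"
      unfolding violation_induced[OF W'] using labelled_subset[of G qs]
      by (intro violation_mono[OF W(3)]) (auto simp: W'_def)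
    then have "obstructed P (induced G W')"
      unfolding obstructed_def clique10_induced[OF W'(1)] using qs W'(2) by blast
    moreover have "card (W \<inter> verts G) \<le> 13" using W card_mono[of W "W \<inter> verts G"] by auto
    then have "card W' \<le> 23"
      using card_Un_le[of "set qs" "W \<inter> verts G"] q(3) by (simp add: W'_def)
    ultimately show ?thesis using W' q(2) by (intro exI[of _ W']) auto
  next
    assume "\<exists>N a b d. at_labels coded G qs N a b d \<and> P N"
    then obtain N a b d where c: "at_labels coded G qs N a b d" and N: "P N" by blast
    define W' where "W' = set qs \<union> (a ` {..N} \<union> (b ` {..N} \<union> d ` {..N}))"
    have L: "labelled G qs {1, 4, 5} = a ` {..N}" "labelled G qs {2} = b ` {..N}" "labelled G qs {3} = d ` {..N}"
      using c by (auto simp: at_labels_def coded_def)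
    then have W': "W' \<subseteq> verts G" "set qs \<subseteq> W'"
      using q(1) labelled_subset[of G qs] unfolding W'_def by blast+
    have "labelled G qs {1, 2, 3, 4, 5} = labelled G qs {1, 4, 5} \<union> (labelled G qs {2} \<union> labelled G qs {3})"
      by (auto simp: labelled_def)
    then have "labelled G qs {1, 2, 3, 4, 5} \<subseteq> W'" unfolding L W'_def by blast
    then have "obstructed P (induced G W')"
      unfolding obstructed_def clique10_induced[OF W'(1)] using qs W'(2) coded_induced[OF W' c] N by blast
    moreover have "card W' \<le> 10 + (Suc N + (Suc N + Suc N))"
      unfolding W'_def
      by (intro order_trans[OF card_Un_le] add_mono order_trans[OF card_image_le]) (simp_all add: q)
    then have "card W' \<le> 23 + 3 * Suc M" using P[OF N] by simp
    ultimately show ?thesis using W' q(2) by (intro exI[of _ W']) auto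
  qed
qed


section \<open>A graph containing a chain\<close>

lemma coded_inj:
  assumes "coded A B D S T E N a b d" "i \<le> N" "j \<le> N" "a i = a j"
  shows "i = j"
  using assms coded_chain_le[of A B D S T E N a b d i j] coded_chain_le[of A B D S T E N a b d j i]
    coded_chain_le[of A B D S T E N a b d i i] by simp

text \<open>\<open>coded\<close> leaves room for further edges inside \<open>A\<close>. With
  consecutive edges only, \<open>between\<close> bounds the index of \<open>x\<close> from above
  through the next element and from below through the previous one.\<close>

lemma not_violation_if_coded:
  assumes c: "coded A B D S T E N a b d"
    and path: "\<And>i j. i \<le> N \<Longrightarrow> j \<le> N \<Longrightarrow> (a i, a j) \<in> E \<longleftrightarrow> i = Suc j \<or> j = Suc i"
  shows "\<not> violation A B D S T E"
proof -
  have sets: "A = a ` {..N}" "B = b ` {..N}" "D = d ` {..N}" "S = {a 0}" "T = {a N}"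
    and ab: "\<And>i j. i \<le> N \<Longrightarrow> j \<le> N \<Longrightarrow> (a i, b j) \<in> E \<longleftrightarrow> i \<le> j"
    and db: "\<And>i j. i \<le> N \<Longrightarrow> j \<le> N \<Longrightarrow> (d i, b j) \<in> E \<longleftrightarrow> i \<le> j"
    using c by (simp_all add: coded_def)
  note inj = coded_inj[OF c]
  have between: "k = i"
    if i: "i \<le> N" and k: "k \<le> N" and x: "\<And>j. j \<le> N \<Longrightarrow> (x, b j) \<in> E \<longleftrightarrow> k \<le> j"
      and bt: "between A B S T E (a i) x" for i k x
  proof (rule antisym)
    from bt obtain v where v: "v \<in> B" "(a i, v) \<in> E" "(x, v) \<in> E"
      "a i \<in> T \<or> (\<exists>a2\<in>A. (a i, a2) \<in> E \<and> (a2, v) \<notin> E)"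
      unfolding between_def by blast
    from v(1) obtain m where m: "m \<le> N" "v = b m" unfolding sets by blast
    have im: "i \<le> m" and km: "k \<le> m" using v(2,3) m ab[OF i] x by auto
    from v(4) show "k \<le> i"
    proof
      assume "a i \<in> T"
      then have "i = N" using sets inj[OF i] by auto
      then show ?thesis using k by simp
    next
      assume "\<exists>a2\<in>A. (a i, a2) \<in> E \<and> (a2, v) \<notin> E"
      then obtain l where l: "l \<le> N" "(a i, a l) \<in> E" "(a l, b m) \<notin> E" unfolding sets m(2) by blast
      \<comment> \<open>Edges are undirected, but \<open>i \<le> m < l\<close> rules out the
        predecessor, so \<open>l = Suc i\<close> and \<open>m = i\<close>.\<close>
      then have "\<not> l \<le> m" "i = Suc l \<or> l = Suc i" using ab[OF l(1) m(1)] path[OF i l(1)] by auto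
      then show ?thesis using im km by auto
    qed
    from bt have "a i \<in> S \<or> (\<exists>a1\<in>A. \<exists>v\<in>B. (a1, a i) \<in> E \<and> (a1, v) \<in> E \<and> (a i, v) \<notin> E \<and> (x, v) \<notin> E)"
      unfolding between_def by blast
    then show "i \<le> k"
    proof
      assume "a i \<in> S"
      then have "i = 0" using sets inj[OF i] by auto
      then show ?thesis by simp
    next
      assume "\<exists>a1\<in>A. \<exists>v\<in>B. (a1, a i) \<in> E \<and> (a1, v) \<in> E \<and> (a i, v) \<notin> E \<and> (x, v) \<notin> E"
      then obtain l m where l: "l \<le> N" "m \<le> N" "(a l, a i) \<in> E" "(a l, b m) \<in> E" "(a i, b m) \<notin> E" "(x, b m) \<notin> E"
        unfolding sets by blast
      then have "\<not> i \<le> m" "l \<le> m" "\<not> k \<le> m" "l = Suc i \<or> i = Suc l"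
        using ab[OF l(1,2)] ab[OF i l(2)] x[OF l(2)] path[OF l(1) i] by auto
      then show ?thesis by auto
    qed
  qed
  have A: "\<not> (\<exists>u\<in>A. \<exists>x\<in>A. \<exists>x'\<in>A. x \<noteq> x' \<and> between A B S T E u x \<and> between A B S T E u x')"
  proof clarify
    fix u x x' assume "u \<in> A" "x \<in> A" "x' \<in> A" and bt: "between A B S T E u x" "between A B S T E u x'" and "x \<noteq> x'"
    then obtain i k k' where "u = a i" "x = a k" "x' = a k'" "i \<le> N" "k \<le> N" "k' \<le> N" using sets by auto
    then show False using between[of i k x] between[of i k' x'] bt ab \<open>x \<noteq> x'\<close> by simp
  qed
  have D: "\<not> (\<exists>u\<in>A. \<exists>x\<in>D. \<exists>x'\<in>D. x \<noteq> x' \<and> between A B S T E u x \<and> between A B S T E u x')"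
  proof clarify
    fix u x x' assume "u \<in> A" "x \<in> D" "x' \<in> D" and bt: "between A B S T E u x" "between A B S T E u x'" and "x \<noteq> x'"
    then obtain i k k' where "u = a i" "x = d k" "x' = d k'" "i \<le> N" "k \<le> N" "k' \<le> N" using sets by auto
    then show False using between[of i k x] between[of i k' x'] bt db \<open>x \<noteq> x'\<close> by simp
  qed
  have B: "\<not> (\<exists>u\<in>A. \<exists>u'\<in>A. \<exists>v\<in>B. \<exists>v'\<in>B. (u, u') \<in> E \<and> v \<noteq> v' \<and>
        (u, v) \<in> E \<and> (u', v) \<notin> E \<and> (u, v') \<in> E \<and> (u', v') \<notin> E)"
  proof clarify
    fix u u' v v' assume "u \<in> A" "u' \<in> A" "v \<in> B" "v' \<in> B" and e: "(u, u') \<in> E"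
      "(u, v) \<in> E" "(u', v) \<notin> E" "(u, v') \<in> E" "(u', v') \<notin> E" and ne: "v \<noteq> v'"
    then obtain i i' k k' where "u = a i" "u' = a i'" "v = b k" "v' = b k'"
      "i \<le> N" "i' \<le> N" "k \<le> N" "k' \<le> N" using sets by auto
    moreover from this have "k = k'" using e ab[of i k] ab[of i k'] ab[of i' k] ab[of i' k'] path[of i i'] by auto
    ultimately show False using ne by simp
  qed
  have "\<not> (\<exists>s\<in>S. \<exists>b\<in>B. (s, b) \<notin> E)" using ab[of 0] by (auto simp: sets)
  moreover have "\<not> (\<exists>e\<in>T. \<exists>x\<in>A \<union> D. \<exists>b\<in>B. (e, b) \<in> E \<and> (x, b) \<notin> E)"
    using ab db by (auto simp: sets)
  moreover have "\<not> (\<exists>e\<in>T. \<exists>b\<in>B. \<exists>b'\<in>B. b \<noteq> b' \<and> (e, b) \<in> E \<and> (e, b') \<in> E)"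
    using ab[of N] by (auto simp: sets)
  ultimately show ?thesis unfolding violation_def using A B D by (intro notI) (elim disjE; blast)
qed

text \<open>The type \<open>t\<close> of a vertex \<open>(t, i)\<close> is \<open>0\<close>, \<open>1\<close>, \<open>2\<close>, \<open>3\<close> for members of the clique and of
  the sets \<open>A\<close>, \<open>B\<close>, \<open>D\<close> of \<^const>\<open>coded\<close>, respectively.\<close>

definition half_adj :: "nat \<Rightarrow> nat \<times> nat \<Rightarrow> nat \<times> nat \<Rightarrow> bool" where
  "half_adj N = (\<lambda>(t, i) (u, j).
     t = 0 \<and> u = 0 \<and> i \<noteq> j \<or>
     t = 1 \<and> u = 0 \<and> (j < 1 \<or> i = 0 \<and> j < 4 \<or> i = N \<and> j < 5) \<or>
     t = 2 \<and> u = 0 \<and> j < 2 \<or>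
     t = 3 \<and> u = 0 \<and> j < 3 \<or>
     t = 1 \<and> u = 1 \<and> j = Suc i \<or>
     t = 1 \<and> u = 2 \<and> i \<le> j \<or>
     t = 3 \<and> u = 2 \<and> i \<le> j \<or>
     t = 1 \<and> u = 3 \<and> i \<in> set_decode j)"

definition chain_verts :: "nat \<Rightarrow> (nat \<times> nat) set" where
  "chain_verts N = {0} \<times> {..<10} \<union> {1, 2, 3} \<times> {..N}"

definition chain_graph :: "nat \<Rightarrow> nat graph" where
  "chain_graph N = Graph (prod_encode ` chain_verts N)
     {(prod_encode p, prod_encode q) | p q. p \<in> chain_verts N \<and> q \<in> chain_verts N \<and> (half_adj N p q \<or> half_adj N q p)}"

lemma verts_chain_graph: "verts (chain_graph N) = prod_encode ` chain_verts N"
  by (simp add: chain_graph_def)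

lemma edges_chain_graph: "(prod_encode p, prod_encode q) \<in> edges (chain_graph N) \<longleftrightarrow>
    p \<in> chain_verts N \<and> q \<in> chain_verts N \<and> (half_adj N p q \<or> half_adj N q p)"
  by (cases p; cases q) (auto simp: chain_graph_def)

lemma chain_graph_fin_graphs: "chain_graph N \<in> fin_graphs"
proof -
  have "finite (chain_verts N)" "chain_verts N \<noteq> {}" by (auto simp: chain_verts_def)
  moreover have "irrefl (edges (chain_graph N))"
    by (auto simp: irrefl_def chain_graph_def half_adj_def)
  ultimately show ?thesis
    by (auto simp: fin_graphs_def is_graph_def verts_chain_graph sym_def) (auto simp: chain_graph_def)
qed

abbreviation chain_clique :: "nat set" where
  "chain_clique \<equiv> prod_encode ` ({0} \<times> {..<10})"

text \<open>A vertex outside the clique is joined to an initial part of it whose length is the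
  intended label. Clique members see the nine others, and \<open>9\<close> is not a label in use.
  For \<open>N = 0\<close> the two ends would coincide, whence the later assumption
  \<open>0 < N\<close>.\<close>

definition chain_label :: "nat \<Rightarrow> nat \<times> nat \<Rightarrow> nat" where
  "chain_label N = (\<lambda>(t, i).
     if t = 0 then 9 else if t = 1 then (if i = 0 then 4 else if i = N then 5 else 1) else if t = 2 then 2 else 3)"

lemma label_chain_graph:
  assumes "set qs = chain_clique" "distinct qs" "0 < N" "(t, i) \<in> chain_verts N"
  shows "length (filter (\<lambda>q. (prod_encode (t, i), q) \<in> edges (chain_graph N)) qs) = chain_label N (t, i)"
proof -
  let ?J = "{j. j < 10 \<and> half_adj N (t, i) (0, j) \<or> j < 10 \<and> half_adj N (0, j) (t, i)}"
  have "length (filter (\<lambda>q. (prod_encode (t, i), q) \<in> edges (chain_graph N)) qs) =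
      card ({q. (prod_encode (t, i), q) \<in> edges (chain_graph N)} \<inter> chain_clique)"
    using assms(1,2) by (simp add: distinct_length_filter)
  also have "{q. (prod_encode (t, i), q) \<in> edges (chain_graph N)} \<inter> chain_clique = (\<lambda>j. prod_encode (0, j)) ` ?J"
    using assms(4) by (auto simp: edges_chain_graph chain_verts_def)
  also have "card \<dots> = card ?J" by (rule card_image) (auto simp: inj_on_def)
  also have "?J = (if t = 0 then {..<10} - {i} else if t = 1 then (if i = 0 then {..<4} else if i = N then {..<5} else {..<1})
      else if t = 2 then {..<2} else {..<3})"
    using assms(3,4) by (auto simp: half_adj_def chain_verts_def)
  also have "card \<dots> = chain_label N (t, i)"
    using assms(4) by (auto simp: chain_verts_def chain_label_def)
  finally show ?thesis .
qed

lemma labelled_chain_graph: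
  assumes "set qs = chain_clique" "distinct qs" "0 < N"
  shows "labelled (chain_graph N) qs {1, 4, 5} = (\<lambda>i. prod_encode (1, i)) ` {..N}"
    and "labelled (chain_graph N) qs {2} = (\<lambda>i. prod_encode (2, i)) ` {..N}"
    and "labelled (chain_graph N) qs {3} = (\<lambda>i. prod_encode (3, i)) ` {..N}"
    and "labelled (chain_graph N) qs {4} = {prod_encode (1, 0)}"
    and "labelled (chain_graph N) qs {5} = {prod_encode (1, N)}"
proof -
  have L: "labelled (chain_graph N) qs L = prod_encode ` {p \<in> chain_verts N. chain_label N p \<in> L}" for L
  proof -
    have lab: "length (filter (\<lambda>q. (prod_encode p, q) \<in> edges (chain_graph N)) qs) = chain_label N p"
      if "p \<in> chain_verts N" for p
      using label_chain_graph[OF assms] that by (cases p) simp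
    show ?thesis unfolding labelled_def verts_chain_graph by (auto simp del: split_paired_All split_paired_Ex simp: lab)
  qed
  have "{p \<in> chain_verts N. chain_label N p \<in> {1, 4, 5}} = Pair 1 ` {..N}"
    "{p \<in> chain_verts N. chain_label N p \<in> {2}} = Pair 2 ` {..N}"
    "{p \<in> chain_verts N. chain_label N p \<in> {3}} = Pair 3 ` {..N}"
    "{p \<in> chain_verts N. chain_label N p \<in> {4}} = {(1, 0)}"
    "{p \<in> chain_verts N. chain_label N p \<in> {5}} = {(1, N)}"
    using assms(3) by (auto simp: chain_verts_def chain_label_def split: if_splits)
  then show "labelled (chain_graph N) qs {1, 4, 5} = (\<lambda>i. prod_encode (1, i)) ` {..N}"
    "labelled (chain_graph N) qs {2} = (\<lambda>i. prod_encode (2, i)) ` {..N}"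
    "labelled (chain_graph N) qs {3} = (\<lambda>i. prod_encode (3, i)) ` {..N}"
    "labelled (chain_graph N) qs {4} = {prod_encode (1, 0)}"
    "labelled (chain_graph N) qs {5} = {prod_encode (1, N)}"
    unfolding L by (simp_all only: image_image image_insert image_empty)
qed

lemma coded_chain_graph:
  assumes "set qs = chain_clique" "distinct qs" "0 < N"
  shows "at_labels coded (chain_graph N) qs N
    (\<lambda>i. prod_encode (1, i)) (\<lambda>i. prod_encode (2, i)) (\<lambda>i. prod_encode (3, i))"
  unfolding at_labels_def labelled_chain_graph[OF assms] coded_def
  by (auto simp: edges_chain_graph chain_verts_def half_adj_def)

lemma not_violation_chain_graph:
  assumes "set qs = chain_clique" "distinct qs" "0 < N"
  shows "\<not> at_labels violation (chain_graph N) qs"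
  unfolding at_labels_def
  by (rule not_violation_if_coded[OF coded_chain_graph[OF assms, unfolded at_labels_def]])
    (auto simp: edges_chain_graph chain_verts_def half_adj_def)

text \<open>This is why there are ten parameters. A vertex outside the designated clique has at most
  five neighbours in it, and outside it a clique contains at most two elements of \<open>A\<close>
  and one each of \<open>B\<close> and \<open>D\<close>. So any other clique has at most 5 + 2 + 1 +
  1 = 9 vertices or is part of the designated one.\<close>

lemma clique10_chain_graph_iff:
  "clique10 (chain_graph N) qs \<longleftrightarrow> length qs = 10 \<and> distinct qs \<and> set qs = chain_clique"
proof
  assume "length qs = 10 \<and> distinct qs \<and> set qs = chain_clique"
  then show "clique10 (chain_graph N) qs"
    by (auto simp: clique10_def verts_chain_graph edges_chain_graph chain_verts_def half_adj_def)
next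
  assume q: "clique10 (chain_graph N) qs"
  then have card: "card (set qs) = 10" and V: "set qs \<subseteq> prod_encode ` chain_verts N"
    by (auto simp: clique10_def distinct_card verts_chain_graph)
  define C where "C = prod_decode ` set qs"
  have C: "C \<subseteq> chain_verts N" using V by (auto simp: C_def)
  have adj: "half_adj N p p' \<or> half_adj N p' p" if "p \<in> C" "p' \<in> C" "p \<noteq> p'" for p p'
  proof -
    have "prod_encode p \<in> set qs" "prod_encode p' \<in> set qs" using that by (auto simp: C_def)
    moreover have "prod_encode p \<noteq> prod_encode p'" using that by simp
    ultimately have "(prod_encode p, prod_encode p') \<in> edges (chain_graph N)"
      using q by (simp add: clique10_def)
    then show ?thesis by (simp add: edges_chain_graph)
  qed
  have cardC: "card C = 10"
    unfolding C_def using card by (simp add: card_image inj_prod_decode)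
  have "C \<subseteq> {0} \<times> {..<10}"
  proof (rule ccontr)
    assume "\<not> C \<subseteq> {0} \<times> {..<10}"
    then obtain p where "p \<in> C" "p \<notin> {0} \<times> {..<10}" by blast
    then obtain t i where p: "(t, i) \<in> C" "t \<noteq> 0" using C by (cases p) (auto simp: chain_verts_def)
    have Q: "C \<inter> {0} \<times> UNIV \<subseteq> {0} \<times> {..<5}"
    proof
      fix p' assume "p' \<in> C \<inter> {0} \<times> UNIV"
      then show "p' \<in> {0} \<times> {..<5}"
        using adj[OF p(1), of p'] p(2) by (auto simp: half_adj_def)
    qed
    have A: "\<exists>l. C \<inter> {1} \<times> UNIV \<subseteq> {(1, l), (1, Suc l)}"
    proof (cases "C \<inter> {1} \<times> UNIV = {}")
      case False
      then have ex: "\<exists>l. (1, l) \<in> C" by auto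
      define l where "l = (LEAST l. (1, l) \<in> C)"
      have l: "(1, l) \<in> C" "\<And>k. (1, k) \<in> C \<Longrightarrow> l \<le> k"
        unfolding l_def using ex by (auto intro: LeastI_ex Least_le)
      have "k = l \<or> k = Suc l" if "(1, k) \<in> C" for k
        using adj[OF l(1) that] l(2)[OF that] by (auto simp: half_adj_def)
      then show ?thesis by (intro exI[of _ l]) auto
    qed auto
    then obtain l where A: "C \<inter> {1} \<times> UNIV \<subseteq> {(1, l), (1, Suc l)}" by blast
    have uniq: "\<exists>k. C \<inter> {t} \<times> UNIV \<subseteq> {(t, k)}" if "t \<in> {2, 3}" for t
    proof (cases "C \<inter> {t} \<times> UNIV = {}")
      case False
      then obtain k where k: "(t, k) \<in> C" by auto
      have "k' = k" if k': "(t, k') \<in> C" for k'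
      proof (rule ccontr)
        assume "k' \<noteq> k"
        then have "half_adj N (t, k) (t, k') \<or> half_adj N (t, k') (t, k)" by (intro adj k k') simp
        then show False using \<open>t \<in> {2, 3}\<close> by (auto simp: half_adj_def)
      qed
      then show ?thesis by (intro exI[of _ k]) auto
    qed auto
    from uniq[of 2] obtain m where B: "C \<inter> {2} \<times> UNIV \<subseteq> {(2, m)}" by auto
    from uniq[of 3] obtain n where D: "C \<inter> {3} \<times> UNIV \<subseteq> {(3, n)}" by auto
    have "chain_verts N \<subseteq> {0} \<times> UNIV \<union> {1} \<times> UNIV \<union> {2} \<times> UNIV \<union> {3} \<times> UNIV"
      by (auto simp: chain_verts_def)
    then have "C \<subseteq> C \<inter> {0} \<times> UNIV \<union> (C \<inter> {1} \<times> UNIV \<union> (C \<inter> {2} \<times> UNIV \<union> C \<inter> {3} \<times> UNIV))"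
      using C by blast
    also have "\<dots> \<subseteq> {0} \<times> {..<5} \<union> ({(1, l), (1, Suc l)} \<union> ({(2, m)} \<union> {(3, n)}))"
      by (intro Un_mono Q A B D)
    finally have "C \<subseteq> {0} \<times> {..<5} \<union> ({(1, l), (1, Suc l)} \<union> {(2, m), (3, n)})"
      by (simp add: insert_commute)
    from card_mono[OF _ this]
    have "card C \<le> card ({0} \<times> {..<5} \<union> ({(1, l), (1, Suc l)} \<union> {(2 :: nat, m), (3, n)}))" by simp
    also have "\<dots> \<le> 5 + (2 + 2)"
      by (intro order_trans[OF card_Un_le] add_mono) (auto simp: card_insert_if card_cartesian_product)
    finally show False using cardC by simp
  qed
  then have "C = {0} \<times> {..<10}"
    by (intro card_subset_eq) (auto simp: cardC card_cartesian_product)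
  moreover have "set qs = prod_encode ` C" unfolding C_def by (simp add: image_image)
  ultimately show "length qs = 10 \<and> distinct qs \<and> set qs = chain_clique"
    using q by (simp add: clique10_def)
qed

lemma obstructed_chain_graph:
  assumes "P N" "0 < N"
  shows "obstructed P (chain_graph N)"
proof -
  define qs where "qs = map (\<lambda>j. prod_encode (0, j)) [0..<10]"
  have qs: "length qs = 10" "distinct qs" "set qs = chain_clique"
    by (auto simp: qs_def distinct_map inj_on_def image_iff)
  then show ?thesis
    unfolding obstructed_def clique10_chain_graph_iff
    using coded_chain_graph[OF qs(3,2) assms(2)] assms(1) by blast
qed

text \<open>The parameters are forced to be the designated clique, for which no violation exists. So
  an obstruction in \<open>W\<close> is a whole chain for some \<open>M\<close>, with
  \<open>Suc M\<close> distinct vertices in \<open>A\<close> alone.\<close>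

lemma obstructed_induced_chain_graph:
  assumes "W \<subseteq> verts (chain_graph N)" "obstructed P (induced (chain_graph N) W)" "0 < N"
  shows "\<exists>M. P M \<and> M < card W"
proof -
  let ?G = "chain_graph N"
  from assms obtain qs where qs: "set qs \<subseteq> W" "clique10 ?G qs"
    and d: "at_labels violation (induced ?G W) qs \<or> (\<exists>M a b d. at_labels coded (induced ?G W) qs M a b d \<and> P M)"
    unfolding obstructed_def clique10_induced[OF assms(1)] by blast
  have "\<not> at_labels violation ?G qs"
    using qs(2) assms(3) not_violation_chain_graph by (simp add: clique10_chain_graph_iff)
  then have "\<not> at_labels violation (induced ?G W) qs"
    unfolding violation_induced[OF assms(1) qs(1)] unfolding at_labels_def
    by (auto elim: violation_mono[THEN notE[rotated]])
  with d obtain M a b d where c: "at_labels coded (induced ?G W) qs M a b d" and M: "P M" by blast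
  have "a ` {..M} \<subseteq> W"
    using c labelled_subset[of "induced ?G W" qs] by (auto simp: at_labels_def coded_def)
  moreover have "inj_on a {..M}"
    using coded_inj[OF c[unfolded at_labels_def]] by (auto simp: inj_on_def)
  moreover have "finite W"
    using assms(1) chain_graph_fin_graphs[of N] by (auto simp: fin_graphs_def intro: finite_subset)
  ultimately have "Suc M \<le> card W" using card_mono[of W "a ` {..M}"] by (simp add: card_image)
  then show ?thesis using M by auto
qed


section \<open>Definability in chains\<close>

text \<open>Recursion over the parameters replaces counting quantifiers;
  \<open>Forall x (Eq x x)\<close> serves as a true formula without free variables.\<close>

primrec exactly :: "nat \<Rightarrow> nat \<Rightarrow> nat list \<Rightarrow> fm" where
  "exactly t x [] = (if t = 0 then Forall x (Eq x x) else Neg (Forall x (Eq x x)))"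
| "exactly t x (q # qs) = Disj
     (Conj (Neg (Edge x q)) (exactly t x qs))
     (case t of 0 \<Rightarrow> Neg (Forall x (Eq x x)) | Suc u \<Rightarrow> Conj (Edge x q) (exactly u x qs))"

lemma sat_exactly: "sat G s (exactly t x qs) \<longleftrightarrow> length (filter (\<lambda>q. (s x, q) \<in> edges G) (map s qs)) = t"
  by (induction qs arbitrary: t) (auto split: nat.splits)

lemma fv_exactly: "fv (exactly t x qs) \<subseteq> insert x (set qs)"
  by (induction qs arbitrary: t) (auto split: nat.splits)

text \<open>The variables below \<open>10\<close> hold the parameters \<open>qs\<close> of \<^const>\<open>labelled\<close>.\<close>

definition labelF :: "nat list \<Rightarrow> nat \<Rightarrow> fm" where
  "labelF ts x = foldr (\<lambda>t \<phi>. Disj (exactly t x [0..<10]) \<phi>) ts (Neg (Forall x (Eq x x)))"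

lemma sat_labelF:
  "sat G s (labelF ts x) \<longleftrightarrow> length (filter (\<lambda>q. (s x, q) \<in> edges G) (map s [0..<10])) \<in> set ts"
  unfolding labelF_def by (induction ts) (auto simp: sat_exactly)

lemma fv_labelF: "fv (labelF ts x) \<subseteq> insert x {..<10}"
  unfolding labelF_def
proof (induction ts)
  case (Cons t ts)
  then show ?case using fv_exactly[of t x "[0..<10]"] by (auto simp: atLeast0LessThan)
qed simp

definition exL :: "nat list \<Rightarrow> nat \<Rightarrow> fm \<Rightarrow> fm" where
  "exL ts x \<phi> = Exists x (Conj (labelF ts x) \<phi>)"

definition allL :: "nat list \<Rightarrow> nat \<Rightarrow> fm \<Rightarrow> fm" where
  "allL ts x \<phi> = Forall x (Disj (Neg (labelF ts x)) \<phi>)"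

lemma map_upd_params: "10 \<le> x \<Longrightarrow> map (s(x := v)) [0..<10] = map s [0..<10]"
  by (rule map_cong) auto

lemma sat_exL: "10 \<le> x \<Longrightarrow>
    sat G s (exL ts x \<phi>) \<longleftrightarrow> (\<exists>v\<in>labelled G (map s [0..<10]) (set ts). sat G (s(x := v)) \<phi>)"
  by (auto simp: exL_def sat_labelF map_upd_params labelled_def simp del: upt.simps upt_rec_numeral)

lemma sat_allL: "10 \<le> x \<Longrightarrow>
    sat G s (allL ts x \<phi>) \<longleftrightarrow> (\<forall>v\<in>labelled G (map s [0..<10]) (set ts). sat G (s(x := v)) \<phi>)"
  by (auto simp: allL_def sat_labelF map_upd_params labelled_def simp del: upt.simps upt_rec_numeral)

lemma fv_exL: "fv (exL ts x \<phi>) \<subseteq> {..<10} \<union> (fv \<phi> - {x})"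
  and fv_allL: "fv (allL ts x \<phi>) \<subseteq> {..<10} \<union> (fv \<phi> - {x})"
  using fv_labelF[of ts x] by (auto simp: exL_def allL_def)

text \<open>The bound variable \<open>x + y + 11\<close> differs from \<open>x\<close>, from
  \<open>y\<close> and from the parameters below \<open>10\<close>.\<close>

definition leF :: "nat \<Rightarrow> nat \<Rightarrow> fm" where
  "leF x y = allL [2] (x + y + 11) (Disj (Neg (Edge y (x + y + 11))) (Edge x (x + y + 11)))"

definition bitF :: "nat \<Rightarrow> nat \<Rightarrow> fm" where
  "bitF x y = exL [3] (x + y + 11) (Conj
     (allL [2] (x + y + 12) (Disj (Conj (Edge y (x + y + 12)) (Edge (x + y + 11) (x + y + 12)))
       (Conj (Neg (Edge y (x + y + 12))) (Neg (Edge (x + y + 11) (x + y + 12))))))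
     (Edge x (x + y + 11)))"

lemma sat_leF: "sat G s (leF x y) \<longleftrightarrow>
    chain_le (labelled G (map s [0..<10]) {2}) (edges G) (s x) (s y)"
  by (auto simp: leF_def sat_allL chain_le_def simp del: upt.simps upt_rec_numeral)

lemma sat_bitF: "sat G s (bitF x y) \<longleftrightarrow>
    chain_bit (labelled G (map s [0..<10]) {2}) (labelled G (map s [0..<10]) {3}) (edges G) (s x) (s y)"
  by (auto simp: bitF_def sat_allL sat_exL map_upd_params chain_bit_def simp del: upt.simps upt_rec_numeral)

lemma fv_leF: "fv (leF x y) \<subseteq> {..<10} \<union> {x, y}"
  unfolding leF_def by (rule order_trans[OF fv_allL]) auto

lemma fv_bitF: "fv (bitF x y) \<subseteq> {..<10} \<union> {x, y}"
proof -
  let ?\<psi> = "allL [2] (x + y + 12) (Disj (Conj (Edge y (x + y + 12)) (Edge (x + y + 11) (x + y + 12)))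
       (Conj (Neg (Edge y (x + y + 12))) (Neg (Edge (x + y + 11) (x + y + 12)))))"
  have "fv ?\<psi> \<subseteq> {..<10} \<union> {y, x + y + 11}"
    by (rule order_trans[OF fv_allL]) auto
  then show ?thesis unfolding bitF_def by (intro order_trans[OF fv_exL]) auto
qed

text \<open>A property \<open>P\<close> of the numbers \<open>e i\<close> with \<open>i \<in> V\<close> is definable if some formula expresses it
  in all graphs containing a sufficiently long chain, where the number \<open>e i\<close> is represented by
  the \<open>e i\<close>-th element of the chain, the value of the variable \<open>10 + i\<close>.\<close>

definition definable :: "nat set \<Rightarrow> ((nat \<Rightarrow> nat) \<Rightarrow> bool) \<Rightarrow> bool" where
  "definable V P \<longleftrightarrow> (\<exists>\<phi>. fv \<phi> \<subseteq> {..<10} \<union> (+) 10 ` V \<and>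
     (\<forall>(G :: nat graph) s N a b d e. at_labels coded G (map s [0..<10]) N a b d \<longrightarrow>
        (\<forall>i\<in>V. e i \<le> N \<and> s (10 + i) = a (e i)) \<longrightarrow> (sat G s \<phi> \<longleftrightarrow> P e)))"

lemma definable_le: "i \<in> V \<Longrightarrow> j \<in> V \<Longrightarrow> definable V (\<lambda>e. e i \<le> e j)"
  unfolding definable_def
proof (intro exI[of _ "leF (10 + i) (10 + j)"] conjI allI impI)
  fix G :: "nat graph" and s N a b d e
  assume c: "at_labels coded G (map s [0..<10]) N a b d" and "i \<in> V" "j \<in> V"
    and "\<forall>i\<in>V. e i \<le> N \<and> s (10 + i) = a (e i)"
  then show "sat G s (leF (10 + i) (10 + j)) \<longleftrightarrow> e i \<le> e j"
    using coded_chain_le[OF c[unfolded at_labels_def]] by (simp add: sat_leF del: upt.simps upt_rec_numeral)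
qed (use fv_leF[of "10 + i" "10 + j"] in auto)

lemma definable_bit: "i \<in> V \<Longrightarrow> j \<in> V \<Longrightarrow> definable V (\<lambda>e. e i \<in> set_decode (e j))"
  unfolding definable_def
proof (intro exI[of _ "bitF (10 + i) (10 + j)"] conjI allI impI)
  fix G :: "nat graph" and s N a b d e
  assume c: "at_labels coded G (map s [0..<10]) N a b d" and "i \<in> V" "j \<in> V"
    and "\<forall>i\<in>V. e i \<le> N \<and> s (10 + i) = a (e i)"
  then show "sat G s (bitF (10 + i) (10 + j)) \<longleftrightarrow> e i \<in> set_decode (e j)"
    using coded_chain_bit[OF c[unfolded at_labels_def]] by (simp add: sat_bitF del: upt.simps upt_rec_numeral)
qed (use fv_bitF[of "10 + i" "10 + j"] in auto)

lemma definable_not: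
  assumes "definable V P"
  shows "definable V (\<lambda>e. \<not> P e)"
proof -
  from assms obtain \<phi> where \<phi>: "fv \<phi> \<subseteq> {..<10} \<union> (+) 10 ` V"
    "\<forall>(G :: nat graph) s N a b d e. at_labels coded G (map s [0..<10]) N a b d \<longrightarrow>
        (\<forall>i\<in>V. e i \<le> N \<and> s (10 + i) = a (e i)) \<longrightarrow> (sat G s \<phi> \<longleftrightarrow> P e)"
    unfolding definable_def by blast
  have "fv (Neg \<phi>) \<subseteq> {..<10} \<union> (+) 10 ` V" using \<phi>(1) by simp
  moreover have "\<forall>(G :: nat graph) s N a b d e. at_labels coded G (map s [0..<10]) N a b d \<longrightarrow>
        (\<forall>i\<in>V. e i \<le> N \<and> s (10 + i) = a (e i)) \<longrightarrow> (sat G s (Neg \<phi>) \<longleftrightarrow> \<not> P e)"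
    using \<phi>(2) by (metis sat.simps(3))
  ultimately show ?thesis unfolding definable_def by blast
qed

lemma definable_conj:
  assumes "definable V P" "definable V Q"
  shows "definable V (\<lambda>e. P e \<and> Q e)"
proof -
  from assms(1) obtain \<phi> where \<phi>: "fv \<phi> \<subseteq> {..<10} \<union> (+) 10 ` V"
    "\<forall>(G :: nat graph) s N a b d e. at_labels coded G (map s [0..<10]) N a b d \<longrightarrow>
        (\<forall>i\<in>V. e i \<le> N \<and> s (10 + i) = a (e i)) \<longrightarrow> (sat G s \<phi> \<longleftrightarrow> P e)"
    unfolding definable_def by blast
  from assms(2) obtain \<psi> where \<psi>: "fv \<psi> \<subseteq> {..<10} \<union> (+) 10 ` V"
    "\<forall>(G :: nat graph) s N a b d e. at_labels coded G (map s [0..<10]) N a b d \<longrightarrow>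
        (\<forall>i\<in>V. e i \<le> N \<and> s (10 + i) = a (e i)) \<longrightarrow> (sat G s \<psi> \<longleftrightarrow> Q e)"
    unfolding definable_def by blast
  have "fv (Conj \<phi> \<psi>) \<subseteq> {..<10} \<union> (+) 10 ` V" using \<phi>(1) \<psi>(1) by simp
  moreover have "\<forall>(G :: nat graph) s N a b d e. at_labels coded G (map s [0..<10]) N a b d \<longrightarrow>
        (\<forall>i\<in>V. e i \<le> N \<and> s (10 + i) = a (e i)) \<longrightarrow> (sat G s (Conj \<phi> \<psi>) \<longleftrightarrow> P e \<and> Q e)"
    using \<phi>(2) \<psi>(2) by (metis sat.simps(4))
  ultimately show ?thesis unfolding definable_def by blast
qed

text \<open>The bound \<open>e i\<close> makes the meaning of the quantifier independent of the
  chain length \<open>N\<close>. Locality allows the value of the new variable \<open>x\<close> to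
  be overwritten by \<open>y\<close> without changing \<open>P\<close>.\<close>

lemma definable_ex_at:
  assumes i: "i \<in> V" and x: "x \<notin> V"
    and local: "\<And>e e' y. (\<And>v. v \<in> V \<Longrightarrow> e v = e' v) \<Longrightarrow> P e y = P e' y"
    and P: "definable (insert x V) (\<lambda>e. P e (e x))"
  shows "definable V (\<lambda>e. \<exists>y\<le>e i. P e y)"
proof -
  from P obtain \<phi> where \<phi>: "fv \<phi> \<subseteq> {..<10} \<union> (+) 10 ` insert x V"
    and sat\<phi>: "\<And>(G :: nat graph) s N a b d e. at_labels coded G (map s [0..<10]) N a b d \<Longrightarrow>
        \<forall>i\<in>insert x V. e i \<le> N \<and> s (10 + i) = a (e i) \<Longrightarrow> sat G s \<phi> \<longleftrightarrow> P e (e x)"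
    unfolding definable_def by blast
  let ?\<psi> = "exL [1, 4, 5] (10 + x) (Conj (leF (10 + x) (10 + i)) \<phi>)"
  show ?thesis
    unfolding definable_def
  proof (intro exI[of _ ?\<psi>] conjI allI impI)
    show "fv ?\<psi> \<subseteq> {..<10} \<union> (+) 10 ` V"
      using fv_exL[of "[1, 4, 5]" "10 + x" "Conj (leF (10 + x) (10 + i)) \<phi>"] fv_leF[of "10 + x" "10 + i"] \<phi> i
      by auto
    fix G :: "nat graph" and s N a b d e
    assume c: "at_labels coded G (map s [0..<10]) N a b d"
      and e: "\<forall>i\<in>V. e i \<le> N \<and> s (10 + i) = a (e i)"
    have A: "labelled G (map s [0..<10]) (set [1, 4, 5]) = a ` {..N}"
      using c by (simp add: at_labels_def coded_def del: upt.simps upt_rec_numeral One_nat_def)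
    have params: "map (s(10 + x := v)) [0..<10] = map s [0..<10]" for v by (rule map_upd_params) simp
    have "sat G (s(10 + x := a y)) (Conj (leF (10 + x) (10 + i)) \<phi>) \<longleftrightarrow> y \<le> e i \<and> P e y" if y: "y \<le> N" for y
    proof -
      have "sat G (s(10 + x := a y)) (leF (10 + x) (10 + i)) \<longleftrightarrow> y \<le> e i"
        unfolding sat_leF params
        using coded_chain_le[OF c[unfolded at_labels_def], of y "e i"] y e i x by (auto simp del: upt.simps upt_rec_numeral)
      moreover have "sat G (s(10 + x := a y)) \<phi> \<longleftrightarrow> P (e(x := y)) ((e(x := y)) x)"
        by (rule sat\<phi>[of _ _ N a b d]) (use c e x y in \<open>auto simp: params simp del: upt.simps upt_rec_numeral\<close>)
      moreover have "P (e(x := y)) y = P e y" by (rule local) (use x in auto)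
      ultimately show ?thesis by simp
    qed
    moreover have "sat G s ?\<psi> \<longleftrightarrow> (\<exists>y\<le>N. sat G (s(10 + x := a y)) (Conj (leF (10 + x) (10 + i)) \<phi>))"
      by (subst sat_exL, simp, unfold A) auto
    ultimately have "sat G s ?\<psi> \<longleftrightarrow> (\<exists>y\<le>N. y \<le> e i \<and> P e y)" by (simp only:) blast
    moreover have "e i \<le> N" using e i by simp
    ultimately show "sat G s ?\<psi> \<longleftrightarrow> (\<exists>y\<le>e i. P e y)" by (meson order_trans)
  qed
qed

lemma definable_ex:
  assumes V: "finite V" and i: "i \<in> V"
    and local: "\<And>e e' y. (\<And>v. v \<in> V \<Longrightarrow> e v = e' v) \<Longrightarrow> P e y = P e' y"
    and P: "\<And>x. x \<notin> V \<Longrightarrow> definable (insert x V) (\<lambda>e. P e (e x))"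
  shows "definable V (\<lambda>e. \<exists>y\<le>e i. P e y)"
proof -
  from V obtain x where x: "x \<notin> V" using ex_new_if_finite by blast
  show ?thesis by (rule definable_ex_at[OF i x local P[OF x]])
qed

lemma definable_disj:
  assumes "definable V P" "definable V Q"
  shows "definable V (\<lambda>e. P e \<or> Q e)"
proof -
  have "definable V (\<lambda>e. \<not> (\<not> P e \<and> \<not> Q e))"
    by (rule definable_not, rule definable_conj; rule definable_not, rule assms)
  then show ?thesis by simp
qed

lemma definable_imp:
  assumes "definable V P" "definable V Q"
  shows "definable V (\<lambda>e. P e \<longrightarrow> Q e)"
proof -
  have "definable V (\<lambda>e. \<not> P e \<or> Q e)"
    by (rule definable_disj, rule definable_not) (rule assms)+
  then show ?thesis by (simp only: imp_conv_disj)
qed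

lemma definable_all:
  assumes "finite V" "i \<in> V"
    and "\<And>e e' y. (\<And>v. v \<in> V \<Longrightarrow> e v = e' v) \<Longrightarrow> P e y = P e' y"
    and "\<And>x. x \<notin> V \<Longrightarrow> definable (insert x V) (\<lambda>e. P e (e x))"
  shows "definable V (\<lambda>e. \<forall>y\<le>e i. P e y)"
proof -
  have "definable V (\<lambda>e. \<not> (\<exists>y\<le>e i. \<not> P e y))"
  proof (rule definable_not, rule definable_ex[OF assms(1,2)])
    fix e e' :: "nat \<Rightarrow> nat" and y assume "\<And>v. v \<in> V \<Longrightarrow> e v = e' v"
    then have "P e y = P e' y" by (rule assms(3))
    then show "(\<not> P e y) = (\<not> P e' y)" by simp
  next
    fix x assume "x \<notin> V"
    then have "definable (insert x V) (\<lambda>e. P e (e x))" by (rule assms(4))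
    then show "definable (insert x V) (\<lambda>e. \<not> P e (e x))" by (rule definable_not)
  qed
  then show ?thesis by simp
qed

lemma definable_less: "i \<in> V \<Longrightarrow> j \<in> V \<Longrightarrow> definable V (\<lambda>e. e i < e j)"
  using definable_not[OF definable_le[of j V i]] by (simp add: not_le)

lemma definable_eq: "i \<in> V \<Longrightarrow> j \<in> V \<Longrightarrow> definable V (\<lambda>e. e i = e j)"
  using definable_conj[OF definable_le[of i V j] definable_le[of j V i]] by (simp add: eq_iff)

lemma definable_False: "definable V (\<lambda>_. False)"
  unfolding definable_def by (intro exI[of _ "Neg (Forall 0 (Eq 0 0))"]) simp

lemma definable_zero:
  assumes "finite V" "i \<in> V"
  shows "definable V (\<lambda>e. e i = 0)"
proof -
  have "definable V (\<lambda>e. \<forall>t\<le>e i. e i \<le> t)"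
    by (intro definable_all definable_le) (use assms in auto)
  moreover have "(\<forall>t\<le>m. m \<le> t) \<longleftrightarrow> m = 0" for m :: nat by auto
  ultimately show ?thesis by simp
qed

lemma definable_Suc:
  assumes "finite V" "i \<in> V" "j \<in> V"
  shows "definable V (\<lambda>e. e j = Suc (e i))"
proof -
  have "definable V (\<lambda>e. e i < e j \<and> (\<forall>t\<le>e j. t \<le> e i \<or> e j \<le> t))"
    by (intro definable_conj definable_less definable_all definable_disj definable_le) (use assms in auto)
  moreover have "(m < n \<and> (\<forall>t\<le>n. t \<le> m \<or> n \<le> t)) = (n = Suc m)" for m n :: nat
    using successor_iff[of m n n] by (auto simp: not_le)
  ultimately show ?thesis by simp
qed


section \<open>Definability of computable functions\<close>

text \<open>Kuratowski pairs, with numbers encoding finite sets of numbers by their binary digits.\<close>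

definition upair :: "nat \<Rightarrow> nat \<Rightarrow> nat \<Rightarrow> bool" where
  "upair p i j \<longleftrightarrow> set_decode p = {i, j}"

definition kpair :: "nat \<Rightarrow> nat \<Rightarrow> nat \<Rightarrow> bool" where
  "kpair z i v \<longleftrightarrow> (\<exists>p\<le>z. \<exists>q\<le>z. upair z p q \<and> upair p i i \<and> upair q i v)"

definition pair_mem :: "nat \<Rightarrow> nat \<Rightarrow> nat \<Rightarrow> bool" where
  "pair_mem w i v \<longleftrightarrow> (\<exists>z\<le>w. z \<in> set_decode w \<and> kpair z i v)"

text \<open>Elements of a coded set do not exceed its code, so quantifiers about sets, pairs and
  sequences can be bounded.\<close>

lemma mem_set_decode_le: "x \<in> set_decode z \<Longrightarrow> x \<le> z"
  using mem_le_set_encode[of "set_decode z" x] by simp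

lemma upair_iff: "upair p i j \<longleftrightarrow> i \<in> set_decode p \<and> j \<in> set_decode p \<and>
    (\<forall>t\<le>p. t \<in> set_decode p \<longrightarrow> t = i \<or> t = j)"
  unfolding upair_def using mem_set_decode_le by auto

lemma ex_upair: "\<exists>p. upair p i j"
  unfolding upair_def by (rule exI[of _ "set_encode {i, j}"]) simp

lemma ex_kpair: "\<exists>z. kpair z i v"
proof -
  obtain p q z where "upair p i i" "upair q i v" "upair z p q" using ex_upair by metis
  moreover from this have "p \<le> z" "q \<le> z" by (auto simp: upair_def intro!: mem_set_decode_le)
  ultimately show ?thesis unfolding kpair_def by blast
qed

lemma kpair_inject: "kpair z i v \<Longrightarrow> kpair z j u \<Longrightarrow> i = j \<and> v = u"
proof -
  assume "kpair z i v" "kpair z j u"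
  then obtain p q p' q' where "set_decode z = {p, q}" "set_decode p = {i}" "set_decode q = {i, v}"
    "set_decode z = {p', q'}" "set_decode p' = {j}" "set_decode q' = {j, u}"
    unfolding kpair_def upair_def by auto
  then show ?thesis by (metis doubleton_eq_iff insert_absorb2 singleton_insert_inj_eq)
qed

lemma pair_mem_le: "pair_mem w i v \<Longrightarrow> i \<le> w \<and> v \<le> w"
proof -
  assume "pair_mem w i v"
  then obtain z p q where "z \<in> set_decode w" "set_decode z = {p, q}" "set_decode q = {i, v}"
    by (auto simp: pair_mem_def kpair_def upair_def)
  then have "z \<le> w" "q \<le> z" "i \<le> q" "v \<le> q" by (auto intro!: mem_set_decode_le)
  then show ?thesis by auto
qed

text \<open>One number holds a whole history, the graph of \<open>h\<close> on \<open>{..n}\<close>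
  as a finite set of pairs. It plays the role of Goedel's beta function.\<close>

lemma ex_sequence_code: "\<exists>w. \<forall>i v. pair_mem w i v \<longleftrightarrow> i \<le> n \<and> v = h i"
proof -
  have "\<forall>i. \<exists>z. kpair z i (h i)" using ex_kpair by blast
  then obtain z where z: "\<And>i. kpair (z i) i (h i)" by metis
  let ?w = "set_encode (z ` {..n})"
  have "pair_mem ?w i v \<longleftrightarrow> i \<le> n \<and> v = h i" for i v
  proof
    assume "pair_mem ?w i v"
    then obtain k where "k \<le> n" "kpair (z k) i v" by (auto simp: pair_mem_def)
    then show "i \<le> n \<and> v = h i" using kpair_inject[OF z[of k]] by auto
  next
    assume "i \<le> n \<and> v = h i"
    then have "z i \<in> set_decode ?w" "kpair (z i) i v" using z by auto
    then show "pair_mem ?w i v" unfolding pair_mem_def using mem_set_decode_le by blast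
  qed
  then show ?thesis by blast
qed

lemma definable_upair:
  assumes "finite V" "p \<in> V" "i \<in> V" "j \<in> V"
  shows "definable V (\<lambda>e. upair (e p) (e i) (e j))"
  unfolding upair_iff
  by (intro definable_conj definable_bit definable_all definable_imp definable_disj definable_eq)
    (use assms in auto)

lemma definable_kpair:
  assumes "finite V" "z \<in> V" "i \<in> V" "v \<in> V"
  shows "definable V (\<lambda>e. kpair (e z) (e i) (e v))"
  unfolding kpair_def
  by (intro definable_ex definable_conj definable_upair) (use assms in auto)

lemma definable_pair_mem:
  assumes "finite V" "w \<in> V" "i \<in> V" "v \<in> V"
  shows "definable V (\<lambda>e. pair_mem (e w) (e i) (e v))"
  unfolding pair_mem_def
  by (intro definable_ex definable_conj definable_kpair definable_bit) (use assms in auto)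

text \<open>For composition, where the number of intermediate values varies with the code; each of
  the fresh variables \<open>js\<close> carries one of them.\<close>

lemma definable_ex_list:
  assumes "finite V" "i \<in> V" "distinct js" "set js \<inter> V = {}"
    and "\<And>e e' zs. (\<And>v. v \<in> V \<Longrightarrow> e v = e' v) \<Longrightarrow> P e zs = P e' zs"
    and "definable (set js \<union> V) (\<lambda>e. P e (map e js))"
  shows "definable V (\<lambda>e. \<exists>zs. length zs = length js \<and> (\<forall>z\<in>set zs. z \<le> e i) \<and> P e zs)"
  using assms
proof (induction js arbitrary: V P)
  case Nil
  show ?case using Nil.prems(6) by simp
next
  case (Cons j js)
  let ?Q = "\<lambda>e y. \<exists>zs. length zs = length js \<and> (\<forall>z\<in>set zs. z \<le> e i) \<and> P e (y # zs)"
  have "definable V (\<lambda>e. \<exists>y\<le>e i. ?Q e y)"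
  proof -
    have ren: "definable (insert j V) (\<lambda>e. ?Q e (e j))"
    proof (rule Cons.IH)
      show "P e (e j # zs) = P e' (e' j # zs)" if "\<And>v. v \<in> insert j V \<Longrightarrow> e v = e' v" for e e' zs
      proof -
        have "P e (e j # zs) = P e' (e j # zs)" by (rule Cons.prems(5), rule that) simp
        moreover have "e j = e' j" by (rule that) simp
        ultimately show ?thesis by simp
      qed
      show "definable (set js \<union> insert j V) (\<lambda>e. P e (e j # map e js))"
        using Cons.prems(6) by simp
    qed (use Cons.prems(1-4) in auto)
    have loc: "?Q e y = ?Q e' y" if "\<And>v. v \<in> V \<Longrightarrow> e v = e' v" for e e' y
    proof -
      have "P e zs = P e' zs" for zs by (rule Cons.prems(5), rule that)
      moreover have "e i = e' i" by (rule that, rule Cons.prems(2))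
      ultimately show ?thesis by simp
    qed
    show ?thesis by (rule definable_ex_at[OF Cons.prems(2) _ loc ren]) (use Cons.prems(4) in auto)
  qed
  moreover have "(\<exists>zs. length zs = length (j # js) \<and> (\<forall>z\<in>set zs. z \<le> m) \<and> R zs) \<longleftrightarrow>
      (\<exists>y\<le>m. \<exists>zs. length zs = length js \<and> (\<forall>z\<in>set zs. z \<le> m) \<and> R (y # zs))" for R and m :: nat
  proof
    assume "\<exists>zs. length zs = length (j # js) \<and> (\<forall>z\<in>set zs. z \<le> m) \<and> R zs"
    then obtain zs where zs: "length zs = Suc (length js)" "\<forall>z\<in>set zs. z \<le> m" "R zs" by auto
    then obtain y ys where "zs = y # ys" by (cases zs) auto
    with zs show "\<exists>y\<le>m. \<exists>zs. length zs = length js \<and> (\<forall>z\<in>set zs. z \<le> m) \<and> R (y # zs)"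
      by (intro exI[of _ y] conjI exI[of _ ys]) auto
  next
    assume "\<exists>y\<le>m. \<exists>zs. length zs = length js \<and> (\<forall>z\<in>set zs. z \<le> m) \<and> R (y # zs)"
    then obtain y zs where "y \<le> m" "length zs = length js" "\<forall>z\<in>set zs. z \<le> m" "R (y # zs)" by blast
    then show "\<exists>zs. length zs = length (j # js) \<and> (\<forall>z\<in>set zs. z \<le> m) \<and> R zs"
      by (intro exI[of _ "y # zs"]) auto
  qed
  ultimately show ?case by simp
qed

text \<open>\<open>Q b xs y\<close> is a bounded version of the computation of \<open>y\<close> from the list \<open>xs\<close>, where the
  intermediate values do not exceed \<open>b\<close>.\<close>

definition representable :: "nat \<Rightarrow> (nat \<Rightarrow> nat list \<Rightarrow> nat \<Rightarrow> bool) \<Rightarrow> bool" where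
  "representable k Q \<longleftrightarrow> (\<forall>V b is y. finite V \<longrightarrow> length is = k \<longrightarrow> insert b (insert y (set is)) \<subseteq> V \<longrightarrow>
     definable V (\<lambda>e. Q (e b) (map e is) (e y)))"

text \<open>Correct for each bound, complete for all sufficiently large ones. Eventual truth allows
  finitely many such bounds to be combined without monotonicity of \<open>Q\<close> in
  \<open>b\<close>.\<close>

definition represents :: "(nat \<Rightarrow> nat list \<Rightarrow> nat \<Rightarrow> bool) \<Rightarrow> nat \<Rightarrow> recf \<Rightarrow> bool" where
  "represents Q k r \<longleftrightarrow> representable k Q \<and>
     (\<forall>b xs y. length xs = k \<longrightarrow> Q b xs y \<longrightarrow> computes r xs y) \<and>
     (\<forall>xs y. length xs = k \<longrightarrow> computes r xs y \<longrightarrow> (\<forall>\<^sub>F b in sequentially. Q b xs y))"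

lemma representableD:
  "representable k Q \<Longrightarrow> finite V \<Longrightarrow> length is = k \<Longrightarrow> b \<in> V \<Longrightarrow> y \<in> V \<Longrightarrow> set is \<subseteq> V \<Longrightarrow>
    definable V (\<lambda>e. Q (e b) (map e is) (e y))"
  unfolding representable_def by simp

lemma representable_never: "representable k (\<lambda>_ _ _. False)"
  by (simp add: representable_def definable_False)

lemma represents_never:
  assumes "\<And>xs y. length xs = k \<Longrightarrow> \<not> computes r xs y"
  shows "\<exists>Q. represents Q k r"
  using assms by (intro exI[of _ "\<lambda>_ _ _. False"]) (simp add: represents_def representable_never)

lemma map_local: "set is \<subseteq> V \<Longrightarrow> (\<And>v. v \<in> V \<Longrightarrow> e v = e' v) \<Longrightarrow> map e is = map e' is"
  by (rule map_cong) auto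

lemma represents_Zero: "represents (\<lambda>_ _ y. y = 0) k Zero"
  unfolding represents_def representable_def
  by (auto intro: definable_zero computes_Zero elim: computes_ZeroE)

lemma represents_Succ: "\<exists>Q. represents Q k Succ"
proof (cases "k = 1")
  case True
  have "represents (\<lambda>_ xs y. y = Suc (hd xs)) 1 Succ"
    unfolding represents_def
  proof (intro conjI allI impI)
    show "representable 1 (\<lambda>_ xs y. y = Suc (hd xs))"
      unfolding representable_def
    proof (intro allI impI)
      fix V :: "nat set" and b "is" y
      assume V: "finite V" "length is = 1" "insert b (insert y (set is)) \<subseteq> V"
      then obtain x where "is = [x]" by (auto simp: length_Suc_conv)
      then show "definable V (\<lambda>e. e y = Suc (hd (map e is)))" using V by (simp add: definable_Suc)
    qed
  qed (auto simp: length_Suc_conv intro: computes_Succ elim: computes_SuccE)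
  with True show ?thesis by blast
next
  case False
  then have "\<not> computes Succ xs y" if "length xs = k" for xs y
    using that by (auto elim: computes_SuccE)
  then show ?thesis by (rule represents_never)
qed

lemma represents_Proj: "\<exists>Q. represents Q k (Proj i)"
proof (cases "i < k")
  case True
  have "represents (\<lambda>_ xs y. y = xs ! i) k (Proj i)"
    unfolding represents_def
  proof (intro conjI allI impI)
    show "representable k (\<lambda>_ xs y. y = xs ! i)"
      unfolding representable_def
    proof (intro allI impI)
      fix V :: "nat set" and b "is" y
      assume V: "finite V" "length is = k" "insert b (insert y (set is)) \<subseteq> V"
      then have "is ! i \<in> V" using True by auto
      then have "definable V (\<lambda>e. e y = e (is ! i))" using V by (intro definable_eq) auto
      then show "definable V (\<lambda>e. e y = map e is ! i)" using V True by simp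
    qed
  qed (use True in \<open>auto intro: computes_Proj elim: computes_ProjE\<close>)
  then show ?thesis by blast
next
  case False
  then have "\<not> computes (Proj i) xs y" if "length xs = k" for xs y
    using that by (auto elim: computes_ProjE)
  then show ?thesis by (rule represents_never)
qed

lemma definable_list_all2:
  assumes "finite V" "length js = length gs" "b \<in> V" "set is \<subseteq> V" "set js \<subseteq> V"
    and "\<forall>g\<in>set gs. representable (length is) (Q g)"
  shows "definable V (\<lambda>e. list_all2 (\<lambda>g z. Q g (e b) (map e is) z) gs (map e js))"
  using assms(2,5,6)
proof (induction js gs rule: list_induct2)
  case Nil
  show ?case using definable_not[OF definable_False] by simp
next
  case (Cons j js g gs)
  have "definable V (\<lambda>e. Q g (e b) (map e is) (e j) \<and> list_all2 (\<lambda>g z. Q g (e b) (map e is) z) gs (map e js))"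
    by (rule definable_conj, rule representableD) (use Cons assms in auto)
  then show ?case by simp
qed

lemma eventually_list_all2:
  assumes "list_all2 (\<lambda>g z. \<forall>\<^sub>F b in F. P b g z) gs zs"
  shows "\<forall>\<^sub>F b in F. list_all2 (P b) gs zs"
  using assms by (induction rule: list_all2_induct) (auto elim: eventually_elim2)

lemma ex_fresh_list: "finite (V :: nat set) \<Longrightarrow> \<exists>js. length js = m \<and> distinct js \<and> set js \<inter> V = {}"
proof -
  assume "finite V"
  then have "infinite (- V)" by (simp add: Compl_eq_Diff_UNIV)
  then obtain X where X: "finite X" "card X = m" "X \<subseteq> - V" using infinite_arbitrarily_large by blast
  obtain js where "set js = X" "distinct js" using finite_distinct_list[OF X(1)] by blast
  then show ?thesis using X distinct_card[of js] by (intro exI[of _ js]) auto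
qed

lemma represents_Comp:
  assumes gs: "\<forall>g\<in>set gs. represents (Q g) k g" and f: "represents Q' (length gs) f"
  shows "represents (\<lambda>b xs y. \<exists>zs. length zs = length gs \<and> (\<forall>z\<in>set zs. z \<le> b) \<and>
    list_all2 (\<lambda>g z. Q g b xs z) gs zs \<and> Q' b zs y) k (Comp f gs)"
  unfolding represents_def
proof (intro conjI allI impI)
  show "representable k (\<lambda>b xs y. \<exists>zs. length zs = length gs \<and> (\<forall>z\<in>set zs. z \<le> b) \<and>
    list_all2 (\<lambda>g z. Q g b xs z) gs zs \<and> Q' b zs y)"
    unfolding representable_def
  proof (intro allI impI)
    fix V :: "nat set" and b "is" y
    assume V: "finite V" "length is = k" "insert b (insert y (set is)) \<subseteq> V"
    obtain js where js: "length js = length gs" "distinct js" "set js \<inter> V = {}"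
      using ex_fresh_list[OF V(1)] by blast
    have "definable V (\<lambda>e. \<exists>zs. length zs = length js \<and> (\<forall>z\<in>set zs. z \<le> e b) \<and>
      list_all2 (\<lambda>g z. Q g (e b) (map e is) z) gs zs \<and> Q' (e b) zs (e y))"
    proof (rule definable_ex_list[OF V(1) _ js(2,3)])
      fix e e' :: "nat \<Rightarrow> nat" and zs
      assume e: "\<And>v. v \<in> V \<Longrightarrow> e v = e' v"
      have "map e is = map e' is" using V e by (intro map_local[of _ V]) auto
      then show "(list_all2 (\<lambda>g z. Q g (e b) (map e is) z) gs zs \<and> Q' (e b) zs (e y)) =
          (list_all2 (\<lambda>g z. Q g (e' b) (map e' is) z) gs zs \<and> Q' (e' b) zs (e' y))"
        using e[of b] e[of y] V(3) by (simp del: map_eq_conv)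
    next
      show "definable (set js \<union> V)
        (\<lambda>e. list_all2 (\<lambda>g z. Q g (e b) (map e is) z) gs (map e js) \<and> Q' (e b) (map e js) (e y))"
      proof (rule definable_conj)
        have "\<forall>g\<in>set gs. representable (length is) (Q g)" using gs V(2) by (simp add: represents_def)
        then show "definable (set js \<union> V) (\<lambda>e. list_all2 (\<lambda>g z. Q g (e b) (map e is) z) gs (map e js))"
          using V(1,3) js(1) by (intro definable_list_all2) auto
        have "representable (length gs) Q'" using f by (simp add: represents_def)
        then show "definable (set js \<union> V) (\<lambda>e. Q' (e b) (map e js) (e y))"
          using V(1,3) js(1) by (intro representableD) auto
      qed
    qed (use V in auto)
    then show "definable V (\<lambda>e. \<exists>zs. length zs = length gs \<and> (\<forall>z\<in>set zs. z \<le> e b) \<and>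
      list_all2 (\<lambda>g z. Q g (e b) (map e is) z) gs zs \<and> Q' (e b) zs (e y))" using js by simp
  qed
next
  fix b y and xs :: "nat list"
  assume xs: "length xs = k"
  assume "\<exists>zs. length zs = length gs \<and> (\<forall>z\<in>set zs. z \<le> b) \<and> list_all2 (\<lambda>g z. Q g b xs z) gs zs \<and> Q' b zs y"
  then obtain zs where zs: "length zs = length gs" "list_all2 (\<lambda>g z. Q g b xs z) gs zs" "Q' b zs y" by blast
  have "list_all2 (\<lambda>g z. computes g xs z) gs zs"
    using zs(2) gs xs unfolding represents_def list_all2_conv_all_nth by (metis nth_mem)
  moreover have "computes f zs y" using f zs by (simp add: represents_def)
  ultimately show "computes (Comp f gs) xs y" by (rule computes_Comp)
next
  fix xs y
  assume xs: "length xs = k" and "computes (Comp f gs) xs y"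
  then obtain zs where zs: "list_all2 (\<lambda>g z. computes g xs z) gs zs" "computes f zs y"
    by (auto elim: computes_CompE)
  have len: "length zs = length gs" using zs(1) by (simp add: list_all2_lengthD)
  have "list_all2 (\<lambda>g z. \<forall>\<^sub>F b in sequentially. Q g b xs z) gs zs"
    using zs(1) gs xs unfolding represents_def list_all2_conv_all_nth by (metis nth_mem)
  then have "\<forall>\<^sub>F b in sequentially. list_all2 (\<lambda>g z. Q g b xs z) gs zs"
    by (rule eventually_list_all2)
  moreover have "\<forall>\<^sub>F b in sequentially. Q' b zs y" using f zs(2) len by (simp add: represents_def)
  moreover have "\<forall>\<^sub>F b in sequentially. \<forall>z\<in>set zs. z \<le> b"
    by (rule eventually_ball_finite) (auto intro: eventually_ge_at_top)
  ultimately show "\<forall>\<^sub>F b in sequentially. \<exists>zs. length zs = length gs \<and> (\<forall>z\<in>set zs. z \<le> b) \<and>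
      list_all2 (\<lambda>g z. Q g b xs z) gs zs \<and> Q' b zs y"
    by eventually_elim (use len in blast)
qed

lemma computes_PrimRec_sequence:
  assumes "computes (PrimRec f g) (n # xs) y"
  shows "\<exists>h. h n = y \<and> computes f xs (h 0) \<and> (\<forall>i<n. computes g (i # h i # xs) (h (Suc i)))"
  using assms
proof (induction n arbitrary: y)
  case 0
  then show ?case by (intro exI[of _ "\<lambda>_. y"]) (auto elim: computes_PrimRec_0E)
next
  case (Suc n)
  then obtain z where z: "computes (PrimRec f g) (n # xs) z" "computes g (n # z # xs) y"
    by (auto elim: computes_PrimRec_SucE)
  from Suc.IH[OF z(1)] obtain h where h: "h n = z" "computes f xs (h 0)"
    "\<forall>i<n. computes g (i # h i # xs) (h (Suc i))" by blast
  then show ?case using z(2) by (intro exI[of _ "h(Suc n := y)"]) (auto simp: less_Suc_eq)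
qed

text \<open>\<open>w\<close> is a table in which each entry is justified by \<open>f\<close>, or by
  \<open>g\<close> and an entry with the preceding index. Correctness holds for every entry by
  induction on its index, without requiring that the table be single-valued.\<close>

lemma represents_PrimRec:
  assumes f: "represents Qf k f" and g: "represents Qg (Suc (Suc k)) g"
  shows "represents (\<lambda>b xs y. \<exists>w\<le>b. pair_mem w (hd xs) y \<and> (\<forall>i\<le>b. \<forall>v\<le>b. pair_mem w i v \<longrightarrow>
      i = 0 \<and> Qf b (tl xs) v \<or>
      (\<exists>j\<le>b. \<exists>u\<le>b. i = Suc j \<and> pair_mem w j u \<and> Qg b (j # u # tl xs) v))) (Suc k) (PrimRec f g)"
    (is "represents ?Q _ _")
  unfolding represents_def
proof (intro conjI allI impI)
  show "representable (Suc k) ?Q"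
    unfolding representable_def
  proof (intro allI impI)
    fix V :: "nat set" and b "is" y
    assume V: "finite V" "length is = Suc k" "insert b (insert y (set is)) \<subseteq> V"
    then obtain x xs where "is": "is = x # xs" by (cases "is") auto
    have V': "b \<in> V" "y \<in> V" "x \<in> V" "set xs \<subseteq> V" "length xs = k" using V "is" by auto
    have Qf: "definable V' (\<lambda>e. Qf (e b) (map e xs) (e v))" if "finite V'" "v \<in> V'" "V \<subseteq> V'" for v and V' :: "nat set"
      using f that V' by (intro representableD) (auto simp: represents_def)
    have Qg: "definable V' (\<lambda>e. Qg (e b) (e j # e u # map e xs) (e v))"
      if "finite V'" "j \<in> V'" "u \<in> V'" "v \<in> V'" "V \<subseteq> V'" for j u v and V' :: "nat set"
    proof -
      have "definable V' (\<lambda>e. Qg (e b) (map e (j # u # xs)) (e v))"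
        using g that V' by (intro representableD) (auto simp: represents_def)
      then show ?thesis by simp
    qed
    have xs: "map e xs = map e' xs" if "\<And>v. v \<in> V \<Longrightarrow> e v = e' v" for e e'
      using that V'(4) by (rule map_local[rotated])
    have "definable V (\<lambda>e. \<exists>w\<le>e b. pair_mem w (e x) (e y) \<and> (\<forall>i\<le>e b. \<forall>v\<le>e b. pair_mem w i v \<longrightarrow>
      i = 0 \<and> Qf (e b) (map e xs) v \<or>
      (\<exists>j\<le>e b. \<exists>u\<le>e b. i = Suc j \<and> pair_mem w j u \<and> Qg (e b) (j # u # map e xs) v)))"
    proof (rule definable_ex, goal_cases)
      case (3 e e' w)
      show ?case using xs[of e e', OF 3] 3 V' by (simp del: map_eq_conv)
    next
      case (4 w)
      show ?case
      proof (rule definable_conj, goal_cases)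
        case 2
        show ?case
        proof (rule definable_all, goal_cases)
          case (3 e e' i)
          show ?case using xs[of e e', OF 3] 3 V' by (simp del: map_eq_conv)
        next
          case (4 i)
          show ?case
          proof (rule definable_all, goal_cases)
            case (3 e e' v)
            show ?case using xs[of e e', OF 3] 3 V' by (simp del: map_eq_conv)
          next
            case (4 v)
            show ?case
            proof (rule definable_imp, goal_cases)
              case 2
              show ?case
              proof (rule definable_disj, goal_cases)
                case 1
                show ?case by (intro definable_conj definable_zero Qf) (use V V' in auto)
              next
                case 2
                show ?case
                proof (rule definable_ex, goal_cases)
                  case (3 e e' j)
                  show ?case using xs[of e e', OF 3] 3 V' by (simp del: map_eq_conv)
                next
                  case (4 j)
                  show ?case
                  proof (rule definable_ex, goal_cases)
                    case (3 e e' u)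
                    show ?case using xs[of e e', OF 3] 3 V' by (simp del: map_eq_conv)
                  next
                    case (4 u)
                    show ?case
                      by (intro definable_conj definable_Suc definable_pair_mem Qg) (use V V' in auto)
                  qed (use V V' in auto)
                qed (use V V' in auto)
              qed
            qed (intro definable_pair_mem; use V V' in auto)
          qed (use V V' in auto)
        qed (use V V' in auto)
      qed (intro definable_pair_mem; use V V' in auto)
    qed (use V V' in auto)
    then show "definable V (\<lambda>e. ?Q (e b) (map e is) (e y))" by (simp add: "is")
  qed
next
  fix b y and xs :: "nat list"
  assume xs: "length xs = Suc k" and "?Q b xs y"
  then obtain w where w: "w \<le> b" "pair_mem w (hd xs) y"
    and step: "\<And>i v. i \<le> b \<Longrightarrow> v \<le> b \<Longrightarrow> pair_mem w i v \<Longrightarrow> i = 0 \<and> Qf b (tl xs) v \<or>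
      (\<exists>j\<le>b. \<exists>u\<le>b. i = Suc j \<and> pair_mem w j u \<and> Qg b (j # u # tl xs) v)" by blast
  have "computes (PrimRec f g) (i # tl xs) v" if "pair_mem w i v" for i v
    using that
  proof (induction i arbitrary: v)
    case 0
    then have "Qf b (tl xs) v" using step[of 0 v] pair_mem_le[OF 0] w(1) by auto
    then show ?case using f xs by (intro computes_PrimRec_0) (simp add: represents_def)
  next
    case (Suc i)
    then obtain u where "pair_mem w i u" "Qg b (i # u # tl xs) v"
      using step[of "Suc i" v] pair_mem_le[OF Suc.prems] w(1) by auto
    then show ?case using g xs by (intro computes_PrimRec_Suc[OF Suc.IH]) (auto simp: represents_def)
  qed
  from this[OF w(2)] show "computes (PrimRec f g) xs y" using xs by (cases xs) auto
next
  fix xs y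
  assume len: "length xs = Suc k" and c: "computes (PrimRec f g) xs y"
  then obtain n ys where xs: "xs = n # ys" "length ys = k" by (cases xs) auto
  from computes_PrimRec_sequence[OF c[unfolded xs(1)]] obtain h where
    h: "h n = y" "computes f ys (h 0)" "\<forall>i<n. computes g (i # h i # ys) (h (Suc i))" by blast
  obtain w where w: "\<And>i v. pair_mem w i v \<longleftrightarrow> i \<le> n \<and> v = h i" using ex_sequence_code[of n h] by blast
  have "\<forall>\<^sub>F b in sequentially. Qf b ys (h 0)" using f h(2) xs by (simp add: represents_def)
  moreover have "\<forall>\<^sub>F b in sequentially. \<forall>i\<in>{..<n}. Qg b (i # h i # ys) (h (Suc i))"
    using g h(3) xs by (intro eventually_ball_finite) (auto simp: represents_def)
  moreover have "\<forall>\<^sub>F b in sequentially. w \<le> b" by (rule eventually_ge_at_top)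
  ultimately show "\<forall>\<^sub>F b in sequentially. ?Q b xs y"
  proof eventually_elim
    case (elim b)
    show ?case
    proof (intro exI[of _ w] conjI allI impI)
      show "w \<le> b" by fact
      show "pair_mem w (hd xs) y" using w h(1) xs by simp
      fix i v assume "pair_mem w i v"
      then have i: "i \<le> n" "v = h i" using w by auto
      show "i = 0 \<and> Qf b (tl xs) v \<or> (\<exists>j\<le>b. \<exists>u\<le>b. i = Suc j \<and> pair_mem w j u \<and> Qg b (j # u # tl xs) v)"
      proof (cases i)
        case 0
        then show ?thesis using elim(1) i xs by simp
      next
        case (Suc j)
        then have "pair_mem w j (h j)" using w i by simp
        moreover from this have "j \<le> b" "h j \<le> b" using pair_mem_le elim(3) by (meson order_trans)+
        moreover have "Qg b (j # h j # tl xs) v" using elim(2) i Suc xs by simp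
        ultimately show ?thesis using Suc by blast
      qed
    qed
  qed
qed

text \<open>Definability is available for quantifiers bounded by \<open>\<le>\<close> and for
  relations between variables. Hence \<open>z = 0\<close> occurs under a quantifier in place of a
  constant argument, and \<open>m = y\<close> as an alternative in place of the bound
  \<open>m < y\<close>.\<close>

lemma represents_Min:
  assumes f: "represents Qf (Suc k) f"
  shows "represents (\<lambda>b xs y. (\<exists>z\<le>b. z = 0 \<and> Qf b (y # xs) z) \<and>
      (\<forall>m\<le>y. m = y \<or> (\<exists>z\<le>b. z \<noteq> 0 \<and> Qf b (m # xs) z))) k (Min f)"
    (is "represents ?Q _ _")
  unfolding represents_def
proof (intro conjI allI impI)
  show "representable k ?Q"
    unfolding representable_def
  proof (intro allI impI)
    fix V :: "nat set" and b "is" y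
    assume V: "finite V" "length is = k" "insert b (insert y (set is)) \<subseteq> V"
    have V': "b \<in> V" "y \<in> V" "set is \<subseteq> V" using V by auto
    have Qf: "definable V' (\<lambda>e. Qf (e b) (e j # map e is) (e v))"
      if "finite V'" "j \<in> V'" "v \<in> V'" "V \<subseteq> V'" for j v and V' :: "nat set"
    proof -
      have "definable V' (\<lambda>e. Qf (e b) (map e (j # is)) (e v))"
        using f that V V' by (intro representableD) (auto simp: represents_def)
      then show ?thesis by simp
    qed
    have xs: "map e is = map e' is" if "\<And>v. v \<in> V \<Longrightarrow> e v = e' v" for e e'
      using that V'(3) by (rule map_local[rotated])
    show "definable V (\<lambda>e. ?Q (e b) (map e is) (e y))"
    proof (rule definable_conj, goal_cases)
      case 1
      show ?case
      proof (rule definable_ex, goal_cases)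
        case (3 e e' z)
        show ?case using xs[of e e', OF 3] 3 V' by (simp del: map_eq_conv)
      next
        case (4 z)
        show ?case by (intro definable_conj definable_zero Qf) (use V V' in auto)
      qed (use V V' in auto)
    next
      case 2
      show ?case
      proof (rule definable_all, goal_cases)
        case (3 e e' m)
        show ?case using xs[of e e', OF 3] 3 V' by (simp del: map_eq_conv)
      next
        case (4 m)
        show ?case
        proof (rule definable_disj, goal_cases)
          case 1
          show ?case by (rule definable_eq) (use V' in auto)
        next
          case 2
          show ?case
          proof (rule definable_ex, goal_cases)
            case (3 e e' z)
            show ?case using xs[of e e', OF 3] 3 V' by (simp del: map_eq_conv)
          next
            case (4 z)
            show ?case by (intro definable_conj definable_not definable_zero Qf) (use V V' in auto)
          qed (use V V' in auto)
        qed
      qed (use V V' in auto)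
    qed
  qed
next
  fix b y and xs :: "nat list"
  assume xs: "length xs = k" and Q: "?Q b xs y"
  show "computes (Min f) xs y"
  proof (rule computes_Min)
    show "computes f (y # xs) 0" using Q f xs by (auto simp: represents_def)
    show "\<forall>m<y. \<exists>z>0. computes f (m # xs) z"
    proof (intro allI impI)
      fix m assume "m < y"
      then obtain z where "z \<noteq> 0" "Qf b (m # xs) z" using Q by (metis less_imp_le nat_neq_iff)
      then show "\<exists>z>0. computes f (m # xs) z" using f xs by (auto simp: represents_def)
    qed
  qed
next
  fix xs y
  assume xs: "length xs = k" and "computes (Min f) xs y"
  then have y: "computes f (y # xs) 0" "\<forall>m<y. \<exists>z>0. computes f (m # xs) z"
    by (auto elim: computes_MinE)
  then obtain z where z: "\<And>m. m < y \<Longrightarrow> z m > 0 \<and> computes f (m # xs) (z m)" by metis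
  have "\<forall>\<^sub>F b in sequentially. Qf b (y # xs) 0" using f y(1) xs by (simp add: represents_def)
  moreover have "\<forall>\<^sub>F b in sequentially. \<forall>m\<in>{..<y}. Qf b (m # xs) (z m) \<and> z m \<le> b"
    using f z xs by (intro eventually_ball_finite)
      (auto simp: represents_def intro!: eventually_conj eventually_ge_at_top)
  ultimately show "\<forall>\<^sub>F b in sequentially. ?Q b xs y"
  proof eventually_elim
    case (elim b)
    have "\<exists>w\<le>b. w \<noteq> 0 \<and> Qf b (m # xs) w" if "m < y" for m
      using elim(2) z[OF that] that by (intro exI[of _ "z m"]) auto
    then show ?case using elim(1) by (metis le_neq_implies_less zero_le)
  qed
qed

lemma ex_represents: "\<exists>Q. represents Q k r"
proof (induction r arbitrary: k)
  case Zero
  show ?case using represents_Zero by blast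
next
  case Succ
  show ?case by (rule represents_Succ)
next
  case (Proj i)
  show ?case by (rule represents_Proj)
next
  case (Comp f gs)
  from Comp.IH(2) have "\<forall>g\<in>set gs. \<exists>Q. represents Q k g" by blast
  then obtain Q where "\<forall>g\<in>set gs. represents (Q g) k g" by metis
  moreover from Comp.IH(1) obtain Q' where "represents Q' (length gs) f" by blast
  ultimately show ?case using represents_Comp by blast
next
  case (PrimRec f g)
  show ?case
  proof (cases k)
    case 0
    have "\<not> computes (PrimRec f g) [] y" for y by (auto elim: computes.cases)
    then show ?thesis by (intro represents_never) (simp add: 0)
  next
    case (Suc m)
    then show ?thesis using represents_PrimRec PrimRec.IH by blast
  qed
next
  case (Min f)
  then show ?case using represents_Min by blast
qed

text \<open>The minimality makes \<open>L\<close> functional, so that \<open>L N n\<close> determines the length of the chain.\<close>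

lemma ex_definable_halting:
  "\<exists>L. definable {0, 1} (\<lambda>e. L (e 1) (e 0)) \<and>
     (\<forall>N n. L N n \<longrightarrow> n < N) \<and>
     (\<forall>N M n. L N n \<longrightarrow> L M n \<longrightarrow> N = M) \<and>
     (\<forall>n c. computes r [n] c \<longrightarrow> (\<exists>N. L N n)) \<and>
     (\<forall>N n c. L N n \<longrightarrow> computes r [n] c \<longrightarrow> c < N)"
proof -
  obtain Q where Q: "represents Q 1 r" using ex_represents by blast
  \<comment> \<open>Bounding input and output strictly by \<open>b\<close> gives
    \<open>n < N\<close>, so that the chain reaches element \<open>n\<close>, and
    \<open>c < N\<close>, which the comparison of sizes uses.\<close>
  define H where "H = (\<lambda>b n. n < b \<and> (\<exists>y\<le>b. y < b \<and> Q b [n] y))"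
  define L where "L = (\<lambda>b n. H b n \<and> (\<forall>b'\<le>b. b' < b \<longrightarrow> \<not> H b' n))"
  have H: "definable V (\<lambda>e. H (e b) (e n))" if V: "finite V" "b \<in> V" "n \<in> V" for V b n
    unfolding H_def
  proof (rule definable_conj, rule definable_less[OF V(3,2)], rule definable_ex[OF V(1,2)])
    fix y assume "y \<notin> V"
    have "definable (insert y V) (\<lambda>e. Q (e b) (map e [n]) (e y))"
      using Q V by (intro representableD) (auto simp: represents_def)
    then show "definable (insert y V) (\<lambda>e. e y < e b \<and> Q (e b) [e n] (e y))"
      using V by (intro definable_conj definable_less) simp_all
  qed (use V in simp)
  have "definable {0, 1} (\<lambda>e. L (e 1) (e 0))"
    unfolding L_def
    by (rule definable_conj, rule H, simp_all, rule definable_all)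
      (auto intro!: definable_imp definable_less definable_not H)
  moreover have "n < N" if "L N n" for N n using that by (simp add: L_def H_def)
  moreover have "N = M" if "L N n" "L M n" for N M n
    using that unfolding L_def by (metis less_imp_le linorder_neqE_nat)
  moreover have "\<exists>N. L N n" if "computes r [n] c" for n c
  proof -
    have "\<forall>\<^sub>F b in sequentially. Q b [n] c" using Q that by (simp add: represents_def)
    moreover have "\<forall>\<^sub>F b in sequentially. c < b" by (rule eventually_gt_at_top)
    moreover have "\<forall>\<^sub>F b in sequentially. n < b" by (rule eventually_gt_at_top)
    ultimately have "\<forall>\<^sub>F b in sequentially. H b n" unfolding H_def by eventually_elim (blast intro: less_imp_le)
    then have "\<exists>b. H b n" by (auto simp: eventually_sequentially)
    then show ?thesis unfolding L_def exists_least_iff[of "\<lambda>b. H b n"] by blast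
  qed
  moreover have "c < N" if "L N n" "computes r [n] c" for N n c
  proof -
    from that(1) obtain y where "y < N" "Q N [n] y" by (auto simp: L_def H_def)
    then show ?thesis using Q computes_deterministic[OF that(2), of y] by (auto simp: represents_def)
  qed
  ultimately show ?thesis by (intro exI[of _ L]) blast
qed


section \<open>The diagonal sentence\<close>

definition iffF :: "fm \<Rightarrow> fm \<Rightarrow> fm" where
  "iffF \<phi> \<psi> = Disj (Conj \<phi> \<psi>) (Conj (Neg \<phi>) (Neg \<psi>))"

definition impF :: "fm \<Rightarrow> fm \<Rightarrow> fm" where
  "impF \<phi> \<psi> = Disj (Neg \<phi>) \<psi>"

definition memF :: "nat list \<Rightarrow> nat \<Rightarrow> fm" where
  "memF ts x = exL ts (x + 11) (Eq (x + 11) x)"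

text \<open>Bound variables are numbered from \<open>20\<close>, out of the way of the arguments,
  which in \<open>violationF\<close> are among \<open>10\<close>, \<open>11\<close>,
  \<open>12\<close>.\<close>

definition betweenF :: "nat \<Rightarrow> nat \<Rightarrow> fm" where
  "betweenF a x = Conj
     (Disj (memF [4] a) (exL [1, 4, 5] 20 (exL [2] 21
       (Conj (Edge 20 a) (Conj (Edge 20 21) (Conj (Neg (Edge a 21)) (Neg (Edge x 21))))))))
     (exL [2] 22 (Conj (Edge a 22) (Conj (Edge x 22)
       (Disj (memF [5] a) (exL [1, 4, 5] 23 (Conj (Edge a 23) (Neg (Edge 23 22))))))))"

definition violationF :: fm where
  "violationF = Disj (exL [4] 10 (exL [2] 11 (Neg (Edge 10 11))))
    (Disj (exL [5] 10 (exL [1, 4, 5, 3] 11 (exL [2] 12 (Conj (Edge 10 12) (Neg (Edge 11 12))))))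
    (Disj (exL [5] 10 (exL [2] 11 (exL [2] 12 (Conj (Neg (Eq 11 12)) (Conj (Edge 10 11) (Edge 10 12))))))
    (Disj (exL [1, 4, 5] 10 (exL [1, 4, 5] 11 (exL [2] 12 (exL [2] 13 (Conj (Edge 10 11) (Conj (Neg (Eq 12 13))
       (Conj (Edge 10 12) (Conj (Neg (Edge 11 12)) (Conj (Edge 10 13) (Neg (Edge 11 13)))))))))))
    (Disj (exL [1, 4, 5] 10 (exL [1, 4, 5] 11 (exL [1, 4, 5] 12
       (Conj (Neg (Eq 11 12)) (Conj (betweenF 10 11) (betweenF 10 12))))))
     (exL [1, 4, 5] 10 (exL [3] 11 (exL [3] 12
       (Conj (Neg (Eq 11 12)) (Conj (betweenF 10 11) (betweenF 10 12))))))))))"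

definition completeF :: fm where
  "completeF = Conj (exL [4] 10 (Eq 10 10))
    (Conj (allL [1, 4, 5] 10 (Disj (memF [5] 10)
       (exL [1, 4, 5] 11 (Conj (Edge 10 11) (Conj (leF 10 11) (Neg (leF 11 10)))))))
    (Conj (allL [5] 10 (exL [2] 11 (Edge 10 11)))
    (Conj (allL [1, 4, 5] 10 (exL [3] 11 (allL [2] 12 (iffF (Edge 10 12) (Edge 11 12)))))
    (Conj (allL [4] 10 (allL [1, 4, 5] 11 (Neg (bitF 11 10))))
     (allL [1, 4, 5] 10 (allL [1, 4, 5] 11 (impF
       (Conj (Neg (leF 11 10)) (allL [1, 4, 5] 12 (Disj (leF 12 10) (leF 11 12))))
       (allL [1, 4, 5] 13 (iffF (bitF 13 11) (iffF (bitF 13 10)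
         (exL [1, 4, 5] 14 (Conj (Neg (leF 13 14)) (Neg (bitF 14 10))))))))))))))"

text \<open>Adjacency forces the parameters to be distinct, as graphs have no loops. The final
  conjunct is truth, by nonemptiness of the universe.\<close>

definition cliqueF :: fm where
  "cliqueF = foldr (\<lambda>(i, j). Conj (Edge i j))
     (filter (\<lambda>(i, j). i \<noteq> j) (List.product [0..<10] [0..<10])) (Neg (Forall 0 (Neg (Eq 0 0))))"

text \<open>If \<open>\<chi>\<close> says something about the element of the chain that is the value of the variable \<open>10\<close>,
  then \<open>step \<sigma> \<chi>\<close>, where \<open>\<sigma>\<close> defines the successor relation, says the same about its successor.\<close>

definition step :: "fm \<Rightarrow> fm \<Rightarrow> fm" where
  "step \<sigma> \<chi> = exL [1, 4, 5] 11 (Conj \<sigma> (exL [1, 4, 5] 10 (Conj (Eq 10 11) \<chi>)))"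

text \<open>\<open>\<chi>\<close> is evaluated with the first element of the chain, which bears
  label \<open>4\<close>, in variable \<open>10\<close>.\<close>

definition obstruction_free :: "fm \<Rightarrow> fm" where
  "obstruction_free \<chi> = Neg (foldr Exists [0..<10]
     (Conj cliqueF (Disj violationF (Conj completeF (exL [4] 10 \<chi>)))))"

lemma sat_iffF: "sat G s (iffF \<phi> \<psi>) \<longleftrightarrow> (sat G s \<phi> \<longleftrightarrow> sat G s \<psi>)"
  by (auto simp: iffF_def)

lemma sat_impF: "sat G s (impF \<phi> \<psi>) \<longleftrightarrow> (sat G s \<phi> \<longrightarrow> sat G s \<psi>)"
  by (simp add: impF_def)

lemma sat_memF: "sat G s (memF ts x) \<longleftrightarrow> s x \<in> labelled G (map s [0..<10]) (set ts)"
  by (auto simp: memF_def sat_exL simp del: upt.simps upt_rec_numeral)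

lemmas sat_simps = sat.simps sat_iffF sat_impF sat_memF sat_exL sat_allL sat_leF sat_bitF map_upd_params
  rel_simps fun_upd_apply if_True if_False list.set

lemma sat_betweenF:
  assumes "a \<in> {10, 11, 12}" "x \<in> {10, 11, 12}"
  shows "sat G s (betweenF a x) \<longleftrightarrow>
    between (labelled G (map s [0..<10]) {1, 4, 5}) (labelled G (map s [0..<10]) {2})
      (labelled G (map s [0..<10]) {4}) (labelled G (map s [0..<10]) {5}) (edges G) (s a) (s x)"
proof -
  have "a \<noteq> n \<and> n \<noteq> a \<and> x \<noteq> n \<and> n \<noteq> x" if "n \<in> {20, 21, 22, 23}" for n using assms that by auto
  from this[of 20] this[of 21] this[of 22] this[of 23] show ?thesis
    by (simp only: betweenF_def between_def sat_simps simp_thms insert_iff)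
qed

lemma sat_violationF: "sat G s violationF \<longleftrightarrow> at_labels violation G (map s [0..<10])"
proof -
  let ?L = "labelled G (map s [0..<10])"
  have AD: "?L {1, 4, 5} \<union> ?L {3} = ?L {1, 4, 5, 3}" by (auto simp: labelled_def)
  have b: "sat G s (betweenF 10 x) \<longleftrightarrow>
    between (labelled G (map s [0..<10]) {1, 4, 5}) (labelled G (map s [0..<10]) {2})
      (labelled G (map s [0..<10]) {4}) (labelled G (map s [0..<10]) {5}) (edges G) (s 10) (s x)"
    if "x = 11 \<or> x = 12" for s x
    by (rule sat_betweenF) (use that in auto)
  show ?thesis
    unfolding at_labels_def violation_def AD
    by (simp only: violationF_def sat_simps b simp_thms)
qed

lemma sat_completeF: "sat G s completeF \<longleftrightarrow> at_labels complete_chain G (map s [0..<10])"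
proof -
  have ne: "(X \<noteq> {}) = (\<exists>v\<in>X. v = v)" for X :: "'a set" by auto
  show ?thesis
    unfolding at_labels_def complete_chain_def ne
    by (simp only: completeF_def sat_simps)
qed

lemma sat_cliqueF: "sat G s cliqueF \<longleftrightarrow> (\<forall>i<10. \<forall>j<10. i \<noteq> j \<longrightarrow> (s i, s j) \<in> edges G)"
  if "verts G \<noteq> {}"
proof -
  have "sat G s (foldr (\<lambda>(i, j). Conj (Edge i j)) ps \<psi>) \<longleftrightarrow> (\<forall>(i, j)\<in>set ps. (s i, s j) \<in> edges G) \<and> sat G s \<psi>" for ps \<psi>
    by (induction ps) auto
  then show ?thesis using that unfolding cliqueF_def by (auto simp del: upt.simps upt_rec_numeral)
qed

lemma fv_cliqueF: "fv cliqueF \<subseteq> {..<10}"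
proof -
  have "fv (foldr (\<lambda>(i, j). Conj (Edge i j)) ps \<psi>) \<subseteq> fst ` set ps \<union> snd ` set ps \<union> fv \<psi>" for ps \<psi>
    by (induction ps) auto
  from this[of "filter (\<lambda>(i, j). i \<noteq> j) (List.product [0..<10] [0..<10])" "Neg (Forall 0 (Neg (Eq 0 0)))"]
  show ?thesis unfolding cliqueF_def by (auto simp del: upt.simps upt_rec_numeral)
qed

lemma fv_memF: "fv (memF ts x) \<subseteq> {..<10} \<union> {x}"
  unfolding memF_def by (rule order_trans[OF fv_exL]) auto

lemma fv_betweenF: "fv (betweenF a x) \<subseteq> {..<10} \<union> {a, x}"
  unfolding betweenF_def
  by (auto dest!: subsetD[OF fv_exL] subsetD[OF fv_memF])

lemma fv_violationF: "fv violationF \<subseteq> {..<10}"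
  unfolding violationF_def
  by (auto dest!: subsetD[OF fv_exL] subsetD[OF fv_betweenF])

lemma fv_completeF: "fv completeF \<subseteq> {..<10}"
  unfolding completeF_def iffF_def impF_def
  by (auto dest!: subsetD[OF fv_exL] subsetD[OF fv_allL] subsetD[OF fv_memF] subsetD[OF fv_leF] subsetD[OF fv_bitF])

lemma fv_step:
  assumes "fv \<sigma> \<subseteq> {..<10} \<union> {10, 11}" "fv \<chi> \<subseteq> {..<10} \<union> {10}"
  shows "fv (step \<sigma> \<chi>) \<subseteq> {..<10} \<union> {10}"
proof -
  let ?\<psi> = "exL [1, 4, 5] 10 (Conj (Eq 10 11) \<chi>)"
  have "fv ?\<psi> \<subseteq> {..<10} \<union> {11}"
    by (rule order_trans[OF fv_exL]) (use assms(2) in \<open>simp, blast\<close>)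
  then show ?thesis
    unfolding step_def by (intro order_trans[OF fv_exL]) (use assms(1) in \<open>simp, blast\<close>)
qed

lemma sentence_obstruction_free:
  assumes "fv \<chi> \<subseteq> {..<10} \<union> {10}"
  shows "sentence (obstruction_free \<chi>)"
proof -
  have "fv (exL [4] 10 \<chi>) \<subseteq> {..<10}" using assms by (auto dest!: subsetD[OF fv_exL])
  then show ?thesis
    using fv_cliqueF fv_violationF fv_completeF
    by (auto simp: sentence_def obstruction_free_def simp del: upt.simps upt_rec_numeral)
qed

text \<open>\<open>step\<close> advances along the chain and returns the new element to variable
  \<open>10\<close>, so \<open>n\<close> copies lead from \<open>a k\<close> to
  \<open>a (k + n)\<close> with two variables; past the end of the chain the formula is
  false.\<close>

lemma sat_step:
  assumes c: "at_labels coded G (map s [0..<10]) N a b d"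
    and \<sigma>: "\<And>s k l. at_labels coded G (map s [0..<10]) N a b d \<Longrightarrow> k \<le> N \<Longrightarrow> l \<le> N \<Longrightarrow>
      s 10 = a k \<Longrightarrow> s 11 = a l \<Longrightarrow> sat G s \<sigma> \<longleftrightarrow> l = Suc k"
    and \<chi>: "\<And>s k. at_labels coded G (map s [0..<10]) N a b d \<Longrightarrow> k \<le> N \<Longrightarrow> s 10 = a k \<Longrightarrow>
      sat G s \<chi> \<longleftrightarrow> R k"
    and k: "k \<le> N" "s 10 = a k"
  shows "sat G s ((step \<sigma> ^^ n) \<chi>) \<longleftrightarrow> k + n \<le> N \<and> R (k + n)"
  using c k
proof (induction n arbitrary: s k)
  case 0
  then show ?case using \<chi> by simp
next
  case (Suc n)
  note c = Suc.prems(1) and k = Suc.prems(2,3)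
  have A: "labelled G (map s [0..<10]) {1, 4, 5} = a ` {..N}"
    using c by (simp add: at_labels_def coded_def del: upt.simps upt_rec_numeral One_nat_def)
  let ?s = "\<lambda>l m. s(11 := a l, 10 := a m)"
  have params: "map (s(11 := v)) [0..<10] = map s [0..<10]" "map (s(11 := v, 10 := w)) [0..<10] = map s [0..<10]" for v w
    by (simp_all add: map_upd_params del: upt.simps upt_rec_numeral)
  have inj: "a m = a l \<longleftrightarrow> m = l" if "m \<le> N" "l \<le> N" for m l
    using coded_inj[OF c[unfolded at_labels_def]] that by blast
  have "sat G s ((step \<sigma> ^^ Suc n) \<chi>) \<longleftrightarrow>
      (\<exists>l\<le>N. sat G (s(11 := a l)) \<sigma> \<and> (\<exists>m\<le>N. a m = a l \<and> sat G (?s l m) ((step \<sigma> ^^ n) \<chi>)))"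
  proof -
    have "sat G s ((step \<sigma> ^^ Suc n) \<chi>) \<longleftrightarrow> (\<exists>v\<in>a ` {..N}. sat G (s(11 := v)) \<sigma> \<and>
        (\<exists>w\<in>a ` {..N}. w = v \<and> sat G (s(11 := v, 10 := w)) ((step \<sigma> ^^ n) \<chi>)))"
      by (simp add: step_def sat_exL A params del: upt.simps upt_rec_numeral One_nat_def)
    then show ?thesis by blast
  qed
  also have "\<dots> \<longleftrightarrow> (\<exists>l\<le>N. l = Suc k \<and> (\<exists>m\<le>N. m = l \<and> (m + n \<le> N \<and> R (m + n))))"
  proof -
    have "sat G (s(11 := a l)) \<sigma> \<longleftrightarrow> l = Suc k" if "l \<le> N" for l
    proof (rule \<sigma>)
      show "at_labels coded G (map (s(11 := a l)) [0..<10]) N a b d" using c by (simp only: params)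
    qed (use k that in simp_all)
    moreover have "sat G (?s l m) ((step \<sigma> ^^ n) \<chi>) \<longleftrightarrow> m + n \<le> N \<and> R (m + n)" if "m \<le> N" for l m
    proof (rule Suc.IH)
      show "at_labels coded G (map (?s l m) [0..<10]) N a b d" using c by (simp only: params)
    qed (use that in simp_all)
    ultimately show ?thesis using inj by (simp cong: conj_cong)
  qed
  also have "\<dots> \<longleftrightarrow> k + Suc n \<le> N \<and> R (k + Suc n)" by auto
  finally show ?case .
qed

text \<open>For a clique without violation, finiteness turns the first-order condition
  \<open>completeF\<close> into the existence of a coded chain; a clique with a violation settles
  both sides.\<close>

lemma models_obstruction_free_iff:
  assumes G: "G \<in> fin_graphs" and sent: "sentence (obstruction_free \<chi>)"
    and \<chi>: "\<And>s N a b d. at_labels coded G (map s [0..<10]) N a b d \<Longrightarrow> s 10 = a 0 \<Longrightarrow> sat G s \<chi> \<longleftrightarrow> P N"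
  shows "models G (obstruction_free \<chi>) \<longleftrightarrow> \<not> obstructed P G"
proof -
  have fin: "finite (verts G)" and ne: "verts G \<noteq> {}" and irr: "irrefl (edges G)"
    using G by (auto simp: fin_graphs_def is_graph_def)
  have matrix: "at_labels violation G (map t [0..<10]) \<or>
      at_labels complete_chain G (map t [0..<10]) \<and> sat G t (exL [4] 10 \<chi>) \<longleftrightarrow>
      at_labels violation G (map t [0..<10]) \<or> (\<exists>N a b d. at_labels coded G (map t [0..<10]) N a b d \<and> P N)"
    (is "?v \<or> ?c \<and> ?x \<longleftrightarrow> ?v \<or> ?o") for t
  proof -
    have params: "map (t(10 := v)) [0..<10] = map t [0..<10]" for v by (simp add: map_upd_params del: upt.simps upt_rec_numeral)
    have x: "?x \<longleftrightarrow> P N" if c: "at_labels coded G (map t [0..<10]) N a b d" for N a b d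
    proof -
      have "labelled G (map t [0..<10]) (set [4]) = {a 0}"
        using c by (simp add: at_labels_def coded_def del: upt.simps upt_rec_numeral One_nat_def)
      then have "?x \<longleftrightarrow> sat G (t(10 := a 0)) \<chi>" by (subst sat_exL) simp_all
      also have "\<dots> \<longleftrightarrow> P N"
      proof (rule \<chi>)
        show "at_labels coded G (map (t(10 := a 0)) [0..<10]) N a b d" using c by (simp only: params)
      qed simp
      finally show ?thesis .
    qed
    have "\<exists>N a b d. at_labels coded G (map t [0..<10]) N a b d" if "?c" "\<not> ?v"
      unfolding at_labels_def
      by (rule coded_if_complete_chain)
        (use that finite_subset[OF labelled_subset fin] in \<open>simp_all only: at_labels_def not_False_eq_True\<close>,
          auto intro!: labelled_mono)
    moreover have ?c if "at_labels coded G (map t [0..<10]) N a b d" for N a b d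
      using complete_chain_if_coded that unfolding at_labels_def by blast
    ultimately show ?thesis using x by blast
  qed
  have "\<not> models G (obstruction_free \<chi>) \<longleftrightarrow>
      sat G s (foldr Exists [0..<10] (Conj cliqueF (Disj violationF (Conj completeF (exL [4] 10 \<chi>)))))" for s
    using not_models_iff[OF sent ne, of s] by (simp add: obstruction_free_def)
  note this[of undefined]
  also have "sat G undefined (foldr Exists [0..<10] (Conj cliqueF (Disj violationF (Conj completeF (exL [4] 10 \<chi>))))) \<longleftrightarrow>
      (\<exists>t. (\<forall>v<10. t v \<in> verts G) \<and> (\<forall>v\<ge>10. t v = undefined v) \<and> (\<forall>i<10. \<forall>j<10. i \<noteq> j \<longrightarrow> (t i, t j) \<in> edges G) \<and>
        (at_labels violation G (map t [0..<10]) \<or> (\<exists>N a b d. at_labels coded G (map t [0..<10]) N a b d \<and> P N)))"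
    unfolding sat_foldr_Exists sat.simps sat_cliqueF[OF ne] sat_violationF sat_completeF matrix
    by (simp add: Ball_def not_less del: upt.simps upt_rec_numeral)
  also have "\<dots> \<longleftrightarrow> obstructed P G"
  proof
    assume "\<exists>t. (\<forall>v<10. t v \<in> verts G) \<and> (\<forall>v\<ge>10. t v = undefined v) \<and> (\<forall>i<10. \<forall>j<10. i \<noteq> j \<longrightarrow> (t i, t j) \<in> edges G) \<and>
        (at_labels violation G (map t [0..<10]) \<or> (\<exists>N a b d. at_labels coded G (map t [0..<10]) N a b d \<and> P N))"
    then obtain t where t: "\<forall>v<10. t v \<in> verts G" "\<forall>i<10. \<forall>j<10. i \<noteq> j \<longrightarrow> (t i, t j) \<in> edges G"
      "at_labels violation G (map t [0..<10]) \<or> (\<exists>N a b d. at_labels coded G (map t [0..<10]) N a b d \<and> P N)" by blast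
    \<comment> \<open>Equal values at distinct indices would give a loop.\<close>
    have "inj_on t {..<10}"
      by (rule inj_onI) (metis t(2) irr irrefl_def lessThan_iff)
    then have "clique10 G (map t [0..<10])"
      using t(1,2) by (auto simp: clique10_def distinct_map atLeast0LessThan simp del: upt.simps upt_rec_numeral)
    then show "obstructed P G" using t(3) unfolding obstructed_def by blast
  next
    assume "obstructed P G"
    then obtain qs where qs: "clique10 G qs" and d: "at_labels violation G qs \<or> (\<exists>N a b d. at_labels coded G qs N a b d \<and> P N)"
      unfolding obstructed_def by blast
    let ?t = "\<lambda>v. if v < 10 then qs ! v else undefined v"
    have len: "length qs = 10" using qs by (simp add: clique10_def)
    have "map ?t [0..<10] = map ((!) qs) [0..<length qs]" unfolding len by (rule map_cong) auto
    then have t: "map ?t [0..<10] = qs" by (simp only: map_nth)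
    have "\<forall>v<10. ?t v \<in> verts G" "\<forall>v\<ge>10. ?t v = undefined v"
      using qs by (auto simp: clique10_def)
    moreover have "\<forall>i<10. \<forall>j<10. i \<noteq> j \<longrightarrow> (?t i, ?t j) \<in> edges G"
      using qs by (auto simp: clique10_def nth_eq_iff_index_eq)
    ultimately show "\<exists>t. (\<forall>v<10. t v \<in> verts G) \<and> (\<forall>v\<ge>10. t v = undefined v) \<and> (\<forall>i<10. \<forall>j<10. i \<noteq> j \<longrightarrow> (t i, t j) \<in> edges G) \<and>
        (at_labels violation G (map t [0..<10]) \<or> (\<exists>N a b d. at_labels coded G (map t [0..<10]) N a b d \<and> P N))"
      using d t by (intro exI[of _ ?t]) (simp only: simp_thms)
  qed
  finally show ?thesis by blast
qed

text \<open>Wrapping a formula in a fixed context acts on codes by a computable function; the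
  diagonal argument uses no other arithmetic of syntax.\<close>

definition code_computable :: "(fm \<Rightarrow> fm) \<Rightarrow> bool" where
  "code_computable F \<longleftrightarrow> (\<exists>g. computable1 g \<and> (\<forall>\<phi>. fm_code (F \<phi>) = g (fm_code \<phi>)))"

lemma code_computable_id: "code_computable (\<lambda>\<phi>. \<phi>)"
  unfolding code_computable_def using computable1_id by blast

lemma code_computable_Neg:
  assumes "code_computable F"
  shows "code_computable (\<lambda>\<phi>. Neg (F \<phi>))"
proof -
  from assms obtain g where g: "computable1 g" "\<forall>\<phi>. fm_code (F \<phi>) = g (fm_code \<phi>)"
    unfolding code_computable_def by blast
  have "computable1 (\<lambda>c. prod_encode (2, g c))"
    by (intro computable1_prod_encode computable1_const g)
  then show ?thesis unfolding code_computable_def using g(2) by (intro exI[of _ "\<lambda>c. prod_encode (2, g c)"]) simp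
qed

lemma code_computable_Conj:
  assumes "code_computable F"
  shows "code_computable (\<lambda>\<phi>. Conj \<psi> (F \<phi>))"
proof -
  from assms obtain g where g: "computable1 g" "\<forall>\<phi>. fm_code (F \<phi>) = g (fm_code \<phi>)"
    unfolding code_computable_def by blast
  have "computable1 (\<lambda>c. prod_encode (3, prod_encode (fm_code \<psi>, g c)))"
    by (intro computable1_prod_encode computable1_const g)
  then show ?thesis unfolding code_computable_def using g(2)
    by (intro exI[of _ "\<lambda>c. prod_encode (3, prod_encode (fm_code \<psi>, g c))"]) simp
qed

lemma code_computable_Disj:
  assumes "code_computable F"
  shows "code_computable (\<lambda>\<phi>. Disj \<psi> (F \<phi>))"
proof -
  from assms obtain g where g: "computable1 g" "\<forall>\<phi>. fm_code (F \<phi>) = g (fm_code \<phi>)"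
    unfolding code_computable_def by blast
  have "computable1 (\<lambda>c. prod_encode (4, prod_encode (fm_code \<psi>, g c)))"
    by (intro computable1_prod_encode computable1_const g)
  then show ?thesis unfolding code_computable_def using g(2)
    by (intro exI[of _ "\<lambda>c. prod_encode (4, prod_encode (fm_code \<psi>, g c))"]) simp
qed

lemma code_computable_Exists:
  assumes "code_computable F"
  shows "code_computable (\<lambda>\<phi>. Exists x (F \<phi>))"
proof -
  from assms obtain g where g: "computable1 g" "\<forall>\<phi>. fm_code (F \<phi>) = g (fm_code \<phi>)"
    unfolding code_computable_def by blast
  have "computable1 (\<lambda>c. prod_encode (6, prod_encode (x, g c)))"
    by (intro computable1_prod_encode computable1_const g)
  then show ?thesis unfolding code_computable_def using g(2)
    by (intro exI[of _ "\<lambda>c. prod_encode (6, prod_encode (x, g c))"]) simp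
qed

lemma code_computable_foldr_Exists:
  assumes "code_computable F"
  shows "code_computable (\<lambda>\<phi>. foldr Exists vs (F \<phi>))"
  using assms by (induction vs) (simp_all add: code_computable_Exists)

lemma code_computable_step: "code_computable (step \<sigma>)"
  unfolding step_def exL_def
  by (intro code_computable_Exists code_computable_Conj code_computable_id)

lemma code_computable_obstruction_free: "code_computable obstruction_free"
  unfolding obstruction_free_def exL_def
  by (intro code_computable_Neg code_computable_foldr_Exists code_computable_Conj code_computable_Disj
      code_computable_Exists code_computable_id)

text \<open>\<open>D\<close> and \<open>L\<close> depend on \<open>r\<close> and
  \<open>\<sigma>\<close>, so \<open>\<theta>\<close> and \<open>\<chi>\<close> are available before
  \<open>n\<close> is fixed as the code of \<open>\<chi>\<close>. Then \<open>D\<close> maps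
  \<open>n\<close> to the code of \<open>\<phi>\<close>, and \<open>L\<close> at \<open>n\<close>
  refers to the computation of \<open>r\<close> on that very code.\<close>

lemma diagonal_sentence:
  "\<exists>\<phi>. sentence \<phi> \<and> hereditary \<phi> \<and> (\<exists>k. obstructions_le k \<phi>) \<and>
     (\<forall>c. computes r [fm_code \<phi>] c \<longrightarrow> (\<exists>G\<in>fin_graphs - Graph_fin \<phi>.
        \<forall>W\<subseteq>verts G. W \<noteq> {} \<longrightarrow> card W \<le> Suc c \<longrightarrow> induced G W \<in> Graph_fin \<phi>))"
proof -
  have "definable {0, 1} (\<lambda>e. e 1 = Suc (e 0))" by (rule definable_Suc) auto
  then obtain \<sigma> where fv\<sigma>: "fv \<sigma> \<subseteq> {..<10} \<union> (+) 10 ` {0, 1}"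
    and sat\<sigma>: "\<And>(G :: nat graph) s N a b d e. at_labels coded G (map s [0..<10]) N a b d \<Longrightarrow>
      \<forall>i\<in>{0, 1}. e i \<le> N \<and> s (10 + i) = a (e i) \<Longrightarrow> sat G s \<sigma> \<longleftrightarrow> e 1 = Suc (e 0)"
    unfolding definable_def by blast
  from code_computable_step[of \<sigma>] obtain g where g: "computable1 g" "\<And>\<phi>. fm_code (step \<sigma> \<phi>) = g (fm_code \<phi>)"
    unfolding code_computable_def by blast
  from code_computable_obstruction_free obtain f where
    f: "computable1 f" "\<And>\<phi>. fm_code (obstruction_free \<phi>) = f (fm_code \<phi>)"
    unfolding code_computable_def by blast
  from computable1_diagonal[OF f(1) g(1)] obtain D where D: "\<And>n. computes D [n] (f ((g ^^ n) n))"
    unfolding computable1_def by blast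
  obtain L where L: "definable {0, 1} (\<lambda>e. L (e 1) (e 0))" "\<And>N n. L N n \<Longrightarrow> n < N"
    "\<And>N M n. L N n \<Longrightarrow> L M n \<Longrightarrow> N = M"
    "\<And>n c. computes (Comp r [D]) [n] c \<Longrightarrow> \<exists>N. L N n"
    "\<And>N n c. L N n \<Longrightarrow> computes (Comp r [D]) [n] c \<Longrightarrow> c < N"
    using ex_definable_halting[of "Comp r [D]"] by blast
  from L(1) obtain \<theta> where fv\<theta>: "fv \<theta> \<subseteq> {..<10} \<union> (+) 10 ` {0, 1}"
    and sat\<theta>: "\<And>(G :: nat graph) s N a b d e. at_labels coded G (map s [0..<10]) N a b d \<Longrightarrow>
      \<forall>i\<in>{0, 1}. e i \<le> N \<and> s (10 + i) = a (e i) \<Longrightarrow> sat G s \<theta> \<longleftrightarrow> L (e 1) (e 0)"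
    unfolding definable_def by blast
  \<comment> \<open>Label \<open>5\<close> marks the last element, so variable \<open>11\<close>
    holds element \<open>N\<close>, and \<open>\<chi>\<close> states \<open>L N k\<close> when
    variable \<open>10\<close> holds element \<open>k\<close>.\<close>
  define \<chi> where "\<chi> = exL [5] 11 \<theta>"
  define n where "n = fm_code \<chi>"
  define \<phi> where "\<phi> = obstruction_free ((step \<sigma> ^^ n) \<chi>)"
  have code: "fm_code \<phi> = f ((g ^^ n) n)"
  proof -
    have "fm_code ((step \<sigma> ^^ m) \<chi>) = (g ^^ m) n" for m
      by (induction m) (simp_all add: n_def g(2))
    then show ?thesis by (simp add: \<phi>_def f(2))
  qed
  have fv: "fv ((step \<sigma> ^^ m) \<chi>) \<subseteq> {..<10} \<union> {10}" for m
  proof (induction m)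
    case 0
    then show ?case using fv\<theta> fv_exL[of "[5]" 11 \<theta>] by (auto simp: \<chi>_def)
  next
    case (Suc m)
    then show ?case using fv\<sigma> fv_step[of \<sigma> "(step \<sigma> ^^ m) \<chi>"] by auto
  qed
  have sent: "sentence \<phi>" unfolding \<phi>_def by (rule sentence_obstruction_free[OF fv])
  have sat\<chi>: "sat G s \<chi> \<longleftrightarrow> L N k"
    if c: "at_labels coded G (map s [0..<10]) N a b d" and k: "k \<le> N" "s 10 = a k"
    for G :: "nat graph" and s N a b d k
  proof -
    have "labelled G (map s [0..<10]) (set [5]) = {a N}"
      using c by (simp add: at_labels_def coded_def del: upt.simps upt_rec_numeral One_nat_def)
    then have "sat G s \<chi> \<longleftrightarrow> sat G (s(11 := a N)) \<theta>" unfolding \<chi>_def by (subst sat_exL) simp_all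
    also have "\<dots> \<longleftrightarrow> L ((\<lambda>i. if i = 0 then k else N) (1 :: nat)) ((\<lambda>i. if i = 0 then k else N) (0 :: nat))"
    proof (rule sat\<theta>)
      have "map (s(11 := a N)) [0..<10] = map s [0..<10]" by (rule map_upd_params) simp
      then show "at_labels coded G (map (s(11 := a N)) [0..<10]) N a b d" using c by (simp only:)
    qed (use k in simp_all)
    finally show ?thesis by simp
  qed
  have sat\<sigma>': "sat G s \<sigma> \<longleftrightarrow> l = Suc k"
    if c: "at_labels coded G (map s [0..<10]) N a b d" and k: "k \<le> N" "l \<le> N" "s 10 = a k" "s 11 = a l"
    for G :: "nat graph" and s N a b d k l
    using sat\<sigma>[OF c, of "\<lambda>i. if i = 0 then k else l"] k by simp
  have models: "models G \<phi> \<longleftrightarrow> \<not> obstructed (\<lambda>N. L N n) G" if G: "G \<in> fin_graphs" for G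
    unfolding \<phi>_def
  proof (rule models_obstruction_free_iff[OF G sent[unfolded \<phi>_def]])
    fix s N a b d
    assume c: "at_labels coded G (map s [0..<10]) N a b d" and s: "s 10 = a 0"
    have "sat G s ((step \<sigma> ^^ n) \<chi>) \<longleftrightarrow> 0 + n \<le> N \<and> L N (0 + n)"
      by (rule sat_step[OF c sat\<sigma>' sat\<chi> _ s]) simp_all
    \<comment> \<open>\<open>L N n\<close> entails \<open>n < N\<close>, so the demand that the
      chain be long enough is met automatically.\<close>
    then show "sat G s ((step \<sigma> ^^ n) \<chi>) \<longleftrightarrow> L N n" using L(2)[of N n] by auto
  qed
  then have Graph: "G \<in> Graph_fin \<phi> \<longleftrightarrow> \<not> obstructed (\<lambda>N. L N n) G" if "G \<in> fin_graphs" for G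
    using that by (simp add: Graph_fin_def)
  have "hereditary \<phi>"
    unfolding hereditary_def
  proof (intro ballI allI impI)
    fix G W assume G: "G \<in> Graph_fin \<phi>" and W: "W \<subseteq> verts G" "W \<noteq> {}"
    have "G \<in> fin_graphs" using G by (simp add: Graph_fin_def)
    then show "induced G W \<in> Graph_fin \<phi>"
      using G W Graph fin_graphs_induced obstructed_if_induced by metis
  qed
  moreover have "\<exists>k. obstructions_le k \<phi>"
  proof -
    \<comment> \<open>At most one \<open>N\<close> satisfies \<open>L N n\<close>, so a bound exists
      whether or not \<open>r\<close> halts; it need not be computable.\<close>
    obtain M where M: "\<And>N. L N n \<Longrightarrow> N \<le> M" using L(3) by (metis order_refl)
    have "obstructions_le (23 + 3 * Suc M) \<phi>"
      unfolding obstructions_le_def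
    proof
      fix G assume G: "G \<in> fin_graphs - Graph_fin \<phi>"
      then have "finite (verts G)" "obstructed (\<lambda>N. L N n) G" using Graph by (auto simp: fin_graphs_def)
      from obstructed_small[OF this M] obtain W where W: "W \<subseteq> verts G" "W \<noteq> {}" "card W \<le> 23 + 3 * Suc M"
        "obstructed (\<lambda>N. L N n) (induced G W)" by blast
      then have "induced G W \<notin> Graph_fin \<phi>" using Graph fin_graphs_induced G by blast
      then show "\<exists>W\<subseteq>verts G. W \<noteq> {} \<and> card W \<le> 23 + 3 * Suc M \<and> induced G W \<notin> Graph_fin \<phi>" using W by blast
    qed
    then show ?thesis by blast
  qed
  moreover have "\<exists>G\<in>fin_graphs - Graph_fin \<phi>. \<forall>W\<subseteq>verts G. W \<noteq> {} \<longrightarrow> card W \<le> Suc c \<longrightarrow> induced G W \<in> Graph_fin \<phi>"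
    if "computes r [fm_code \<phi>] c" for c
  proof -
    have c: "computes (Comp r [D]) [n] c" using that D unfolding code by (rule computes_Comp1[rotated])
    from L(4)[OF this] obtain N where N: "L N n" by blast
    have "c < N" using L(5)[OF N c] .
    have G: "chain_graph N \<in> fin_graphs" by (rule chain_graph_fin_graphs)
    have "chain_graph N \<notin> Graph_fin \<phi>"
      using obstructed_chain_graph[of "\<lambda>N. L N n" N] N \<open>c < N\<close> Graph[OF G] by auto
    moreover have "induced (chain_graph N) W \<in> Graph_fin \<phi>"
      if W: "W \<subseteq> verts (chain_graph N)" "W \<noteq> {}" "card W \<le> Suc c" for W
    proof (rule ccontr)
      assume "induced (chain_graph N) W \<notin> Graph_fin \<phi>"
      then have "obstructed (\<lambda>N. L N n) (induced (chain_graph N) W)"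
        using Graph fin_graphs_induced[OF G W(1,2)] by blast
      from obstructed_induced_chain_graph[OF W(1) this] obtain M where "L M n" "M < card W"
        using \<open>c < N\<close> by auto
      \<comment> \<open>Uniqueness gives \<open>M = N\<close>, but
        \<open>M < card W \<le> Suc c \<le> N\<close>.\<close>
      then show False using L(3)[OF N] W(3) \<open>c < N\<close> by auto
    qed
    ultimately show ?thesis using G by blast
  qed
  ultimately show ?thesis using sent by blast
qed

theorem theorem1p3:
  shows "\<not> (\<exists>r. \<forall>\<phi>. sentence \<phi> \<and> (\<exists>\<mu>. universal_sentence \<mu> \<and> Graph_fin \<phi> = Graph_fin \<mu>) \<longrightarrow>
            (\<exists>\<mu>. computes r [fm_code \<phi>] (fm_code \<mu>) \<and>
                 universal_sentence \<mu> \<and> Graph_fin \<phi> = Graph_fin \<mu>))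
       \<and> \<not> (\<exists>r. \<forall>\<phi>. sentence \<phi> \<and>
              (\<exists>\<F>. finite \<F> \<and> \<F> \<subseteq> fin_graphs \<and> Graph_fin \<phi> = Forb_fin \<F>) \<longrightarrow>
            (\<exists>\<F>. computes r [fm_code \<phi>] (graph_set_code \<F>) \<and>
                 finite \<F> \<and> \<F> \<subseteq> fin_graphs \<and> Graph_fin \<phi> = Forb_fin \<F>))"
proof (intro conjI notI; elim exE)
  fix r
  assume r: "\<forall>\<phi>. sentence \<phi> \<and> (\<exists>\<mu>. universal_sentence \<mu> \<and> Graph_fin \<phi> = Graph_fin \<mu>) \<longrightarrow>
            (\<exists>\<mu>. computes r [fm_code \<phi>] (fm_code \<mu>) \<and> universal_sentence \<mu> \<and> Graph_fin \<phi> = Graph_fin \<mu>)"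
  obtain \<phi> k where \<phi>: "sentence \<phi>" "hereditary \<phi>" "obstructions_le k \<phi>"
    and big: "\<And>c. computes r [fm_code \<phi>] c \<Longrightarrow> \<exists>G\<in>fin_graphs - Graph_fin \<phi>.
        \<forall>W\<subseteq>verts G. W \<noteq> {} \<longrightarrow> card W \<le> Suc c \<longrightarrow> induced G W \<in> Graph_fin \<phi>"
    using diagonal_sentence[of r] by blast
  obtain \<F> where "finite \<F>" "\<F> \<subseteq> fin_graphs" "Graph_fin \<phi> = Forb_fin \<F>"
    using Forb_fin_if_obstructions_le[OF \<phi>] by blast
  then have "\<exists>\<mu>. universal_sentence \<mu> \<and> Graph_fin \<phi> = Graph_fin \<mu>"
    using universal_sentence_Forb_fin[of \<F>] by auto
  then obtain \<mu> where \<mu>: "computes r [fm_code \<phi>] (fm_code \<mu>)" "universal_sentence \<mu>" "Graph_fin \<phi> = Graph_fin \<mu>"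
    using r \<phi>(1) by blast
  from big[OF \<mu>(1)] show False
    using universal_sentence_obstructions_le[OF \<mu>(2)] unfolding obstructions_le_def \<mu>(3) by meson
next
  fix r
  assume r: "\<forall>\<phi>. sentence \<phi> \<and> (\<exists>\<F>. finite \<F> \<and> \<F> \<subseteq> fin_graphs \<and> Graph_fin \<phi> = Forb_fin \<F>) \<longrightarrow>
            (\<exists>\<F>. computes r [fm_code \<phi>] (graph_set_code \<F>) \<and>
                 finite \<F> \<and> \<F> \<subseteq> fin_graphs \<and> Graph_fin \<phi> = Forb_fin \<F>)"
  obtain \<phi> k where \<phi>: "sentence \<phi>" "hereditary \<phi>" "obstructions_le k \<phi>"
    and big: "\<And>c. computes r [fm_code \<phi>] c \<Longrightarrow> \<exists>G\<in>fin_graphs - Graph_fin \<phi>.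
        \<forall>W\<subseteq>verts G. W \<noteq> {} \<longrightarrow> card W \<le> Suc c \<longrightarrow> induced G W \<in> Graph_fin \<phi>"
    using diagonal_sentence[of r] by blast
  obtain \<F> where \<F>: "computes r [fm_code \<phi>] (graph_set_code \<F>)" "finite \<F>" "\<F> \<subseteq> fin_graphs"
    "Graph_fin \<phi> = Forb_fin \<F>"
    using r Forb_fin_if_obstructions_le[OF \<phi>] \<phi>(1) by blast
  from big[OF \<F>(1)] show False
    using Forb_fin_small_obstruction[OF \<F>(2,3)] unfolding \<F>(4) by (meson le_SucI)
qed

end
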